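(* The decision problem DRBN (given a nonempty graph $G$ and a positive integer $k$, decide whether $b_{dR}(G)\leq k$) is NP-hard, even when the input graphs are restricted to bipartite graphs.
   Context: All graphs are finite, simple and undirected; a nonempty graph is one with at least one edge. For a graph $G=(V,E)$, a double Roman dominating function (DRDF) is a function $f:V\to\{0,1,2,3\}$ such that every vertex $v$ with $f(v)=0$ has at least two neighbors $u$ with $f(u)=2$ or at least one neighbor $w$ with $f(w)=3$, and every vertex $v$ with $f(v)=1$ has at least one neighbor $w$ with $f(w)\geq 2$. The weight of $f$ is $\sum_{u\in V}f(u)$, and $\gamma_{dR}(G)$ is the minimum weight of a DRDF on $G$. The double Roman bondage number $b_{dR}(G)$ is the minimum cardinality of an edge set $B\subseteq E(G)$ such that $\gamma_{dR}(G-B)>\gamma_{dR}(G)$. The problem DRBN has as instance a nonempty graph $G$ and a positive integer $k$, and asks whether $b_{dR}(G)\leq k$. *)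

theory Defs
  imports Main "HOL-Computational_Algebra.Polynomial"
begin

section \<open>Multi-tape Turing machines\<close>

text \<open>
  States and tape symbols are natural numbers; finiteness of the transition relation makes
  the reachable states and the symbols ever written finite in number. Symbol 0 is the blank, the
  input bits are the symbols 1 and 2. Tapes are infinite in both directions and numbered from 0;
  tape 0 holds the input and the last tape holds the output (they coincide for a one-tape machine).
\<close>

datatype move = MLeft | MStay | MRight

fun shift :: "move \<Rightarrow> int" where
  "shift MLeft = -1"
| "shift MStay = 0"
| "shift MRight = 1"

record tm =
  tapes :: nat
  trans :: "((nat \<times> nat list) \<times> (nat \<times> nat list \<times> move list)) set"
  start :: nat
  accepting :: "nat set"

definition wf_tm :: "tm \<Rightarrow> bool" where
  "wf_tm M \<longleftrightarrow> 1 \<le> tapes M \<and> finite (trans M) \<and>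
     (\<forall>((q, rs), (q', ws, ds)) \<in> trans M.
        length rs = tapes M \<and> length ws = tapes M \<and> length ds = tapes M)"

definition deterministic :: "tm \<Rightarrow> bool" where
  "deterministic M \<longleftrightarrow> single_valued (trans M)"

text \<open>A configuration: state, contents of each tape, head position on each tape.\<close>

type_synonym config = "nat \<times> (nat \<Rightarrow> int \<Rightarrow> nat) \<times> (nat \<Rightarrow> int)"

inductive step :: "tm \<Rightarrow> config \<Rightarrow> config \<Rightarrow> bool" for M where
  "((q, map (\<lambda>j. T j (h j)) [0..<tapes M]), (q', ws, ds)) \<in> trans M \<Longrightarrow>
   step M (q, T, h)
     (q', (\<lambda>j. if j < tapes M then (T j)(h j := ws ! j) else T j),
          (\<lambda>j. if j < tapes M then h j + shift (ds ! j) else h j))"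

definition halted :: "tm \<Rightarrow> config \<Rightarrow> bool" where
  "halted M c \<longleftrightarrow> (\<nexists>c'. step M c c')"

definition tape_of :: "bool list \<Rightarrow> int \<Rightarrow> nat" where
  "tape_of x i = (if 0 \<le> i \<and> nat i < length x then (if x ! nat i then 2 else 1) else 0)"

definition init :: "tm \<Rightarrow> bool list \<Rightarrow> config" where
  "init M x = (start M, (\<lambda>j. if j = 0 then tape_of x else (\<lambda>_. 0)), (\<lambda>_. 0))"

text \<open>Every computation (on every nondeterministic branch) halts within the time bound.\<close>

definition runs_in_time :: "tm \<Rightarrow> (nat \<Rightarrow> nat) \<Rightarrow> bool" where
  "runs_in_time M t \<longleftrightarrow> (\<forall>x n c. (step M ^^ n) (init M x) c \<longrightarrow> n \<le> t (length x))"

definition poly_time :: "tm \<Rightarrow> bool" where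
  "poly_time M \<longleftrightarrow> (\<exists>p :: nat poly. runs_in_time M (poly p))"

definition accepts :: "tm \<Rightarrow> bool list \<Rightarrow> bool" where
  "accepts M x \<longleftrightarrow> (\<exists>c. (step M)\<^sup>*\<^sup>* (init M x) c \<and> halted M c \<and> fst c \<in> accepting M)"

definition computes :: "tm \<Rightarrow> (bool list \<Rightarrow> bool list) \<Rightarrow> bool" where
  "computes M f \<longleftrightarrow>
     (\<forall>x. \<exists>q T h. (step M)\<^sup>*\<^sup>* (init M x) (q, T, h) \<and> halted M (q, T, h) \<and>
                  T (tapes M - 1) = tape_of (f x))"


section \<open>NP and NP-hardness\<close>

definition NP :: "bool list set set" where
  "NP = {L. \<exists>M. wf_tm M \<and> poly_time M \<and> L = {x. accepts M x}}"

definition poly_time_computable :: "(bool list \<Rightarrow> bool list) \<Rightarrow> bool" where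
  "poly_time_computable f \<longleftrightarrow>
     (\<exists>M. wf_tm M \<and> deterministic M \<and> poly_time M \<and> computes M f)"

text \<open>
  A decision problem is given by a set of instances, a predicate selecting the yes-instances and
  an encoding of instances as bit strings. A many-one reduction to it must map every
  string to (the code of) an instance; hence restricting the set of instances
  is a genuine restriction of the inputs that the reduction may produce.
\<close>

definition NP_hard :: "('i \<Rightarrow> bool list) \<Rightarrow> 'i set \<Rightarrow> ('i \<Rightarrow> bool) \<Rightarrow> bool" where
  "NP_hard enc I yes \<longleftrightarrow>
     (\<forall>L \<in> NP. \<exists>f. poly_time_computable f \<and>
        (\<forall>x. f x \<in> enc ` I \<and> (x \<in> L \<longleftrightarrow> f x \<in> enc ` {i \<in> I. yes i})))"


section \<open>Graphs and double Roman domination\<close>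

definition simple_graph :: "'a set \<Rightarrow> 'a set set \<Rightarrow> bool" where
  "simple_graph V E \<longleftrightarrow> finite V \<and> (\<forall>e \<in> E. e \<subseteq> V \<and> card e = 2)"

definition bipartite :: "'a set \<Rightarrow> 'a set set \<Rightarrow> bool" where
  "bipartite V E \<longleftrightarrow>
     (\<exists>X Y. X \<union> Y = V \<and> X \<inter> Y = {} \<and> (\<forall>e \<in> E. \<exists>x \<in> X. \<exists>y \<in> Y. e = {x, y}))"

definition neighbors :: "'a set set \<Rightarrow> 'a \<Rightarrow> 'a set" where
  "neighbors E v = {u. {u, v} \<in> E}"

definition drdf :: "'a set \<Rightarrow> 'a set set \<Rightarrow> ('a \<Rightarrow> nat) \<Rightarrow> bool" where
  "drdf V E f \<longleftrightarrow> f ` V \<subseteq> {0, 1, 2, 3} \<and>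
     (\<forall>v \<in> V. f v = 0 \<longrightarrow>
        2 \<le> card {u \<in> neighbors E v. f u = 2} \<or> (\<exists>w \<in> neighbors E v. f w = 3)) \<and>
     (\<forall>v \<in> V. f v = 1 \<longrightarrow> (\<exists>w \<in> neighbors E v. 2 \<le> f w))"

definition gamma_dR :: "'a set \<Rightarrow> 'a set set \<Rightarrow> nat" where
  "gamma_dR V E = (LEAST w. \<exists>f. drdf V E f \<and> w = (\<Sum>u \<in> V. f u))"

definition b_dR :: "'a set \<Rightarrow> 'a set set \<Rightarrow> nat" where
  "b_dR V E = (LEAST m. \<exists>B. B \<subseteq> E \<and> card B = m \<and> gamma_dR V E < gamma_dR V (E - B))"

text \<open>Both minima are attained, the second one for graphs with at least one edge.\<close>

lemma drdf_const_2: "drdf V E (\<lambda>_. 2)"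
  by (auto simp: drdf_def)

lemma gamma_dR_attained: "\<exists>f. drdf V E f \<and> gamma_dR V E = (\<Sum>u \<in> V. f u)"
  unfolding gamma_dR_def by (rule LeastI_ex) (use drdf_const_2 in blast)

lemma gamma_dR_le: "drdf V E f \<Longrightarrow> gamma_dR V E \<le> (\<Sum>u \<in> V. f u)"
  unfolding gamma_dR_def by (rule Least_le) blast

lemma b_dR_attained:
  assumes G: "simple_graph V E" and "E \<noteq> {}"
  shows "\<exists>B. B \<subseteq> E \<and> card B = b_dR V E \<and> gamma_dR V E < gamma_dR V (E - B)"
proof -
  from G have fin: "finite V" by (simp add: simple_graph_def)
  obtain e where e: "e \<in> E" using \<open>E \<noteq> {}\<close> by blast
  then obtain a b where ab: "e = {a, b}" "a \<noteq> b" "a \<in> V" "b \<in> V"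
    using G unfolding simple_graph_def by (metis card_2_iff insert_subset)
  define g :: "'a \<Rightarrow> nat" where "g = (\<lambda>_. 2)(a := 3, b := 0)"
  have split: "(\<Sum>u \<in> V. h u) = h a + (h b + (\<Sum>u \<in> V - {a} - {b}. h u))" for h :: "'a \<Rightarrow> nat"
    using sum.remove[of V a h] sum.remove[of "V - {a}" b h] fin ab by simp
  have "drdf V E g"
    using e ab unfolding drdf_def g_def by (auto simp: neighbors_def)
  then have "gamma_dR V E \<le> (\<Sum>u \<in> V. g u)" by (rule gamma_dR_le)
  also have "\<dots> = g a + (g b + (\<Sum>u \<in> V - {a} - {b}. g u))"
    by (rule split)
  also have "(\<Sum>u \<in> V - {a} - {b}. g u) = (\<Sum>u \<in> V - {a} - {b}. 2)"
    by (rule sum.cong) (auto simp: g_def)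
  also have "g a + (g b + (\<Sum>u \<in> V - {a} - {b}. 2)) < 2 + (2 + (\<Sum>u \<in> V - {a} - {b}. 2))"
    using ab by (simp add: g_def)
  also have "\<dots> = (\<Sum>u \<in> V. 2)"
    by (rule split[symmetric])
  finally have lt: "gamma_dR V E < (\<Sum>u \<in> V. 2)" .
  obtain f where f: "drdf V {} f" "gamma_dR V {} = (\<Sum>u \<in> V. f u)"
    using gamma_dR_attained by blast
  have "2 \<le> f u" if "u \<in> V" for u
  proof -
    have "f u \<noteq> 0" "f u \<noteq> 1" using f(1) that by (auto simp: drdf_def neighbors_def)
    then show ?thesis by linarith
  qed
  then have "(\<Sum>u \<in> V. 2) \<le> (\<Sum>u \<in> V. f u)" by (intro sum_mono) auto
  then have "gamma_dR V E < gamma_dR V (E - E)" using lt f(2) by simp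
  then have "\<exists>m B. B \<subseteq> E \<and> card B = m \<and> gamma_dR V E < gamma_dR V (E - B)" by blast
  then show ?thesis unfolding b_dR_def by (rule LeastI_ex)
qed


section \<open>The decision problem\<close>

text \<open>An instance \<open>(n, E, k)\<close> is the graph with vertex set \<open>{..<n}\<close> and edge set \<open>E\<close> together with \<open>k\<close>.\<close>

type_synonym drbn_instance = "nat \<times> nat set set \<times> nat"

definition DRBN_instances :: "drbn_instance set" where
  "DRBN_instances = {(n, E, k). simple_graph {..<n} E \<and> E \<noteq> {} \<and> 0 < k}"

definition bipartite_instances :: "drbn_instance set" where
  "bipartite_instances = {(n, E, k). bipartite {..<n} E}"

definition DRBN :: "drbn_instance \<Rightarrow> bool" where
  "DRBN = (\<lambda>(n, E, k). b_dR {..<n} E \<le> k)"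

text \<open>Binary representation, least significant bit first.\<close>

fun bin :: "nat \<Rightarrow> bool list" where
  "bin 0 = []"
| "bin (Suc n) = odd (Suc n) # bin (Suc n div 2)"

text \<open>The order in unary, a terminator, the adjacency matrix row by row, and \<open>k\<close> in binary.\<close>

definition encode :: "drbn_instance \<Rightarrow> bool list" where
  "encode = (\<lambda>(n, E, k).
     replicate n True @ [False] @
     concat (map (\<lambda>u. map (\<lambda>v. {u, v} \<in> E) [0..<n]) [0..<n]) @ bin k)"

lemma bin_inj: "bin m = bin n \<Longrightarrow> m = n"
proof (induction m arbitrary: n rule: bin.induct)
  case 1
  then show ?case by (cases n) auto
next
  case (2 m)
  then obtain n' where n: "n = Suc n'" by (cases n) auto
  with "2.prems" have "odd (Suc m) = odd (Suc n')" "bin (Suc m div 2) = bin (Suc n' div 2)"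
    by simp_all
  from this(1) have "Suc m mod 2 = Suc n' mod 2" by presburger
  moreover have "Suc m div 2 = Suc n' div 2"
    using \<open>bin (Suc m div 2) = bin (Suc n' div 2)\<close> by (rule "2.IH")
  ultimately show ?case using n by (metis div_mult_mod_eq)
qed

lemma encode_inj: "inj_on encode DRBN_instances"
proof (rule inj_onI)
  fix x y
  assume xy: "x \<in> DRBN_instances" "y \<in> DRBN_instances" "encode x = encode y"
  obtain n E k n' E' k' where x: "x = (n, E, k)" and y: "y = (n', E', k')"
    by (metis prod_cases3)
  note i = xy(1,2)[unfolded x y] and eq = xy(3)[unfolded x y]
  let ?A = "\<lambda>n E. concat (map (\<lambda>u. map (\<lambda>v. {u, v} \<in> E) [0..<n]) [0..<n])"
  have tw: "length (takeWhile id (encode (n, E, k))) = n" for n E k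
    by (simp add: encode_def takeWhile_append)
  have n: "n' = n" using tw[of n E k] tw[of n' E' k'] eq by simp
  have len: "length (?A n E) = length (?A n E')"
    by (simp add: length_concat comp_def)
  have A: "?A n E = ?A n E'" and "bin k = bin k'"
    using eq len by (simp_all add: encode_def n)
  then have k: "k = k'" using bin_inj by blast
  have "map (\<lambda>u. map (\<lambda>v. {u, v} \<in> E) [0..<n]) [0..<n] =
        map (\<lambda>u. map (\<lambda>v. {u, v} \<in> E') [0..<n]) [0..<n]"
    by (rule concat_injective[OF A]) (auto simp: set_zip)
  then have adj: "{u, v} \<in> E \<longleftrightarrow> {u, v} \<in> E'" if "u < n" "v < n" for u v
    using that by simp
  have "e \<in> E \<longleftrightarrow> e \<in> E'" for e
  proof -
    have "\<exists>u v. e = {u, v} \<and> u < n \<and> v < n" if "e \<in> E \<or> e \<in> E'"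
    proof -
      have "e \<subseteq> {..<n}" "card e = 2"
        using that i by (auto simp: DRBN_instances_def simple_graph_def n)
      then show ?thesis by (auto simp: card_2_iff)
    qed
    then show ?thesis using adj by metis
  qed
  then have "E = E'" by blast
  then show "x = y" using n k x y by simp
qed

end

theory Submission
  imports Defs
begin

text \<open>
  Every language in NP is reduced directly to the question whether the deletion of a single edge
  of a bipartite graph raises \<^const>\<open>gamma_dR\<close>, so \<open>k = 1\<close> throughout.

  A nondeterministic machine accepts \<open>x\<close> iff it can act for \<open>T\<close> steps when idling in
  accepting halting configurations is allowed. Such a run is described by unknowns with
  polynomially many values, one for the action at each time and one for each head position, subject
  to clauses that are disjunctions of statements that an unknown has a given value.

  In the graph, an unknown is a large complete bipartite block: at weight 6 a block must carry
  the value 3 on exactly one vertex of each side, which selects a value. A clause is a vertex joined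
  to the vertices of its literals and to six vertices of one special block. If the clauses
  are satisfiable then weight 6 per block suffices, and the special block admits only one
  configuration of weight 6, which the deletion of one edge destroys. Otherwise one extra
  unit lets the special block dominate all clauses, in three ways so different that at least one
  survives the deletion of an arbitrary edge.

  Adjacency in this graph is given by a term built from arithmetic, bounded sums and input lookup.
  A multi-tape machine that uses head positions as counters evaluates such terms in polynomial time.
\<close>

section \<open>Structured programs for multi-tape machines\<close>

text \<open>A clause costs one vertex whatever its length, and a value costs one vertex on each side
  of a block, so nothing is gained by first passing to short clauses or two-valued unknowns. The
  obstacle is the unsatisfiable case, in which no deletion anywhere may raise the minimum. For
  \<open>N\<close> blocks the minimum is \<open>6 * N\<close> or \<open>6 * N + 1\<close>. The
  number 6 comes from counting: among seven vertices of total weight at most 6 one has value 0, and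
  dominating it puts weight at least 3 on the opposite side, in a single vertex if the weight there
  is exactly 3. The extra unit turns a single 3 into 2 + 2 on a pair. In the special block the only
  X vertex able to carry a single 3 is vertex 0, which is joined to no clause, whereas each pair is
  joined to all clauses. Hence the extra unit buys exactly the domination of the clauses.\<close>

type_synonym tapeconf = "(nat \<Rightarrow> int \<Rightarrow> nat) \<times> (nat \<Rightarrow> int)"

datatype com =
    Act nat "nat \<Rightarrow> nat \<times> move"
  | Seq com com
  | While nat "nat set" com
  | If nat "nat set" com com

text \<open>In the rules for loops and branches the constants count the instructions that
  \<open>code\<close> adds: the test, and the jump back or past the other branch.
  \<open>weaken\<close> allows bounds that do not depend on the data.\<close>

inductive bs :: "com \<Rightarrow> tapeconf \<Rightarrow> nat \<Rightarrow> tapeconf \<Rightarrow> bool" where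
  Act: "g (T j (h j)) = (w, d) \<Longrightarrow>
    bs (Act j g) (T, h) 1 (T(j := (T j)(h j := w)), h(j := h j + shift d))"
| Seq: "bs c1 a m b \<Longrightarrow> bs c2 b n c \<Longrightarrow> bs (Seq c1 c2) a (m + n) c"
| WhileF: "T j (h j) \<notin> S \<Longrightarrow> bs (While j S c) (T, h) 1 (T, h)"
| WhileT: "T j (h j) \<in> S \<Longrightarrow> bs c (T, h) m b \<Longrightarrow> bs (While j S c) b n d \<Longrightarrow>
    bs (While j S c) (T, h) (m + n + 2) d"
| IfT: "T j (h j) \<in> S \<Longrightarrow> bs c1 (T, h) m b \<Longrightarrow> bs (If j S c1 c2) (T, h) (m + 2) b"
| IfF: "T j (h j) \<notin> S \<Longrightarrow> bs c2 (T, h) m b \<Longrightarrow> bs (If j S c1 c2) (T, h) (m + 1) b"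
| weaken: "bs c a m b \<Longrightarrow> m \<le> n \<Longrightarrow> bs c a n b"

text \<open>The symbols 0, 1, 2 must be preserved because \<open>machine\<close> tabulates its
  transitions on these symbols only, which keeps the relation finite.\<close>

fun wf_com :: "nat \<Rightarrow> com \<Rightarrow> bool" where
  "wf_com K (Act j g) \<longleftrightarrow> j < K \<and> (\<forall>a \<le> 2. fst (g a) \<le> 2)"
| "wf_com K (Seq c1 c2) \<longleftrightarrow> wf_com K c1 \<and> wf_com K c2"
| "wf_com K (While j S c) \<longleftrightarrow> j < K \<and> wf_com K c"
| "wf_com K (If j S c1 c2) \<longleftrightarrow> j < K \<and> wf_com K c1 \<and> wf_com K c2"

text \<open>An instruction inspects a single tape; from the symbol read it determines the next
  program counter, the symbol written and the move.\<close>

type_synonym instr = "nat \<times> (nat \<Rightarrow> nat \<times> nat \<times> move)"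

text \<open>Jump targets are absolute: \<open>p\<close> is the address of the first instruction, and
  every fragment exits at the address just past its end.\<close>

fun code :: "com \<Rightarrow> nat \<Rightarrow> instr list" where
  "code (Act j g) p = [(j, \<lambda>a. (Suc p, g a))]"
| "code (Seq c1 c2) p = code c1 p @ code c2 (p + length (code c1 p))"
| "code (While j S c) p =
     [(j, \<lambda>a. (if a \<in> S then Suc p else Suc (Suc (p + length (code c (Suc p)))), a, MStay))] @
     code c (Suc p) @ [(j, \<lambda>a. (p, a, MStay))]"
| "code (If j S c1 c2) p =
     (let n1 = length (code c1 (Suc p)); n2 = length (code c2 (Suc (Suc (p + n1)))) in
     [(j, \<lambda>a. (if a \<in> S then Suc p else Suc (Suc (p + n1)), a, MStay))] @
     code c1 (Suc p) @ [(j, \<lambda>a. (Suc (Suc (p + n1 + n2)), a, MStay))] @ code c2 (Suc (Suc (p + n1))))"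

definition succ_of :: "nat \<Rightarrow> instr \<Rightarrow> nat list \<Rightarrow> nat \<times> nat list \<times> move list" where
  "succ_of K ins rs = (case ins of (j, g) \<Rightarrow> case g (rs ! j) of (q', w, d) \<Rightarrow>
     (q', rs[j := w], (replicate K MStay)[j := d]))"

text \<open>The program counter is the state, so the address past the last instruction has no
  transition and is the halting state.\<close>

definition machine :: "nat \<Rightarrow> instr list \<Rightarrow> tm" where
  "machine K prog = \<lparr>tapes = K,
     trans = (\<lambda>(q, rs). ((q, rs), succ_of K (prog ! q) rs)) `
       ({..<length prog} \<times> {rs. set rs \<subseteq> {..2} \<and> length rs = K}),
     start = 0, accepting = {}\<rparr>"

lemma tapes_machine [simp]: "tapes (machine K prog) = K"
  by (simp add: machine_def)

lemma wf_machine: "1 \<le> K \<Longrightarrow> wf_tm (machine K prog)"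
  unfolding wf_tm_def machine_def
  by (auto simp: succ_of_def finite_lists_length_eq split: prod.splits)

lemma deterministic_machine: "deterministic (machine K prog)"
  unfolding deterministic_def machine_def single_valued_def by (clarsimp simp: image_iff) (metis prod.inject)

lemma halted_machine: "halted (machine K prog) (length prog, T, h)"
  unfolding halted_def by (auto elim!: step.cases simp: machine_def)

lemma step_machine:
  assumes "q < length prog" "prog ! q = (j, g)" "j < K" "\<forall>j i. T j i \<le> 2"
    and g: "g (T j (h j)) = (q', w, d)"
  shows "step (machine K prog) (q, T, h) (q', T(j := (T j)(h j := w)), h(j := h j + shift d))"
proof -
  let ?rs = "map (\<lambda>j. T j (h j)) [0..<K]"
  let ?ds = "(replicate K MStay)[j := d]"
  have "((q, ?rs), succ_of K (prog ! q) ?rs) \<in> trans (machine K prog)"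
    using assms(1,4) by (auto simp: machine_def intro!: image_eqI[where x = "(q, ?rs)"])
  moreover have "succ_of K (prog ! q) ?rs = (q', ?rs[j := w], ?ds)"
    using assms by (simp add: succ_of_def)
  ultimately have "((q, ?rs), (q', ?rs[j := w], ?ds)) \<in> trans (machine K prog)"
    by simp
  then have "step (machine K prog) (q, T, h)
     (q', (\<lambda>i. if i < K then (T i)(h i := ?rs[j := w] ! i) else T i),
          (\<lambda>i. if i < K then h i + shift (?ds ! i) else h i))"
    using step.intros[of q T h "machine K prog" q' "?rs[j := w]" ?ds] by simp
  moreover have "(\<lambda>i. if i < K then (T i)(h i := ?rs[j := w] ! i) else T i) = T(j := (T j)(h j := w))"
    using \<open>j < K\<close> by (auto simp: fun_eq_iff nth_list_update)
  moreover have "(\<lambda>i. if i < K then h i + shift (?ds ! i) else h i) = h(j := h j + shift d)"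
    using \<open>j < K\<close> by (auto simp: fun_eq_iff nth_list_update)
  ultimately show ?thesis by simp
qed

lemma step_machine_test:
  assumes "q < length prog" "prog ! q = (j, \<lambda>a. (n a, a, MStay))" "j < K" "\<forall>j i. T j i \<le> 2"
  shows "step (machine K prog) (q, T, h) (n (T j (h j)), T, h)"
  using step_machine[OF assms(1-4), of h] by simp

section \<open>Correctness of the compilation to machines\<close>

definition has_code :: "instr list \<Rightarrow> nat \<Rightarrow> instr list \<Rightarrow> bool" where
  "has_code prog p is \<longleftrightarrow> (\<exists>xs ys. prog = xs @ is @ ys \<and> length xs = p)"

lemma has_code_append:
  "has_code prog p (is1 @ is2) \<longleftrightarrow> has_code prog p is1 \<and> has_code prog (p + length is1) is2"
proof
  assume "has_code prog p (is1 @ is2)"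
  then obtain xs ys where "prog = xs @ is1 @ is2 @ ys" "length xs = p"
    by (auto simp: has_code_def)
  then show "has_code prog p is1 \<and> has_code prog (p + length is1) is2"
    unfolding has_code_def by (metis append.assoc length_append)
next
  assume "has_code prog p is1 \<and> has_code prog (p + length is1) is2"
  then obtain xs ys xs' ys' where *: "prog = xs @ is1 @ ys" "length xs = p"
    "prog = xs' @ is2 @ ys'" "length xs' = p + length is1"
    unfolding has_code_def by blast
  then have "xs @ is1 = xs'"
    by (metis append.assoc append_eq_append_conv length_append)
  with *(3) have "prog = xs @ (is1 @ is2) @ ys'" by auto
  with *(2) show "has_code prog p (is1 @ is2)" unfolding has_code_def by blast
qed

lemma has_code_Cons:
  "has_code prog p (i # is) \<longleftrightarrow> p < length prog \<and> prog ! p = i \<and> has_code prog (p + 1) is"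
proof -
  have "has_code prog p [i] \<longleftrightarrow> p < length prog \<and> prog ! p = i"
    unfolding has_code_def
    by (auto simp: nth_append) (metis append_Cons append_Nil id_take_nth_drop length_take min.absorb4)
  then show ?thesis using has_code_append[of prog p "[i]" "is"] by simp
qed

lemma bs_symbols:
  assumes "bs c a n b" "wf_com K c" "\<forall>j i. fst a j i \<le> 2"
  shows "\<forall>j i. fst b j i \<le> 2"
  using assms
proof (induction rule: bs.induct)
  case (Act g T j h w d)
  then have "fst (g (T j (h j))) \<le> 2" unfolding wf_com.simps by (metis fst_conv)
  with Act show ?case by simp
qed auto

text \<open>Time bounds in \<^const>\<open>bs\<close> are upper bounds, hence the quantifier over \<open>m\<close>.\<close>

lemma bs_compile:
  assumes "bs c a n b" "wf_com K c" "\<forall>j i. fst a j i \<le> 2" "has_code prog p (code c p)"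
  shows "\<exists>m\<le>n. (step (machine K prog) ^^ m) (p, a) (p + length (code c p), b)"
  using assms
proof (induction arbitrary: p rule: bs.induct)
  case (Act g T j h w d)
  then have "step (machine K prog) (p, T, h) (Suc p, T(j := (T j)(h j := w)), h(j := h j + shift d))"
    by (intro step_machine[where g = "\<lambda>a. (Suc p, g a)"]) (auto simp: has_code_Cons)
  then show ?case by (intro exI[of _ 1]) auto
next
  case (Seq c1 a m b c2 n c)
  from Seq.prems have hc: "has_code prog p (code c1 p)"
    "has_code prog (p + length (code c1 p)) (code c2 (p + length (code c1 p)))"
    by (auto simp: has_code_append)
  obtain m1 where m1: "m1 \<le> m" "(step (machine K prog) ^^ m1) (p, a) (p + length (code c1 p), b)"
    using Seq.IH(1)[OF _ _ hc(1)] Seq.prems by auto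
  have "\<forall>j i. fst b j i \<le> 2" using bs_symbols[OF Seq.hyps(1)] Seq.prems by auto
  then obtain m2 where m2: "m2 \<le> n" "(step (machine K prog) ^^ m2) (p + length (code c1 p), b)
     (p + length (code c1 p) + length (code c2 (p + length (code c1 p))), c)"
    using Seq.IH(2)[OF _ _ hc(2)] Seq.prems by auto
  have "(step (machine K prog) ^^ (m1 + m2)) (p, a)
     (p + length (code c1 p) + length (code c2 (p + length (code c1 p))), c)"
    using m1 m2 by (auto simp: relpowp_add)
  with m1 m2 show ?case by (intro exI[of _ "m1 + m2"]) (auto simp: add.assoc)
next
  case (WhileF T j h S c)
  have "step (machine K prog) (p, T, h) (Suc (Suc (p + length (code c (Suc p)))), T, h)"
    using WhileF step_machine_test[of p prog j
      "\<lambda>a. if a \<in> S then Suc p else Suc (Suc (p + length (code c (Suc p))))" K T h]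
    by (simp add: has_code_Cons)
  then show ?case by (intro exI[of _ 1]) auto
next
  case (WhileT T j h S c m b n d)
  let ?n = "length (code c (Suc p))"
  obtain Tb hb where b: "b = (Tb, hb)" by fastforce
  have hc: "has_code prog (Suc p) (code c (Suc p))"
    "Suc (p + ?n) < length prog" "prog ! (Suc (p + ?n)) = (j, \<lambda>a. (p, a, MStay))"
    using WhileT.prems by (auto simp: has_code_append has_code_Cons)
  have sym: "\<forall>j i. Tb j i \<le> 2" using bs_symbols[OF WhileT.hyps(2), of K] WhileT.prems b by auto
  have s1: "step (machine K prog) (p, T, h) (Suc p, T, h)"
    using WhileT step_machine_test[of p prog j "\<lambda>a. if a \<in> S then Suc p else Suc (Suc (p + ?n))" K T h]
    by (simp add: has_code_Cons)
  obtain m1 where m1: "m1 \<le> m" "(step (machine K prog) ^^ m1) (Suc p, T, h) (Suc (p + ?n), b)"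
    using WhileT.IH(1)[OF _ _ hc(1)] WhileT.prems by auto
  have s2: "step (machine K prog) (Suc (p + ?n), b) (p, b)"
    using WhileT.prems hc(2,3) sym step_machine_test[of "Suc (p + ?n)" prog j "\<lambda>a. p" K Tb hb] b
    by (simp add: has_code_Cons)
  obtain m2 where m2: "m2 \<le> n"
    "(step (machine K prog) ^^ m2) (p, b) (p + length (code (While j S c) p), d)"
    using WhileT.IH(2)[OF _ _ WhileT.prems(3)] WhileT.prems sym b by auto
  note relpowp_Suc_I2[OF s1 relpowp_trans[OF m1(2) relpowp_Suc_I2[OF s2 m2(2)]]]
  moreover have "Suc (m1 + Suc m2) \<le> m + n + 2" using m1(1) m2(1) by simp
  ultimately show ?case by blast
next
  case (IfT T j h S c1 m b c2)
  let ?n1 = "length (code c1 (Suc p))"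
  let ?n2 = "length (code c2 (Suc (Suc (p + ?n1))))"
  obtain Tb hb where b: "b = (Tb, hb)" by fastforce
  have hc: "has_code prog (Suc p) (code c1 (Suc p))"
    "Suc (p + ?n1) < length prog" "prog ! (Suc (p + ?n1)) = (j, \<lambda>a. (Suc (Suc (p + ?n1 + ?n2)), a, MStay))"
    using IfT.prems by (auto simp: has_code_append has_code_Cons Let_def)
  have sym: "\<forall>j i. Tb j i \<le> 2" using bs_symbols[OF IfT.hyps(2), of K] IfT.prems b by auto
  have s1: "step (machine K prog) (p, T, h) (Suc p, T, h)"
    using IfT step_machine_test[of p prog j "\<lambda>a. if a \<in> S then Suc p else Suc (Suc (p + ?n1))" K T h]
    by (simp add: has_code_Cons Let_def)
  obtain m1 where m1: "m1 \<le> m" "(step (machine K prog) ^^ m1) (Suc p, T, h) (Suc (p + ?n1), b)"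
    using IfT.IH[OF _ _ hc(1)] IfT.prems by auto
  have s2: "step (machine K prog) (Suc (p + ?n1), b) (Suc (Suc (p + ?n1 + ?n2)), b)"
    using IfT.prems hc(2,3) sym b
      step_machine_test[of "Suc (p + ?n1)" prog j "\<lambda>a. Suc (Suc (p + ?n1 + ?n2))" K Tb hb]
    by (simp add: has_code_Cons)
  have "(step (machine K prog) ^^ Suc (Suc m1)) (p, T, h) (Suc (Suc (p + ?n1 + ?n2)), b)"
    by (rule relpowp_Suc_I2[OF s1 relpowp_Suc_I[OF m1(2) s2]])
  moreover have "p + length (code (If j S c1 c2) p) = Suc (Suc (p + ?n1 + ?n2))"
    by (simp add: Let_def)
  moreover have "Suc (Suc m1) \<le> m + 2" using m1(1) by simp
  ultimately show ?case by metis
next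
  case (IfF T j h S c2 m b c1)
  let ?n1 = "length (code c1 (Suc p))"
  let ?n2 = "length (code c2 (Suc (Suc (p + ?n1))))"
  have hc: "has_code prog (Suc (Suc (p + ?n1))) (code c2 (Suc (Suc (p + ?n1))))"
    using IfF.prems by (auto simp: has_code_append has_code_Cons Let_def)
  have s1: "step (machine K prog) (p, T, h) (Suc (Suc (p + ?n1)), T, h)"
    using IfF step_machine_test[of p prog j "\<lambda>a. if a \<in> S then Suc p else Suc (Suc (p + ?n1))" K T h]
    by (simp add: has_code_Cons Let_def)
  obtain m1 where m1: "m1 \<le> m" "(step (machine K prog) ^^ m1) (Suc (Suc (p + ?n1)), T, h) (Suc (Suc (p + ?n1 + ?n2)), b)"
    using IfF.IH[OF _ _ hc] IfF.prems by auto
  note relpowp_Suc_I2[OF s1 m1(2)]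
  moreover have "p + length (code (If j S c1 c2) p) = Suc (Suc (p + ?n1 + ?n2))"
    by (simp add: Let_def)
  moreover have "Suc m1 \<le> m + 1" using m1(1) by simp
  ultimately show ?case by metis
next
  case (weaken c a m b n)
  then show ?case by (meson le_trans)
qed

section \<open>From one halting computation to polynomial-time computability\<close>

lemma step_deterministic:
  assumes "deterministic M" "step M c c1" "step M c c2"
  shows "c1 = c2"
proof -
  obtain q T h where c: "c = (q, T, h)" by (metis prod_cases3)
  let ?rs = "map (\<lambda>j. T j (h j)) [0..<tapes M]"
  let ?c = "\<lambda>(q', ws, ds). (q', (\<lambda>j. if j < tapes M then (T j)(h j := ws ! j) else T j),
          (\<lambda>j. if j < tapes M then h j + shift (ds ! j) else h j))"
  have ex: "\<exists>y. ((q, ?rs), y) \<in> trans M \<and> d = ?c y" if "step M c d" for d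
    using that unfolding c by cases force
  from ex[OF assms(2)] obtain y1 where y1: "((q, ?rs), y1) \<in> trans M" "c1 = ?c y1" by blast
  from ex[OF assms(3)] obtain y2 where y2: "((q, ?rs), y2) \<in> trans M" "c2 = ?c y2" by blast
  have "y1 = y2" using assms(1) y1(1) y2(1) unfolding deterministic_def by (rule single_valuedD)
  with y1(2) y2(2) show ?thesis by (simp only:)
qed

text \<open>Runs are unique, so a longer one would have to continue from the halted
  \<open>b\<close>. This turns the length of one halting computation into the bound on all partial
  runs that \<open>runs_in_time\<close> demands.\<close>

lemma deterministic_halts_first:
  assumes det: "deterministic M" and m: "(step M ^^ m) a b" "halted M b" and n: "(step M ^^ n) a c"
  shows "n \<le> m"
proof (rule ccontr)
  assume "\<not> n \<le> m"
  then have "m < n" by simp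
  then obtain k where k: "n = m + Suc k" by (auto dest: less_imp_Suc_add)
  have uniq: "(step M ^^ i) a x \<Longrightarrow> (step M ^^ i) a y \<Longrightarrow> x = y" for i x y
  proof (induction i arbitrary: x y)
    case (Suc i)
    from Suc.prems(1) obtain x' where "(step M ^^ i) a x'" "step M x' x" by (rule relpowp_Suc_E)
    moreover from Suc.prems(2) obtain y' where "(step M ^^ i) a y'" "step M y' y"
      by (rule relpowp_Suc_E)
    ultimately show ?case using Suc.IH[of x' y'] step_deterministic[OF det, of x'] by simp
  qed simp
  have "((step M ^^ m) OO (step M ^^ Suc k)) a c" using n unfolding k relpowp_add .
  then obtain b' where b': "(step M ^^ m) a b'" "(step M ^^ Suc k) b' c" by blast
  from b'(2) obtain d where "step M b' d" by (rule relpowp_Suc_E2)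
  with m uniq[OF b'(1) m(1)] show False unfolding halted_def by blast
qed

lemma poly_time_computable_by_com:
  fixes t :: "nat poly"
  assumes K: "1 \<le> K" and wf: "wf_com K c"
    and run: "\<And>x. \<exists>T h. bs c ((\<lambda>j. if j = 0 then tape_of x else (\<lambda>_. 0)), (\<lambda>_. 0))
        (poly t (length x)) (T, h) \<and> T (K - 1) = tape_of (f x)"
  shows "poly_time_computable f"
proof -
  define M where "M = machine K (code c 0)"
  have ex: "\<exists>m T h. m \<le> poly t (length x) \<and> (step M ^^ m) (init M x) (length (code c 0), T, h) \<and>
      T (K - 1) = tape_of (f x)" for x
  proof -
    obtain T h where 1: "bs c ((\<lambda>j. if j = 0 then tape_of x else (\<lambda>_. 0)), (\<lambda>_. 0))
        (poly t (length x)) (T, h)" and 2: "T (K - 1) = tape_of (f x)"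
      using run by blast
    have "\<exists>m\<le>poly t (length x). (step (machine K (code c 0)) ^^ m)
       (0, ((\<lambda>j. if j = 0 then tape_of x else (\<lambda>_. 0)), (\<lambda>_. 0))) (0 + length (code c 0), T, h)"
      by (rule bs_compile[OF 1 wf]) (auto simp: tape_of_def has_code_def)
    then show ?thesis using 2 by (auto simp: M_def init_def machine_def)
  qed
  have det: "deterministic M" by (simp add: M_def deterministic_machine)
  have hl: "halted M (length (code c 0), T, h)" for T h by (simp add: M_def halted_machine)
  have "runs_in_time M (poly t)"
    unfolding runs_in_time_def
  proof (intro allI impI)
    fix x n d assume n: "(step M ^^ n) (init M x) d"
    obtain m T h where m: "m \<le> poly t (length x)" "(step M ^^ m) (init M x) (length (code c 0), T, h)"
      using ex by blast
    show "n \<le> poly t (length x)" using deterministic_halts_first[OF det m(2) hl n] m(1) by simp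
  qed
  moreover have "computes M f"
    unfolding computes_def
  proof
    fix x
    obtain m T h where "(step M ^^ m) (init M x) (length (code c 0), T, h)" "T (K - 1) = tape_of (f x)"
      using ex by blast
    then show "\<exists>q T h. (step M)\<^sup>*\<^sup>* (init M x) (q, T, h) \<and> halted M (q, T, h) \<and>
        T (tapes M - 1) = tape_of (f x)"
      using hl[of T h] relpowp_imp_rtranclp[of m "step M"] by (metis M_def tapes_machine)
  qed
  ultimately show ?thesis
    unfolding poly_time_computable_def poly_time_def using det wf_machine[OF K] M_def by blast
qed

section \<open>Counter programs and arithmetic terms\<close>

definition Skip :: com where "Skip = Act 0 (\<lambda>a. (a, MStay))"
definition Inc :: "nat \<Rightarrow> com" where "Inc j = Act j (\<lambda>a. (a, MRight))"
definition Dec :: "nat \<Rightarrow> com" where "Dec j = Act j (\<lambda>a. (a, MLeft))"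
text \<open>A blank under the head signals a nonzero counter. The body sees the register already
  decremented, that is, the number of rounds still to come.\<close>

definition Loop :: "nat \<Rightarrow> com \<Rightarrow> com" where "Loop j c = While j {0} (Seq (Dec j) c)"
definition Emit :: "nat \<Rightarrow> bool \<Rightarrow> com" where
  "Emit j b = Act j (\<lambda>_. (if b then 2 else 1, MRight))"

text \<open>Registers are head positions: register \<open>j\<close> of \<open>s\<close>, for \<open>0 < j < ot\<close>, is the position of the
  head on a tape that is blank except for a 1 at position 0, which makes zero recognisable.
  Register 0 is the position of the input head; tape \<open>ot\<close> is the output tape.\<close>

definition cfg :: "bool list \<Rightarrow> nat \<Rightarrow> (nat \<Rightarrow> nat) \<Rightarrow> bool list \<Rightarrow> tapeconf" where
  "cfg x ot s out =
    ((\<lambda>j. if j = 0 then tape_of x else if j < ot then (\<lambda>i. if i = 0 then 1 else 0)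
          else if j = ot then tape_of out else (\<lambda>_. 0)),
     (\<lambda>j. if j < ot then int (s j) else if j = ot then int (length out) else 0))"

lemma wf_com_Skip [simp]: "wf_com K Skip \<longleftrightarrow> 0 < K"
  and wf_com_Inc [simp]: "wf_com K (Inc j) \<longleftrightarrow> j < K"
  and wf_com_Dec [simp]: "wf_com K (Dec j) \<longleftrightarrow> j < K"
  and wf_com_Loop [simp]: "wf_com K (Loop j c) \<longleftrightarrow> j < K \<and> wf_com K c"
  and wf_com_Emit [simp]: "wf_com K (Emit j b) \<longleftrightarrow> j < K"
  by (auto simp: Skip_def Inc_def Dec_def Loop_def Emit_def)

lemma bs_Skip: "bs Skip a 1 a"
  using bs.Act[of "\<lambda>a. (a, MStay)" "fst a" 0 "snd a" _ MStay] by (simp add: Skip_def)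

lemma bs_Inc: "j < ot \<Longrightarrow> bs (Inc j) (cfg x ot s out) 1 (cfg x ot (s(j := Suc (s j))) out)"
  unfolding Inc_def cfg_def
  by (rule bs.Act[where d = MRight, THEN back_subst[of "bs _ _ _"]]) (auto simp: fun_eq_iff)

lemma bs_Dec: "j < ot \<Longrightarrow> 0 < s j \<Longrightarrow> bs (Dec j) (cfg x ot s out) 1 (cfg x ot (s(j := s j - 1)) out)"
  unfolding Dec_def cfg_def
  by (rule bs.Act[where d = MLeft, THEN back_subst[of "bs _ _ _"]]) (auto simp: fun_eq_iff)

lemma bs_Emit: "0 < ot \<Longrightarrow> bs (Emit ot b) (cfg x ot s out) 1 (cfg x ot s (out @ [b]))"
  unfolding Emit_def cfg_def
  by (rule bs.Act[where d = MRight, THEN back_subst[of "bs _ _ _"]])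
    (auto simp: fun_eq_iff tape_of_def nth_append)

lemma bs_While_exit: "fst a j (snd a j) \<notin> S \<Longrightarrow> bs (While j S c) a 1 a"
  using bs.WhileF[of "fst a" j "snd a" S c] by simp

lemma bs_While_step: "fst a j (snd a j) \<in> S \<Longrightarrow> bs c a m b \<Longrightarrow> bs (While j S c) b n d \<Longrightarrow>
    bs (While j S c) a (m + n + 2) d"
  using bs.WhileT[of "fst a" j "snd a" S c] by simp

lemma bs_If_true: "fst a j (snd a j) \<in> S \<Longrightarrow> bs c1 a m b \<Longrightarrow> bs (If j S c1 c2) a (m + 2) b"
  using bs.IfT[of "fst a" j "snd a" S c1] by simp

lemma bs_If_false: "fst a j (snd a j) \<notin> S \<Longrightarrow> bs c2 a m b \<Longrightarrow> bs (If j S c1 c2) a (m + 1) b"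
  using bs.IfF[of "fst a" j "snd a" S c2] by simp

lemma symbol_register:
  "0 < j \<Longrightarrow> j < ot \<Longrightarrow> fst (cfg x ot s out) j (snd (cfg x ot s out) j) = (if s j = 0 then 1 else 0)"
  by (auto simp: cfg_def)

lemma symbol_input:
  "0 < ot \<Longrightarrow> fst (cfg x ot s out) 0 (snd (cfg x ot s out) 0) = tape_of x (int (s 0))"
  by (auto simp: cfg_def)

text \<open>\<open>S i\<close> and \<open>out i\<close> are the registers and the output after
  \<open>i\<close> rounds, with register \<open>j\<close> overwritten by the rounds left.
  \<open>N\<close> stands for a bound on \<open>n\<close> that is polynomial in the input length. A
  round costs 3 more than its body: the decrement, the test and the jump back.\<close>

lemma bs_Loop:
  assumes j: "0 < j" "j < ot" and n: "n \<le> N"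
    and body: "\<And>i. i < n \<Longrightarrow> bs c (cfg x ot ((S i)(j := n - Suc i)) (out i)) t
        (cfg x ot ((S (Suc i))(j := n - Suc i)) (out (Suc i)))"
    and a: "s = (S 0)(j := n)" and b: "s' = (S n)(j := 0)"
  shows "bs (Loop j c) (cfg x ot s (out 0)) (N * (t + 3) + 1) (cfg x ot s' (out n))"
proof -
  \<comment> \<open>The induction is on the number \<open>k\<close> of rounds left, since the rule
    for \<open>While\<close> splits off the first round.\<close>
  have "bs (Loop j c) (cfg x ot ((S (n - k))(j := k)) (out (n - k))) (k * (t + 3) + 1)
          (cfg x ot s' (out n))" if "k \<le> n" for k
    using that
  proof (induction k)
    case 0
    have "bs (Loop j c) (cfg x ot ((S n)(j := 0)) (out n)) 1 (cfg x ot ((S n)(j := 0)) (out n))"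
      unfolding Loop_def using j by (intro bs_While_exit) (simp add: symbol_register)
    then show "bs (Loop j c) (cfg x ot ((S (n - 0))(j := 0)) (out (n - 0))) (0 * (t + 3) + 1)
          (cfg x ot s' (out n))" unfolding b by simp
  next
    case (Suc k)
    let ?S = "(S (n - Suc k))(j := Suc k)"
    have e: "n - Suc (n - Suc k) = k" "Suc (n - Suc k) = n - k" using Suc.prems by auto
    have "bs (Seq (Dec j) c) (cfg x ot ?S (out (n - Suc k))) (1 + t)
        (cfg x ot ((S (n - k))(j := k)) (out (n - k)))"
      using bs_Dec[of j ot ?S x "out (n - Suc k)"] j body[of "n - Suc k"] Suc.prems
      by (intro bs.Seq) (auto simp: e)
    moreover have "bs (Loop j c) (cfg x ot ((S (n - k))(j := k)) (out (n - k))) (k * (t + 3) + 1)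
        (cfg x ot s' (out n))"
      using Suc.IH[OF Suc_leD[OF Suc.prems]] .
    ultimately have "bs (Loop j c) (cfg x ot ?S (out (n - Suc k))) (1 + t + (k * (t + 3) + 1) + 2)
        (cfg x ot s' (out n))"
      unfolding Loop_def by (intro bs_While_step) (simp_all add: symbol_register j)
    then show ?case by (rule bs.weaken) simp
  qed
  from this[of n] show ?thesis
    unfolding a using n by (auto intro: bs.weaken)
qed

lemma bs_Loop':
  assumes "0 < j" "j < ot" "n \<le> N"
    and "\<And>i. i < n \<Longrightarrow> bs c (cfg x ot ((S i)(j := n - Suc i)) out) t
        (cfg x ot ((S (Suc i))(j := n - Suc i)) out)"
    and "s = (S 0)(j := n)" "s' = (S n)(j := 0)"
  shows "bs (Loop j c) (cfg x ot s out) (N * (t + 3) + 1) (cfg x ot s' out)"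
  using bs_Loop[where out = "\<lambda>_. out"] assms by blast

lemma bs_move:
  assumes "0 < j" "j < ot" "d < ot" "j \<noteq> d" "s j \<le> N"
  shows "bs (Loop j (Inc d)) (cfg x ot s out) (N * 4 + 1) (cfg x ot (s(j := 0, d := s d + s j)) out)"
proof -
  have "bs (Loop j (Inc d)) (cfg x ot s out) (N * (1 + 3) + 1)
      (cfg x ot (s(j := 0, d := s d + s j)) out)"
  proof (rule bs_Loop'[where S = "\<lambda>i. s(d := s d + i)" and n = "s j"])
    fix i
    show "bs (Inc d) (cfg x ot (s(d := s d + i, j := s j - Suc i)) out) 1
      (cfg x ot (s(d := s d + Suc i, j := s j - Suc i)) out)"
      using bs_Inc[of d ot x "s(d := s d + i, j := s j - Suc i)" out] assms
      by (simp add: fun_upd_twist)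
  qed (use assms in \<open>auto simp: fun_eq_iff\<close>)
  then show ?thesis by simp
qed

lemma bs_clear:
  assumes "0 < j" "j < ot" "s j \<le> N"
  shows "bs (Loop j Skip) (cfg x ot s out) (N * 4 + 1) (cfg x ot (s(j := 0)) out)"
proof -
  have "bs (Loop j Skip) (cfg x ot s out) (N * (1 + 3) + 1) (cfg x ot (s(j := 0)) out)"
    by (rule bs_Loop'[where S = "\<lambda>i. s" and n = "s j"]) (use assms bs_Skip in auto)
  then show ?thesis by simp
qed

section \<open>Arithmetic terms and their evaluation by counters\<close>

datatype trm =
    Var nat
  | Const nat
  | Plus trm trm
  | Monus trm trm
  | Times trm trm
  | Sum nat trm trm
  | Sym trm

fun eval :: "bool list \<Rightarrow> trm \<Rightarrow> (nat \<Rightarrow> nat) \<Rightarrow> nat" where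
  "eval x (Var v) s = s v"
| "eval x (Const n) s = n"
| "eval x (Plus e1 e2) s = eval x e1 s + eval x e2 s"
| "eval x (Monus e1 e2) s = eval x e1 s - eval x e2 s"
| "eval x (Times e1 e2) s = eval x e1 s * eval x e2 s"
| "eval x (Sum v e1 e2) s = (\<Sum>i<eval x e1 s. eval x e2 (s(v := i)))"
| "eval x (Sym e) s = tape_of x (int (eval x e s))"

fun incs :: "nat \<Rightarrow> nat \<Rightarrow> com" where
  "incs 0 d = Skip"
| "incs (Suc n) d = Seq (incs n d) (Inc d)"

text \<open>The value is left in register \<open>d\<close>; variable \<open>v\<close> lives in register \<open>\<rho> v < d\<close>, and
  all registers above \<open>d\<close> are zero before and after.\<close>

fun compile :: "(nat \<Rightarrow> nat) \<Rightarrow> trm \<Rightarrow> nat \<Rightarrow> com" where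
  "compile \<rho> (Var v) d = Seq (Loop (\<rho> v) (Seq (Inc d) (Inc (d + 1)))) (Loop (d + 1) (Inc (\<rho> v)))"
| "compile \<rho> (Const n) d = incs n d"
| "compile \<rho> (Plus e1 e2) d =
     Seq (compile \<rho> e1 d) (Seq (compile \<rho> e2 (d + 1)) (Loop (d + 1) (Inc d)))"
| "compile \<rho> (Monus e1 e2) d =
     Seq (compile \<rho> e1 d) (Seq (compile \<rho> e2 (d + 1)) (Loop (d + 1) (If d {0} (Dec d) Skip)))"
| "compile \<rho> (Times e1 e2) d =
     Seq (compile \<rho> e1 (d + 1)) (Loop (d + 1) (Seq (compile \<rho> e2 (d + 2)) (Loop (d + 2) (Inc d))))"
| "compile \<rho> (Sum v e1 e2) d =
     Seq (compile \<rho> e1 (d + 1))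
       (Seq (Loop (d + 1) (Seq (compile (\<rho>(v := d + 2)) e2 (d + 3))
              (Seq (Loop (d + 3) (Inc d)) (Inc (d + 2)))))
         (Loop (d + 2) Skip))"
| "compile \<rho> (Sym e) d =
     Seq (compile \<rho> e d) (Seq (Loop d (Seq (Inc 0) (Inc (d + 1))))
       (Seq (If 0 {1} (Inc d) Skip) (Seq (If 0 {2} (Seq (Inc d) (Inc d)) Skip)
         (Loop (d + 1) (Dec 0)))))"

text \<open>An upper bound on how many registers from \<open>d\<close> upwards the compiled code
  uses.\<close>

fun height :: "trm \<Rightarrow> nat" where
  "height (Var v) = 2"
| "height (Const n) = 1"
| "height (Plus e1 e2) = height e1 + height e2 + 2"
| "height (Monus e1 e2) = height e1 + height e2 + 2"
| "height (Times e1 e2) = height e1 + height e2 + 3"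
| "height (Sum v e1 e2) = height e1 + height e2 + 4"
| "height (Sym e) = height e + 2"

text \<open>A polynomial in a common bound of all variables. Under \<open>Sum\<close> the bound
  variable can grow as large as the range, hence the composition with
  \<open>[:0, 1:] + val_bound e1\<close>.\<close>

fun val_bound :: "trm \<Rightarrow> nat poly" where
  "val_bound (Var v) = [:0, 1:]"
| "val_bound (Const n) = [:n:]"
| "val_bound (Plus e1 e2) = val_bound e1 + val_bound e2"
| "val_bound (Monus e1 e2) = val_bound e1"
| "val_bound (Times e1 e2) = val_bound e1 * val_bound e2"
| "val_bound (Sum v e1 e2) = val_bound e1 * (val_bound e2 \<circ>\<^sub>p ([:0, 1:] + val_bound e1))"
| "val_bound (Sym e) = [:2:]"

fun time_bound :: "trm \<Rightarrow> nat poly" where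
  "time_bound (Var v) = [:2, 9:]"
| "time_bound (Const n) = [:n + 1:]"
| "time_bound (Plus e1 e2) = time_bound e1 + (time_bound e2 + (val_bound e2 * [:4:] + [:1:]))"
| "time_bound (Monus e1 e2) = time_bound e1 + (time_bound e2 + (val_bound e2 * [:6:] + [:1:]))"
| "time_bound (Times e1 e2) = time_bound e1 +
     (val_bound e1 * ((time_bound e2 + (val_bound e2 * [:4:] + [:1:])) + [:3:]) + [:1:])"
| "time_bound (Sum v e1 e2) = time_bound e1 +
     ((val_bound e1 * (((time_bound e2 + (val_bound e2 * [:4:] + [:2:])) \<circ>\<^sub>p ([:0, 1:] + val_bound e1))
       + [:3:]) + [:1:]) + (val_bound e1 * [:4:] + [:1:]))"
| "time_bound (Sym e) = time_bound e + (val_bound e * [:5:] + [:1:] + ([:3:] + ([:4:] +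
     (val_bound e * [:4:] + [:1:]))))"

lemma tape_of_le_2: "tape_of x i \<le> 2"
  by (simp add: tape_of_def)

lemma eval_bound: "(\<And>v. s v \<le> B) \<Longrightarrow> eval x e s \<le> poly (val_bound e) B"
proof (induction e arbitrary: s B)
  case (Plus e1 e2)
  then show ?case by (auto intro: add_mono)
next
  case (Monus e1 e2)
  then show ?case by (auto intro: le_trans[OF diff_le_self])
next
  case (Times e1 e2)
  then show ?case by (auto intro: mult_mono)
next
  case (Sum v e1 e2)
  let ?B = "B + poly (val_bound e1) B"
  have "eval x e2 (s(v := i)) \<le> poly (val_bound e2) ?B" if "i < eval x e1 s" for i
  proof (rule Sum.IH(2))
    show "(s(v := i)) w \<le> ?B" for w
      using Sum.prems[of w] Sum.IH(1)[of s B] Sum.prems that by fastforce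
  qed
  then have "(\<Sum>i<eval x e1 s. eval x e2 (s(v := i))) \<le> (\<Sum>i<eval x e1 s. poly (val_bound e2) ?B)"
    by (intro sum_mono) auto
  also have "\<dots> \<le> poly (val_bound e1) B * poly (val_bound e2) ?B"
    using Sum.IH(1)[OF Sum.prems] by simp
  finally show ?case by (simp add: poly_pcompose)
qed (auto simp: tape_of_le_2)

lemma bs_incs:
  "d < ot \<Longrightarrow> bs (incs n d) (cfg x ot s out) (n + 1) (cfg x ot (s(d := s d + n)) out)"
proof (induction n)
  case 0
  then show ?case using bs_Skip by simp
next
  case (Suc n)
  have "bs (incs n d) (cfg x ot s out) (n + 1) (cfg x ot (s(d := s d + n)) out)"
    using Suc by blast
  from bs.Seq[OF this bs_Inc[OF Suc.prems]]
  show "bs (incs (Suc n) d) (cfg x ot s out) (Suc n + 1) (cfg x ot (s(d := s d + Suc n)) out)"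
    by simp
qed

lemma bs_If_register:
  assumes "0 < j" "j < ot"
    and "s j \<noteq> 0 \<Longrightarrow> bs c1 (cfg x ot s out) m b" "s j = 0 \<Longrightarrow> bs c2 (cfg x ot s out) m b"
  shows "bs (If j {0} c1 c2) (cfg x ot s out) (m + 2) b"
proof (cases "s j = 0")
  case True
  then have "bs (If j {0} c1 c2) (cfg x ot s out) (m + 1) b"
    using assms by (intro bs_If_false) (auto simp: symbol_register)
  then show ?thesis by (rule bs.weaken) simp
next
  case False
  then show ?thesis using assms by (intro bs_If_true) (auto simp: symbol_register)
qed

lemma bs_If_input:
  assumes "0 < ot"
    and "tape_of x (int (s 0)) = \<sigma> \<Longrightarrow> bs c (cfg x ot s out) m b"
    and "tape_of x (int (s 0)) \<noteq> \<sigma> \<Longrightarrow> b = cfg x ot s out" "0 < m"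
  shows "bs (If 0 {\<sigma>} c Skip) (cfg x ot s out) (m + 2) b"
proof (cases "tape_of x (int (s 0)) = \<sigma>")
  case True
  then show ?thesis using assms by (intro bs_If_true) (auto simp: symbol_input)
next
  case False
  then have "bs (If 0 {\<sigma>} c Skip) (cfg x ot s out) (1 + 1) b"
    using bs_If_false[OF _ bs_Skip] assms(1,3) by (simp add: symbol_input)
  then show ?thesis by (rule bs.weaken) simp
qed

text \<open>The induction generalises \<open>\<rho>\<close> and \<open>d\<close>, as operands are
  evaluated above the registers that hold intermediate results and \<open>Sum\<close> relocates its
  variable. Register 0 starts at 0 because \<open>Sym\<close> walks the input head from the origin
  to the position and back.\<close>

lemma compile_correct:
  assumes "\<And>v. 0 < \<rho> v \<and> \<rho> v < d" "d + height e \<le> ot" "\<And>r. d \<le> r \<Longrightarrow> s r = 0" "s 0 = 0"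
    and "\<And>v. s (\<rho> v) \<le> B"
  shows "bs (compile \<rho> e d) (cfg x ot s out) (poly (time_bound e) B)
    (cfg x ot (s(d := eval x e (s \<circ> \<rho>))) out)"
proof -
  let ?spec = "\<lambda>e \<rho> d s B. bs (compile \<rho> e d) (cfg x ot s out) (poly (time_bound e) B)
    (cfg x ot (s(d := eval x e (s \<circ> \<rho>))) out)"
  show ?thesis
    using assms
  proof (induction e arbitrary: \<rho> d s B)
    case (Var v)
    let ?n = "s (\<rho> v)"
    note v = Var.prems(1)[of v] and ot = Var.prems(2)
    have z: "s d = 0" "s (Suc d) = 0" using Var.prems(3) by auto
    \<comment> \<open>Reading a counter destroys it, so it is drained into \<open>d\<close> and
      \<open>d + 1\<close>, and the second copy refills it.\<close>
    have 1: "bs (Loop (\<rho> v) (Seq (Inc d) (Inc (d + 1)))) (cfg x ot s out) (B * ((1 + 1) + 3) + 1)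
        (cfg x ot (s(\<rho> v := 0, d := ?n, d + 1 := ?n)) out)"
    proof (rule bs_Loop'[where S = "\<lambda>i. s(d := i, d + 1 := i)" and n = ?n])
      fix i assume "i < ?n"
      let ?s = "s(d := i, d + 1 := i, \<rho> v := ?n - Suc i)"
      have "bs (Seq (Inc d) (Inc (d + 1))) (cfg x ot ?s out) (1 + 1)
        (cfg x ot (?s(d := Suc i, d + 1 := Suc i)) out)"
        using bs_Inc[of d ot x ?s out] bs_Inc[of "d + 1" ot x "?s(d := Suc i)" out] v ot
        by (intro bs.Seq) (auto simp: fun_upd_twist)
      moreover have "?s(d := Suc i, d + 1 := Suc i) = s(d := Suc i, d + 1 := Suc i, \<rho> v := ?n - Suc i)"
        using v by (auto simp: fun_eq_iff)
      ultimately show "bs (Seq (Inc d) (Inc (d + 1))) (cfg x ot ?s out) (1 + 1)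
        (cfg x ot (s(d := Suc i, d + 1 := Suc i, \<rho> v := ?n - Suc i)) out)" by simp
    qed (use v ot z Var.prems(5)[of v] in \<open>auto simp: fun_eq_iff\<close>)
    have "bs (Loop (d + 1) (Inc (\<rho> v))) (cfg x ot (s(\<rho> v := 0, d := ?n, d + 1 := ?n)) out) (B * 4 + 1)
       (cfg x ot ((s(\<rho> v := 0, d := ?n, d + 1 := ?n))(d + 1 := 0, \<rho> v :=
         (s(\<rho> v := 0, d := ?n, d + 1 := ?n)) (\<rho> v) + (s(\<rho> v := 0, d := ?n, d + 1 := ?n)) (d + 1))) out)"
      using v ot Var.prems(5)[of v] by (intro bs_move) auto
    also have "(s(\<rho> v := 0, d := ?n, d + 1 := ?n))(d + 1 := 0, \<rho> v :=
         (s(\<rho> v := 0, d := ?n, d + 1 := ?n)) (\<rho> v) + (s(\<rho> v := 0, d := ?n, d + 1 := ?n)) (d + 1))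
         = s(d := ?n)"
      using v z by (auto simp: fun_eq_iff)
    finally have "bs (Loop (d + 1) (Inc (\<rho> v))) (cfg x ot (s(\<rho> v := 0, d := ?n, d + 1 := ?n)) out)
      (B * 4 + 1) (cfg x ot (s(d := ?n)) out)" .
    from bs.Seq[OF 1 this] show "?spec (Var v) \<rho> d s B"
      by (simp add: algebra_simps)
  next
    case (Const n)
    then show "?spec (Const n) \<rho> d s B" using bs_incs[of d ot n x s out] by simp
  next
    case (Plus e1 e2)
    let ?a = "eval x e1 (s \<circ> \<rho>)" and ?b = "eval x e2 (s \<circ> \<rho>)"
    have \<rho>: "\<rho> v < d" "\<rho> v \<noteq> d" for v using Plus.prems(1)[of v] by auto
    have b: "?b \<le> poly (val_bound e2) B" using Plus.prems(5) by (intro eval_bound) simp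
    have 1: "bs (compile \<rho> e1 d) (cfg x ot s out) (poly (time_bound e1) B) (cfg x ot (s(d := ?a)) out)"
      using Plus.prems by (intro Plus.IH) auto
    have "bs (compile \<rho> e2 (d + 1)) (cfg x ot (s(d := ?a)) out) (poly (time_bound e2) B)
        (cfg x ot (s(d := ?a, d + 1 := eval x e2 (s(d := ?a) \<circ> \<rho>))) out)"
      using Plus.prems \<rho> by (intro Plus.IH) (auto simp: less_SucI)
    also have "s(d := ?a) \<circ> \<rho> = s \<circ> \<rho>" using \<rho> by (auto simp: fun_eq_iff)
    finally have 2: "bs (compile \<rho> e2 (d + 1)) (cfg x ot (s(d := ?a)) out) (poly (time_bound e2) B)
        (cfg x ot (s(d := ?a, d + 1 := ?b)) out)" .
    have "bs (Loop (d + 1) (Inc d)) (cfg x ot (s(d := ?a, d + 1 := ?b)) out)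
        (poly (val_bound e2) B * 4 + 1) (cfg x ot ((s(d := ?a, d + 1 := ?b))(d + 1 := 0, d :=
         (s(d := ?a, d + 1 := ?b)) d + (s(d := ?a, d + 1 := ?b)) (d + 1))) out)"
      using Plus.prems b by (intro bs_move) auto
    also have "(s(d := ?a, d + 1 := ?b))(d + 1 := 0, d :=
         (s(d := ?a, d + 1 := ?b)) d + (s(d := ?a, d + 1 := ?b)) (d + 1)) = s(d := ?a + ?b)"
      using Plus.prems(3) by (auto simp: fun_eq_iff)
    finally have 3: "bs (Loop (d + 1) (Inc d)) (cfg x ot (s(d := ?a, d + 1 := ?b)) out)
        (poly (val_bound e2) B * 4 + 1) (cfg x ot (s(d := ?a + ?b)) out)" .
    from bs.Seq[OF 1 bs.Seq[OF 2 3]] show "?spec (Plus e1 e2) \<rho> d s B" by (simp add: algebra_simps)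
  next
    case (Monus e1 e2)
    let ?a = "eval x e1 (s \<circ> \<rho>)" and ?b = "eval x e2 (s \<circ> \<rho>)"
    have \<rho>: "\<rho> v < d" "\<rho> v \<noteq> d" for v using Monus.prems(1)[of v] by auto
    have b: "?b \<le> poly (val_bound e2) B" using Monus.prems(5) by (intro eval_bound) simp
    have d: "0 < d" using Monus.prems(1)[of 0] by simp
    have 1: "bs (compile \<rho> e1 d) (cfg x ot s out) (poly (time_bound e1) B) (cfg x ot (s(d := ?a)) out)"
      using Monus.prems by (intro Monus.IH) auto
    have "bs (compile \<rho> e2 (d + 1)) (cfg x ot (s(d := ?a)) out) (poly (time_bound e2) B)
        (cfg x ot (s(d := ?a, d + 1 := eval x e2 (s(d := ?a) \<circ> \<rho>))) out)"
      using Monus.prems \<rho> by (intro Monus.IH) (auto simp: less_SucI)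
    also have "s(d := ?a) \<circ> \<rho> = s \<circ> \<rho>" using \<rho> by (auto simp: fun_eq_iff)
    finally have 2: "bs (compile \<rho> e2 (d + 1)) (cfg x ot (s(d := ?a)) out) (poly (time_bound e2) B)
        (cfg x ot (s(d := ?a, d + 1 := ?b)) out)" .
    have "bs (Loop (d + 1) (If d {0} (Dec d) Skip)) (cfg x ot (s(d := ?a, d + 1 := ?b)) out)
        (poly (val_bound e2) B * ((1 + 2) + 3) + 1) (cfg x ot (s(d := ?a - ?b)) out)"
    proof (rule bs_Loop'[where S = "\<lambda>i. s(d := ?a - i)" and n = ?b])
      fix i assume "i < ?b"
      let ?s = "s(d := ?a - i, d + 1 := ?b - Suc i)"
      have e: "s(d := ?a - Suc i, d + 1 := ?b - Suc i) = ?s(d := ?a - i - 1)"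
        by (auto simp: fun_eq_iff)
      show "bs (If d {0} (Dec d) Skip) (cfg x ot ?s out) (1 + 2)
         (cfg x ot (s(d := ?a - Suc i, d + 1 := ?b - Suc i)) out)"
        unfolding e
      proof (rule bs_If_register)
        show "?s d \<noteq> 0 \<Longrightarrow> bs (Dec d) (cfg x ot ?s out) 1 (cfg x ot (?s(d := ?a - i - 1)) out)"
          using bs_Dec[of d ot ?s x out] Monus.prems(2) by simp
        show "bs Skip (cfg x ot ?s out) 1 (cfg x ot (?s(d := ?a - i - 1)) out)" if "?s d = 0"
        proof -
          have "?s(d := ?a - i - 1) = ?s" using that by (auto simp: fun_eq_iff)
          then show ?thesis using bs_Skip by metis
        qed
      qed (use d Monus.prems(2) in auto)
    qed (use Monus.prems b in \<open>auto simp: fun_eq_iff\<close>)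
    from bs.Seq[OF 1 bs.Seq[OF 2 this]] show "?spec (Monus e1 e2) \<rho> d s B" by (simp add: algebra_simps)
  next
    case (Times e1 e2)
    let ?a = "eval x e1 (s \<circ> \<rho>)" and ?b = "eval x e2 (s \<circ> \<rho>)"
    have \<rho>: "\<rho> v < d" "\<rho> v \<noteq> d" "\<rho> v \<noteq> Suc d" "0 < \<rho> v" for v using Times.prems(1)[of v] by auto
    have a: "?a \<le> poly (val_bound e1) B" using Times.prems(5) by (intro eval_bound) simp
    have b: "?b \<le> poly (val_bound e2) B" using Times.prems(5) by (intro eval_bound) simp
    have d: "0 < d" using Times.prems(1)[of 0] by simp
    have 1: "bs (compile \<rho> e1 (d + 1)) (cfg x ot s out) (poly (time_bound e1) B)
        (cfg x ot (s(d + 1 := ?a)) out)"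
      using Times.prems \<rho> by (intro Times.IH) (auto simp: less_SucI)
    have "bs (Loop (d + 1) (Seq (compile \<rho> e2 (d + 2)) (Loop (d + 2) (Inc d))))
        (cfg x ot (s(d + 1 := ?a)) out)
        (poly (val_bound e1) B * ((poly (time_bound e2) B + (poly (val_bound e2) B * 4 + 1)) + 3) + 1)
        (cfg x ot (s(d := ?a * ?b)) out)"
    proof (rule bs_Loop'[where S = "\<lambda>i. s(d := i * ?b)" and n = ?a])
      fix i assume "i < ?a"
      let ?s = "s(d := i * ?b, d + 1 := ?a - Suc i)"
      have e: "?s \<circ> \<rho> = s \<circ> \<rho>" using \<rho> by (auto simp: fun_eq_iff)
      have "bs (compile \<rho> e2 (d + 2)) (cfg x ot ?s out) (poly (time_bound e2) B)
        (cfg x ot (?s(d + 2 := eval x e2 (?s \<circ> \<rho>))) out)"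
        using Times.prems \<rho> d by (intro Times.IH) (auto simp: less_SucI)
      then have 2: "bs (compile \<rho> e2 (d + 2)) (cfg x ot ?s out) (poly (time_bound e2) B)
        (cfg x ot (?s(d + 2 := ?b)) out)" unfolding e .
      have "bs (Loop (d + 2) (Inc d)) (cfg x ot (?s(d + 2 := ?b)) out)
        (poly (val_bound e2) B * 4 + 1) (cfg x ot ((?s(d + 2 := ?b))(d + 2 := 0, d :=
         (?s(d + 2 := ?b)) d + (?s(d + 2 := ?b)) (d + 2))) out)"
        using Times.prems b by (intro bs_move) auto
      also have "(?s(d + 2 := ?b))(d + 2 := 0, d := (?s(d + 2 := ?b)) d + (?s(d + 2 := ?b)) (d + 2))
        = s(d := Suc i * ?b, d + 1 := ?a - Suc i)"
        using Times.prems(3) by (auto simp: fun_eq_iff)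
      finally show "bs (Seq (compile \<rho> e2 (d + 2)) (Loop (d + 2) (Inc d))) (cfg x ot ?s out)
        (poly (time_bound e2) B + (poly (val_bound e2) B * 4 + 1))
        (cfg x ot (s(d := Suc i * ?b, d + 1 := ?a - Suc i)) out)"
        by (rule bs.Seq[OF 2])
    qed (use Times.prems a in \<open>auto simp: fun_eq_iff\<close>)
    from bs.Seq[OF 1 this] show "?spec (Times e1 e2) \<rho> d s B" by (simp add: algebra_simps)
  next
    case (Sum v e1 e2)
    let ?a = "eval x e1 (s \<circ> \<rho>)" and ?g = "\<lambda>i. eval x e2 ((s \<circ> \<rho>)(v := i))"
    let ?B = "B + poly (val_bound e1) B"
    have \<rho>: "\<rho> v < d" "\<rho> v \<noteq> d" "\<rho> v \<noteq> Suc d" "\<rho> v \<noteq> Suc (Suc d)" "0 < \<rho> v" "\<rho> v < d + n"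
      "\<rho> v \<noteq> d + n" for v n
      using Sum.prems(1)[of v] by auto
    have a: "?a \<le> poly (val_bound e1) B" using Sum.prems(5) by (intro eval_bound) simp
    have d: "0 < d" using Sum.prems(1)[of 0] by simp
    have 1: "bs (compile \<rho> e1 (d + 1)) (cfg x ot s out) (poly (time_bound e1) B)
        (cfg x ot (s(d + 1 := ?a)) out)"
      using Sum.prems \<rho> by (intro Sum.IH) (auto simp: less_SucI)
    have 2: "bs (Loop (d + 1) (Seq (compile (\<rho>(v := d + 2)) e2 (d + 3))
                (Seq (Loop (d + 3) (Inc d)) (Inc (d + 2)))))
        (cfg x ot (s(d + 1 := ?a)) out)
        (poly (val_bound e1) B * ((poly (time_bound e2) ?B + (poly (val_bound e2) ?B * 4 + 1 + 1)) + 3) + 1)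
        (cfg x ot (s(d := (\<Sum>i<?a. ?g i), d + 2 := ?a)) out)"
    \<comment> \<open>Register \<open>d\<close> accumulates the partial sum, \<open>d + 1\<close>
      counts the rounds left and \<open>d + 2\<close> is the current index.\<close>
    proof (rule bs_Loop'[where S = "\<lambda>i. s(d := (\<Sum>i<i. ?g i), d + 2 := i)" and n = ?a])
      fix i assume i: "i < ?a"
      let ?s = "s(d := (\<Sum>i<i. ?g i), d + 2 := i, d + 1 := ?a - Suc i)"
      \<comment> \<open>Redirecting \<open>v\<close> to register \<open>d + 2\<close> realises the
        binding, including the shadowing of an outer \<open>v\<close>.\<close>
      have e: "?s \<circ> \<rho>(v := d + 2) = (s \<circ> \<rho>)(v := i)" using \<rho> by (auto simp: fun_eq_iff)
      have B: "((s \<circ> \<rho>)(v := i)) w \<le> ?B" for w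
        using Sum.prems(5)[of w] i a by auto
      have "bs (compile (\<rho>(v := d + 2)) e2 (d + 3)) (cfg x ot ?s out) (poly (time_bound e2) ?B)
        (cfg x ot (?s(d + 3 := eval x e2 (?s \<circ> \<rho>(v := d + 2)))) out)"
      proof (intro Sum.IH)
        show "?s ((\<rho>(v := d + 2)) w) \<le> ?B" for w
          using B[of w] fun_cong[OF e, of w] by simp
      qed (use Sum.prems \<rho> d in auto)
      then have 3: "bs (compile (\<rho>(v := d + 2)) e2 (d + 3)) (cfg x ot ?s out) (poly (time_bound e2) ?B)
        (cfg x ot (?s(d + 3 := ?g i)) out)" unfolding e .
      have "?g i \<le> poly (val_bound e2) ?B" using B by (rule eval_bound)
      then have "bs (Loop (d + 3) (Inc d)) (cfg x ot (?s(d + 3 := ?g i)) out)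
        (poly (val_bound e2) ?B * 4 + 1) (cfg x ot ((?s(d + 3 := ?g i))(d + 3 := 0, d :=
         (?s(d + 3 := ?g i)) d + (?s(d + 3 := ?g i)) (d + 3))) out)"
        using Sum.prems by (intro bs_move) auto
      also have "(?s(d + 3 := ?g i))(d + 3 := 0, d :=
         (?s(d + 3 := ?g i)) d + (?s(d + 3 := ?g i)) (d + 3)) = ?s(d := (\<Sum>i<Suc i. ?g i))"
        using Sum.prems(3) by (auto simp: fun_eq_iff)
      finally have 4: "bs (Loop (d + 3) (Inc d)) (cfg x ot (?s(d + 3 := ?g i)) out)
        (poly (val_bound e2) ?B * 4 + 1) (cfg x ot (?s(d := (\<Sum>i<Suc i. ?g i))) out)" .
      have "bs (Inc (d + 2)) (cfg x ot (?s(d := (\<Sum>i<Suc i. ?g i))) out) 1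
        (cfg x ot ((?s(d := (\<Sum>i<Suc i. ?g i)))(d + 2 := Suc ((?s(d := (\<Sum>i<Suc i. ?g i))) (d + 2)))) out)"
        using Sum.prems(2) by (intro bs_Inc) auto
      also have "(?s(d := (\<Sum>i<Suc i. ?g i)))(d + 2 := Suc ((?s(d := (\<Sum>i<Suc i. ?g i))) (d + 2))) =
        s(d := (\<Sum>i<Suc i. ?g i), d + 2 := Suc i, d + 1 := ?a - Suc i)"
        by (auto simp: fun_eq_iff)
      finally show "bs (Seq (compile (\<rho>(v := d + 2)) e2 (d + 3))
                (Seq (Loop (d + 3) (Inc d)) (Inc (d + 2)))) (cfg x ot ?s out)
        (poly (time_bound e2) ?B + (poly (val_bound e2) ?B * 4 + 1 + 1))
        (cfg x ot (s(d := (\<Sum>i<Suc i. ?g i), d + 2 := Suc i, d + 1 := ?a - Suc i)) out)"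
        by (rule bs.Seq[OF 3 bs.Seq[OF 4]])
    qed (use Sum.prems a in \<open>auto simp: fun_eq_iff\<close>)
    have "bs (Loop (d + 2) Skip) (cfg x ot (s(d := (\<Sum>i<?a. ?g i), d + 2 := ?a)) out)
       (poly (val_bound e1) B * 4 + 1)
       (cfg x ot (s(d := (\<Sum>i<?a. ?g i), d + 2 := ?a, d + 2 := 0)) out)"
      using Sum.prems(2) a by (intro bs_clear) auto
    also have "s(d := (\<Sum>i<?a. ?g i), d + 2 := ?a, d + 2 := 0) = s(d := (\<Sum>i<?a. ?g i))"
      using Sum.prems(3) by (auto simp: fun_eq_iff)
    finally have 3: "bs (Loop (d + 2) Skip) (cfg x ot (s(d := (\<Sum>i<?a. ?g i), d + 2 := ?a)) out)
       (poly (val_bound e1) B * 4 + 1) (cfg x ot (s(d := (\<Sum>i<?a. ?g i))) out)" .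
    from bs.Seq[OF 1 bs.Seq[OF 2 3]] show "?spec (Sum v e1 e2) \<rho> d s B" by (simp add: poly_pcompose algebra_simps)
  next
    case (Sym e)
    let ?a = "eval x e (s \<circ> \<rho>)"
    let ?t = "tape_of x (int ?a)"
    have a: "?a \<le> poly (val_bound e) B" using Sym.prems(5) by (intro eval_bound) simp
    have d: "0 < d" using Sym.prems(1)[of 0] by simp
    have z: "s d = 0" "s (Suc d) = 0" using Sym.prems(3) by auto
    have ot: "0 < ot" "d < ot" "d + 1 < ot" using Sym.prems(2) by auto
    have 1: "bs (compile \<rho> e d) (cfg x ot s out) (poly (time_bound e) B) (cfg x ot (s(d := ?a)) out)"
      using Sym.prems by (intro Sym.IH) auto
    let ?s = "s(0 := ?a, d + 1 := ?a)"
    \<comment> \<open>While the input head moves out to position \<open>?a\<close>, register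
      \<open>d + 1\<close> records the distance for the way back.\<close>
    have 2: "bs (Loop d (Seq (Inc 0) (Inc (d + 1)))) (cfg x ot (s(d := ?a)) out)
       (poly (val_bound e) B * ((1 + 1) + 3) + 1) (cfg x ot ?s out)"
    proof (rule bs_Loop'[where S = "\<lambda>i. s(0 := i, d + 1 := i)" and n = ?a])
      fix i
      let ?s = "s(0 := i, d + 1 := i, d := ?a - Suc i)"
      have "bs (Seq (Inc 0) (Inc (d + 1))) (cfg x ot ?s out) (1 + 1)
        (cfg x ot (?s(0 := Suc i, d + 1 := Suc i)) out)"
        using bs_Inc[of 0 ot x ?s out] bs_Inc[of "d + 1" ot x "?s(0 := Suc i)" out] d ot
        by (intro bs.Seq) (auto simp: fun_upd_twist)
      moreover have "?s(0 := Suc i, d + 1 := Suc i) = s(0 := Suc i, d + 1 := Suc i, d := ?a - Suc i)"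
        using d by (auto simp: fun_eq_iff)
      ultimately show "bs (Seq (Inc 0) (Inc (d + 1))) (cfg x ot ?s out) (1 + 1)
        (cfg x ot (s(0 := Suc i, d + 1 := Suc i, d := ?a - Suc i)) out)" by simp
    qed (use d z ot a Sym.prems(4) in \<open>auto simp: fun_eq_iff\<close>)
    have 3: "bs (If 0 {1} (Inc d) Skip) (cfg x ot ?s out) (1 + 2)
       (cfg x ot (?s(d := (if ?t = 1 then 1 else 0))) out)"
    proof (rule bs_If_input)
      show "tape_of x (int (?s 0)) = 1 \<Longrightarrow>
        bs (Inc d) (cfg x ot ?s out) 1 (cfg x ot (?s(d := (if ?t = 1 then 1 else 0))) out)"
        using bs_Inc[of d ot x ?s out] ot d z by simp
      assume "tape_of x (int (?s 0)) \<noteq> 1"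
      then have "?s(d := (if ?t = 1 then 1 else 0)) = ?s"
        using d z by (auto simp: fun_eq_iff)
      then show "cfg x ot (?s(d := (if ?t = 1 then 1 else 0))) out = cfg x ot ?s out" by (simp only:)
    qed (use ot in auto)
    have 4: "bs (If 0 {2} (Seq (Inc d) (Inc d)) Skip)
       (cfg x ot (?s(d := (if ?t = 1 then 1 else 0))) out) ((1 + 1) + 2) (cfg x ot (?s(d := ?t)) out)"
    proof (rule bs_If_input)
      let ?s' = "?s(d := (if ?t = 1 then 1 else 0))"
      show "bs (Seq (Inc d) (Inc d)) (cfg x ot ?s' out) (1 + 1) (cfg x ot (?s(d := ?t)) out)"
        if "tape_of x (int (?s' 0)) = 2"
        using bs_Inc[of d ot x ?s' out] bs_Inc[of d ot x "?s'(d := 1)" out] ot d that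
        by (intro bs.Seq) (auto simp: numeral_2_eq_2)
      assume "tape_of x (int (?s' 0)) \<noteq> 2"
      then have "?t \<noteq> 2" using d by simp
      then have "(if ?t = 1 then 1 else 0) = ?t" using tape_of_le_2[of x "int ?a"] by auto
      then show "cfg x ot (?s(d := ?t)) out = cfg x ot ?s' out" by simp
    qed (use ot in auto)
    have "bs (Loop (d + 1) (Dec 0)) (cfg x ot (?s(d := ?t)) out) (poly (val_bound e) B * (1 + 3) + 1)
       (cfg x ot (s(d := ?t)) out)"
    proof (rule bs_Loop'[where S = "\<lambda>i. s(0 := ?a - i, d := ?t)" and n = ?a])
      fix i assume "i < ?a"
      then show "bs (Dec 0) (cfg x ot (s(0 := ?a - i, d := ?t, d + 1 := ?a - Suc i)) out) 1
        (cfg x ot (s(0 := ?a - Suc i, d := ?t, d + 1 := ?a - Suc i)) out)"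
        using bs_Dec[of 0 ot "s(0 := ?a - i, d := ?t, d + 1 := ?a - Suc i)" x out] ot d
        by (simp add: fun_upd_twist)
    qed (use d z ot a Sym.prems(4) in \<open>auto simp: fun_eq_iff\<close>)
    then show "?spec (Sym e) \<rho> d s B"
      unfolding compile.simps eval.simps
      by (rule bs.weaken[OF bs.Seq[OF 1 bs.Seq[OF 2 bs.Seq[OF 3 bs.Seq[OF 4]]]]]) simp
  qed
qed

lemma wf_incs: "d < K \<Longrightarrow> wf_com K (incs n d)"
  by (induction n) auto

lemma wf_compile:
  "(\<And>v. \<rho> v < d) \<Longrightarrow> d + height e \<le> K \<Longrightarrow> wf_com K (compile \<rho> e d)"
proof (induction e arbitrary: \<rho> d)
  case (Var v)
  from Var.prems(1)[of v] Var.prems(2) show ?case by simp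
next
  case (Sum v e1 e2)
  have "wf_com K (compile \<rho> e1 (d + 1))"
    using Sum.prems by (intro Sum.IH) (auto simp: less_SucI)
  moreover have "wf_com K (compile (\<rho>(v := d + 2)) e2 (d + 3))"
    using Sum.prems by (intro Sum.IH) (auto intro: less_le_trans[where y = d])
  ultimately show ?case using Sum.prems(2) by simp
qed (auto simp: wf_incs less_SucI)

section \<open>Printing an encoded adjacency matrix\<close>

fun marks :: "nat \<Rightarrow> com" where
  "marks 0 = Skip"
| "marks (Suc n) = Seq (marks n) (Act (Suc n) (\<lambda>_. (1, MStay)))"

lemma bs_marks:
  "bs (marks n) ((\<lambda>j. if j = 0 then tape_of x else (\<lambda>_. 0)), (\<lambda>_. 0)) (n + 1)
    ((\<lambda>j. if j = 0 then tape_of x else if j \<le> n then (\<lambda>i. if i = 0 then 1 else 0) else (\<lambda>_. 0)), (\<lambda>_. 0))"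
proof (induction n)
  case 0
  have "(\<lambda>j :: nat. if j = 0 then tape_of x else if j \<le> 0 then (\<lambda>i. if i = 0 then 1 else 0) else (\<lambda>_. 0)) =
    (\<lambda>j. if j = 0 then tape_of x else (\<lambda>_. 0))" by auto
  then show ?case using bs_Skip[of "((\<lambda>j. if j = 0 then tape_of x else (\<lambda>_. 0)), (\<lambda>_. 0))"] by simp
next
  case (Suc n)
  let ?T = "\<lambda>n j. if j = 0 then tape_of x else if j \<le> n then (\<lambda>i. if i = 0 then 1 else 0) else (\<lambda>_. 0)"
  have "bs (Act (Suc n) (\<lambda>_. (1, MStay))) (?T n, (\<lambda>_. 0)) 1
     ((?T n)(Suc n := (?T n (Suc n))((\<lambda>_. 0) (Suc n) := 1)), (\<lambda>_. 0)(Suc n := (\<lambda>_. 0) (Suc n) + shift MStay))"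
    by (rule bs.Act) simp
  moreover have "(?T n)(Suc n := (?T n (Suc n))((\<lambda>_. 0) (Suc n) := 1)) = ?T (Suc n)"
    by (auto simp: fun_eq_iff)
  moreover have "(\<lambda>_. 0)(Suc n := (\<lambda>_. 0) (Suc n) + shift MStay) = (\<lambda>_. 0)"
    by (auto simp: fun_eq_iff)
  ultimately have "bs (Act (Suc n) (\<lambda>_. (1, MStay))) (?T n, (\<lambda>_. 0)) 1 (?T (Suc n), (\<lambda>_. 0))"
    by simp
  from bs.Seq[OF Suc.IH this] show ?case unfolding marks.simps by (rule bs.weaken) simp
qed

text \<open>Register 1 receives the input length; register 5 counts the same steps and serves to
  bring the input head back to the origin.\<close>

definition scan :: com where
  "scan = Seq (While 0 {1, 2} (Seq (Inc 0) (Seq (Inc 1) (Inc 5)))) (Loop 5 (Dec 0))"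

lemma bs_scan:
  assumes ot: "5 < ot"
  shows "bs scan (cfg x ot (\<lambda>_. 0) out) (length x * 5 + 1 + (length x * 4 + 1))
    (cfg x ot ((\<lambda>_. 0)(1 := length x)) out)"
proof -
  let ?n = "length x"
  let ?s = "\<lambda>i. (\<lambda>_. 0 :: nat)(0 := i, 1 := i, 5 := i)"
  let ?body = "Seq (Inc 0) (Seq (Inc 1) (Inc 5))"
  have "bs (While 0 {1, 2} ?body) (cfg x ot (?s (?n - k)) out) (k * 5 + 1) (cfg x ot (?s ?n) out)"
    if "k \<le> ?n" for k
    using that
  proof (induction k)
    case 0
    have "bs (While 0 {1, 2} ?body) (cfg x ot (?s ?n) out) 1 (cfg x ot (?s ?n) out)"
      using ot by (intro bs_While_exit) (simp add: symbol_input tape_of_def)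
    then show "bs (While 0 {1, 2} ?body) (cfg x ot (?s (?n - 0)) out) (0 * 5 + 1) (cfg x ot (?s ?n) out)"
      by simp
  next
    case (Suc k)
    let ?i = "?n - Suc k"
    have "bs ?body (cfg x ot (?s ?i) out) (1 + (1 + 1)) (cfg x ot ((?s ?i)(0 := Suc ?i, 1 := Suc ?i, 5 := Suc ?i)) out)"
      using ot bs_Inc[of 0 ot x "?s ?i" out] bs_Inc[of 1 ot x "(?s ?i)(0 := Suc ?i)" out]
        bs_Inc[of 5 ot x "(?s ?i)(0 := Suc ?i, 1 := Suc ?i)" out]
      by (intro bs.Seq) auto
    moreover have "(?s ?i)(0 := Suc ?i, 1 := Suc ?i, 5 := Suc ?i) = ?s (?n - k)"
      using Suc.prems by (auto simp: fun_eq_iff)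
    ultimately have "bs ?body (cfg x ot (?s ?i) out) (1 + (1 + 1)) (cfg x ot (?s (?n - k)) out)" by metis
    moreover have "bs (While 0 {1, 2} ?body) (cfg x ot (?s (?n - k)) out) (k * 5 + 1) (cfg x ot (?s ?n) out)"
      using Suc.IH[OF Suc_leD[OF Suc.prems]] .
    ultimately have "bs (While 0 {1, 2} ?body) (cfg x ot (?s ?i) out) (1 + (1 + 1) + (k * 5 + 1) + 2)
        (cfg x ot (?s ?n) out)"
      using ot Suc.prems by (intro bs_While_step) (auto simp: symbol_input tape_of_def)
    then show "bs (While 0 {1, 2} ?body) (cfg x ot (?s (?n - Suc k)) out) (Suc k * 5 + 1) (cfg x ot (?s ?n) out)"
      by (rule bs.weaken) simp
  qed
  from this[of ?n] have 1: "bs (While 0 {1, 2} ?body) (cfg x ot (?s 0) out) (?n * 5 + 1) (cfg x ot (?s ?n) out)"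
    by (simp only: le_refl diff_self_eq_0)
  have s0: "?s 0 = (\<lambda>_. 0)" by (auto simp: fun_eq_iff)
  have 2: "bs (Loop 5 (Dec 0)) (cfg x ot (?s ?n) out) (?n * (1 + 3) + 1) (cfg x ot ((\<lambda>_. 0)(1 := ?n)) out)"
  proof (rule bs_Loop'[where S = "\<lambda>i. (\<lambda>_. 0)(0 := ?n - i, 1 := ?n)" and n = ?n])
    fix i assume "i < ?n"
    then show "bs (Dec 0) (cfg x ot ((\<lambda>_. 0)(0 := ?n - i, 1 := ?n, 5 := ?n - Suc i)) out) 1
      (cfg x ot ((\<lambda>_. 0)(0 := ?n - Suc i, 1 := ?n, 5 := ?n - Suc i)) out)"
      using bs_Dec[of 0 ot "(\<lambda>_. 0)(0 := ?n - i, 1 := ?n, 5 := ?n - Suc i)" x out] ot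
      by (simp add: fun_upd_twist)
  qed (use ot in \<open>auto simp: fun_eq_iff\<close>)
  have "bs scan (cfg x ot (?s 0) out) (?n * 5 + 1 + (?n * (1 + 3) + 1)) (cfg x ot ((\<lambda>_. 0)(1 := ?n)) out)"
    unfolding scan_def by (rule bs.Seq[OF 1 2])
  then show ?thesis unfolding s0 by simp
qed

text \<open>The free variables 0, 1, 2 of a term (input length, row, column) live in registers 1, 2, 3;
  register 4 is constantly zero.\<close>

definition reg :: "nat \<Rightarrow> nat" where "reg v = (if v \<le> 2 then v + 1 else 4)"

definition env :: "bool list \<Rightarrow> nat \<Rightarrow> nat \<Rightarrow> nat \<Rightarrow> nat" where
  "env x u v = (\<lambda>_. 0)(0 := length x, 1 := u, 2 := v)"

text \<open>Register 6 counts the columns left, 3 is the column index and 7 the value of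
  \<open>g\<close>. A blank on tape 7 means a nonzero value, hence \<open>True\<close>.\<close>

definition print_row :: "nat \<Rightarrow> trm \<Rightarrow> trm \<Rightarrow> com" where
  "print_row ot nt g = Seq (compile reg nt 6) (Loop 6 (Seq (compile reg g 7)
     (Seq (If 7 {0} (Emit ot True) (Emit ot False)) (Seq (Loop 7 Skip) (Inc 3)))))"

definition print_matrix :: "nat \<Rightarrow> trm \<Rightarrow> trm \<Rightarrow> com" where
  "print_matrix ot nt g =
     Seq (marks (ot - 1)) (Seq scan
      (Seq (Seq (compile reg nt 5) (Loop 5 (Emit ot True)))
      (Seq (Emit ot False)
      (Seq (Seq (compile reg nt 5) (Loop 5 (Seq (print_row ot nt g) (Seq (Loop 3 Skip) (Inc 2)))))
      (Emit ot True)))))"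

text \<open>The output has the shape of \<open>encode\<close> for an instance with
  \<open>k = 1\<close>: the final \<open>[True]\<close> is \<open>bin 1\<close>.\<close>

lemma poly_time_computable_matrix:
  fixes nt g :: trm and N :: "nat \<Rightarrow> nat"
  assumes nt: "\<And>x s. eval x nt s = N (s 0)"
  shows "poly_time_computable (\<lambda>x. replicate (N (length x)) True @ [False] @
    concat (map (\<lambda>u. map (\<lambda>v. eval x g (env x u v) \<noteq> 0) [0..<N (length x)]) [0..<N (length x)]) @ [True])"
    (is "poly_time_computable ?f")
proof -
  define ot where "ot = height nt + height g + 10"
  have ot: "7 < ot" "0 < ot" "5 + height nt \<le> ot" "6 + height nt \<le> ot" "7 + height g \<le> ot"
    by (auto simp: ot_def)
  \<comment> \<open>This bounds all variables throughout the run: the input length, and row and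
    column indices up to the order of the matrix.\<close>
  define Bp :: "nat poly" where "Bp = [:0, 1:] + val_bound nt"
  define inner :: "nat poly" where
    "inner = time_bound g \<circ>\<^sub>p Bp + ([:3:] + ((val_bound g \<circ>\<^sub>p Bp) * [:4:] + [:1:] + [:1:]))"
  define row :: "nat poly" where
    "row = time_bound nt \<circ>\<^sub>p Bp + (Bp * (inner + [:3:]) + [:1:])"
  define outer :: "nat poly" where "outer = row + (Bp * [:4:] + [:1:] + [:1:])"
  define total :: "nat poly" where "total = [:ot:] + (([:0, 1:] * [:5:] + [:1:] + ([:0, 1:] * [:4:] + [:1:])) +
    ((time_bound nt \<circ>\<^sub>p Bp + (Bp * [:4:] + [:1:])) + ([:1:] +
    ((time_bound nt \<circ>\<^sub>p Bp + (Bp * (outer + [:3:]) + [:1:])) + [:1:]))))"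
  have "\<exists>T h. bs (print_matrix ot nt g) ((\<lambda>j. if j = 0 then tape_of x else (\<lambda>_. 0)), (\<lambda>_. 0))
        (poly total (length x)) (T, h) \<and> T (ot + 1 - 1) = tape_of (?f x)" for x
  proof -
    let ?l = "length x"
    define n where "n = N ?l"
    define B where "B = poly Bp ?l"
    define st where "st u v = (\<lambda>_ :: nat. 0 :: nat)(1 := ?l, 2 := u, 3 := v)" for u v
    have env: "s \<circ> reg = env x u v" if "s 1 = ?l" "s 2 = u" "s 3 = v" "s 4 = 0" for s u v
      using that by (auto simp: fun_eq_iff reg_def env_def eval_nat_numeral le_Suc_eq)
    have evn: "eval x nt (env x u v) = n" for u v by (simp add: nt env_def n_def)
    have "n \<le> poly (val_bound nt) ?l"
      using eval_bound[of "env x 0 0" ?l x nt] evn by (auto simp: env_def)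
    then have nB: "n \<le> B" "?l \<le> B" by (auto simp: B_def Bp_def)
    have comp: "bs (compile reg e d) (cfg x ot s out) (poly (time_bound e) B)
      (cfg x ot (s(d := eval x e (env x u v))) out)"
      if "5 \<le> d" "d + height e \<le> ot" "\<And>r. d \<le> r \<Longrightarrow> s r = 0" "s 0 = 0"
        "s 1 = ?l" "s 2 = u" "s 3 = v" "s 4 = 0" "u \<le> n" "v \<le> n" for e d s u v out
    proof -
      have "s (reg w) \<le> B" for w using that nB by (auto simp: reg_def eval_nat_numeral le_Suc_eq)
      then show ?thesis
        using compile_correct[of reg d e ot s B x out] that env[of s u v]
        by (auto simp: reg_def)
    qed
    define bit where "bit u v \<longleftrightarrow> eval x g (env x u v) \<noteq> 0" for u v
    have row: "bs (print_row ot nt g) (cfg x ot ((st u 0)(5 := c)) out) (poly row ?l)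
      (cfg x ot ((st u n)(5 := c)) (out @ map (bit u) [0..<n]))" if u: "u \<le> n" for u c out
    proof -
      have 1: "bs (compile reg nt 6) (cfg x ot ((st u 0)(5 := c)) out) (poly (time_bound nt) B)
        (cfg x ot ((st u 0)(5 := c, 6 := eval x nt (env x u 0))) out)"
        using ot u by (intro comp) (auto simp: st_def)
      have 2: "bs (Loop 6 (Seq (compile reg g 7) (Seq (If 7 {0} (Emit ot True) (Emit ot False))
          (Seq (Loop 7 Skip) (Inc 3))))) (cfg x ot ((st u 0)(5 := c, 6 := n)) (out @ map (bit u) [0..<0]))
          (B * (poly inner ?l + 3) + 1) (cfg x ot ((st u n)(5 := c)) (out @ map (bit u) [0..<n]))"
      proof (rule bs_Loop[where S = "\<lambda>i. (st u i)(5 := c)" and out = "\<lambda>i. out @ map (bit u) [0..<i]"])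
        fix i assume i: "i < n"
        let ?s = "(st u i)(5 := c, 6 := n - Suc i)" and ?o = "out @ map (bit u) [0..<i]"
        let ?v = "eval x g (env x u i)"
        have a: "bs (compile reg g 7) (cfg x ot ?s ?o) (poly (time_bound g) B) (cfg x ot (?s(7 := ?v)) ?o)"
          using ot u i by (intro comp) (auto simp: st_def)
        have b: "bs (If 7 {0} (Emit ot True) (Emit ot False)) (cfg x ot (?s(7 := ?v)) ?o) (1 + 2)
          (cfg x ot (?s(7 := ?v)) (out @ map (bit u) [0..<Suc i]))"
          using ot bs_Emit[of ot _ x "?s(7 := ?v)" ?o]
          by (intro bs_If_register) (auto simp: bit_def)
        have "?v \<le> poly (val_bound g) B"
          using u i nB by (intro eval_bound) (auto simp: env_def)
        then have c: "bs (Loop 7 Skip) (cfg x ot (?s(7 := ?v)) (out @ map (bit u) [0..<Suc i]))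
          (poly (val_bound g) B * 4 + 1) (cfg x ot (?s(7 := ?v, 7 := 0)) (out @ map (bit u) [0..<Suc i]))"
          using ot by (intro bs_clear) auto
        have "bs (Inc 3) (cfg x ot (?s(7 := ?v, 7 := 0)) (out @ map (bit u) [0..<Suc i])) 1
          (cfg x ot ((?s(7 := ?v, 7 := 0))(3 := Suc ((?s(7 := ?v, 7 := 0)) 3))) (out @ map (bit u) [0..<Suc i]))"
          using ot by (intro bs_Inc) auto
        moreover have "(?s(7 := ?v, 7 := 0))(3 := Suc ((?s(7 := ?v, 7 := 0)) 3)) =
          (st u (Suc i))(5 := c, 6 := n - Suc i)"
          by (auto simp: st_def fun_eq_iff)
        ultimately have d: "bs (Inc 3) (cfg x ot (?s(7 := ?v, 7 := 0)) (out @ map (bit u) [0..<Suc i])) 1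
          (cfg x ot ((st u (Suc i))(5 := c, 6 := n - Suc i)) (out @ map (bit u) [0..<Suc i]))" by metis
        show "bs (Seq (compile reg g 7) (Seq (If 7 {0} (Emit ot True) (Emit ot False))
          (Seq (Loop 7 Skip) (Inc 3)))) (cfg x ot ?s ?o) (poly inner ?l)
          (cfg x ot ((st u (Suc i))(5 := c, 6 := n - Suc i)) (out @ map (bit u) [0..<Suc i]))"
          by (rule bs.weaken[OF bs.Seq[OF a bs.Seq[OF b bs.Seq[OF c d]]]])
            (simp add: inner_def poly_pcompose B_def)
      qed (use ot nB in \<open>auto simp: st_def fun_eq_iff\<close>)
      have "(st u 0)(5 := c, 6 := eval x nt (env x u 0)) = (st u 0)(5 := c, 6 := n)"
        by (simp add: evn)
      with 2 show ?thesis
        unfolding print_row_def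
        by (intro bs.weaken[OF bs.Seq[OF 1]]) (auto simp: row_def poly_pcompose B_def evn)
    qed
    define rows where "rows u = concat (map (\<lambda>u. map (bit u) [0..<n]) [0..<u])" for u
    have 0: "bs (marks (ot - 1)) ((\<lambda>j. if j = 0 then tape_of x else (\<lambda>_. 0)), (\<lambda>_. 0)) (ot - 1 + 1)
      (cfg x ot (\<lambda>_. 0) [])"
    proof -
      have "((\<lambda>j. if j = 0 then tape_of x else if j \<le> ot - 1 then (\<lambda>i. if i = 0 then 1 else 0) else (\<lambda>_. 0)), (\<lambda>_. 0))
        = cfg x ot (\<lambda>_. 0) []"
        using ot by (auto simp: cfg_def fun_eq_iff tape_of_def)
      then show ?thesis using bs_marks[of "ot - 1" x] by metis
    qed
    have s1: "(\<lambda>_. 0)(1 := ?l) = st 0 0" by (auto simp: st_def fun_eq_iff)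
    have 1: "bs scan (cfg x ot (\<lambda>_. 0) []) (?l * 5 + 1 + (?l * 4 + 1)) (cfg x ot (st 0 0) [])"
      using bs_scan[of ot x "[]"] ot s1 by simp
    have 2: "bs (compile reg nt 5) (cfg x ot (st 0 0) out) (poly (time_bound nt) B)
        (cfg x ot ((st 0 0)(5 := n)) out)" for out
    proof -
      have "bs (compile reg nt 5) (cfg x ot (st 0 0) out) (poly (time_bound nt) B)
        (cfg x ot ((st 0 0)(5 := eval x nt (env x 0 0))) out)"
        using ot by (intro comp) (auto simp: st_def)
      then show ?thesis unfolding evn .
    qed
    have 3: "bs (Loop 5 (Emit ot True)) (cfg x ot ((st 0 0)(5 := n)) []) (B * 4 + 1)
        (cfg x ot (st 0 0) (replicate n True))"
    proof -
      have "bs (Loop 5 (Emit ot True)) (cfg x ot ((st 0 0)(5 := n)) (replicate 0 True)) (B * (1 + 3) + 1)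
        (cfg x ot (st 0 0) (replicate n True))"
      proof (rule bs_Loop[where S = "\<lambda>i. st 0 0" and out = "\<lambda>i. replicate i True"])
        show "bs (Emit ot True) (cfg x ot ((st 0 0)(5 := n - Suc i)) (replicate i True)) 1
          (cfg x ot ((st 0 0)(5 := n - Suc i)) (replicate (Suc i) True))" for i
          using bs_Emit[of ot True x "(st 0 0)(5 := n - Suc i)" "replicate i True"] ot
          by (simp add: replicate_append_same)
      qed (use ot nB in \<open>auto simp: st_def fun_eq_iff\<close>)
      then show ?thesis by simp
    qed
    let ?o = "replicate n True @ [False]"
    have 4: "bs (Emit ot False) (cfg x ot (st 0 0) (replicate n True)) 1 (cfg x ot (st 0 0) ?o)"
      by (rule bs_Emit[OF ot(2)])
    have 5: "bs (Loop 5 (Seq (print_row ot nt g) (Seq (Loop 3 Skip) (Inc 2))))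
      (cfg x ot ((st 0 0)(5 := n)) (?o @ rows 0)) (B * (poly outer ?l + 3) + 1) (cfg x ot (st n 0) (?o @ rows n))"
    proof (rule bs_Loop[where S = "\<lambda>i. st i 0" and out = "\<lambda>i. ?o @ rows i"])
      fix i assume i: "i < n"
      let ?c = "n - Suc i" and ?out = "?o @ rows (Suc i)"
      have rS: "?o @ rows i @ map (bit i) [0..<n] = ?out" by (simp add: rows_def)
      have a: "bs (print_row ot nt g) (cfg x ot ((st i 0)(5 := ?c)) (?o @ rows i)) (poly row ?l)
         (cfg x ot ((st i n)(5 := ?c)) ?out)"
        using row[of i ?c "?o @ rows i"] i rS by simp
      have b: "bs (Loop 3 Skip) (cfg x ot ((st i n)(5 := ?c)) ?out) (B * 4 + 1)
         (cfg x ot ((st i n)(5 := ?c, 3 := 0)) ?out)"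
        using ot nB by (intro bs_clear) (auto simp: st_def)
      have "bs (Inc 2) (cfg x ot ((st i n)(5 := ?c, 3 := 0)) ?out) 1
        (cfg x ot ((st i n)(5 := ?c, 3 := 0, 2 := Suc (((st i n)(5 := ?c, 3 := 0)) 2))) ?out)"
        using ot by (intro bs_Inc) auto
      moreover have "(st i n)(5 := ?c, 3 := 0, 2 := Suc (((st i n)(5 := ?c, 3 := 0)) 2)) = (st (Suc i) 0)(5 := ?c)"
        by (auto simp: st_def fun_eq_iff)
      ultimately have c: "bs (Inc 2) (cfg x ot ((st i n)(5 := ?c, 3 := 0)) ?out) 1
        (cfg x ot ((st (Suc i) 0)(5 := ?c)) ?out)" by metis
      show "bs (Seq (print_row ot nt g) (Seq (Loop 3 Skip) (Inc 2))) (cfg x ot ((st i 0)(5 := ?c)) (?o @ rows i))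
        (poly outer ?l) (cfg x ot ((st (Suc i) 0)(5 := ?c)) ?out)"
        by (rule bs.weaken[OF bs.Seq[OF a bs.Seq[OF b c]]]) (simp add: outer_def B_def)
    qed (use ot nB in \<open>auto simp: st_def fun_eq_iff\<close>)
    have 7: "bs (Loop 5 (Seq (print_row ot nt g) (Seq (Loop 3 Skip) (Inc 2))))
      (cfg x ot ((st 0 0)(5 := n)) ?o) (B * (poly outer ?l + 3) + 1) (cfg x ot (st n 0) (?o @ rows n))"
      using 5 by (simp add: rows_def)
    have 6: "bs (Emit ot True) (cfg x ot (st n 0) (?o @ rows n)) 1 (cfg x ot (st n 0) ((?o @ rows n) @ [True]))"
      by (rule bs_Emit[OF ot(2)])
    have "bs (print_matrix ot nt g) ((\<lambda>j. if j = 0 then tape_of x else (\<lambda>_. 0)), (\<lambda>_. 0))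
        (poly total ?l) (cfg x ot (st n 0) ((?o @ rows n) @ [True]))"
      unfolding print_matrix_def
      by (rule bs.weaken[OF bs.Seq[OF 0 bs.Seq[OF 1 bs.Seq[OF bs.Seq[OF 2 3] bs.Seq[OF 4 bs.Seq[OF bs.Seq[OF 2 7] 6]]]]]])
        (use ot in \<open>simp add: total_def poly_pcompose B_def\<close>)
    moreover have "(?o @ rows n) @ [True] = ?f x" by (simp add: rows_def n_def bit_def[abs_def])
    moreover have "fst (cfg x ot s out) ot = tape_of out" for s out using ot by (simp add: cfg_def)
    moreover obtain T h where "cfg x ot (st n 0) ((?o @ rows n) @ [True]) = (T, h)" by fastforce
    ultimately show ?thesis by (intro exI[of _ T] exI[of _ h]) (metis add_diff_cancel_right' fst_conv)
  qed
  moreover have "wf_com (ot + 1) (print_matrix ot nt g)"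
  proof -
    have m: "n < ot + 1 \<Longrightarrow> wf_com (ot + 1) (marks n)" for n by (induction n) auto
    have r: "reg v < 5" "reg v < 6" "reg v < 7" for v by (auto simp: reg_def)
    show ?thesis
      unfolding print_matrix_def print_row_def scan_def
      using ot m[of "ot - 1"] wf_compile[of reg 5 nt "ot + 1"] wf_compile[of reg 6 nt "ot + 1"]
        wf_compile[of reg 7 g "ot + 1"] r by simp
  qed
  ultimately show ?thesis
    by (intro poly_time_computable_by_com[of "ot + 1" "print_matrix ot nt g" total]) auto
qed

section \<open>The gadget graph\<close>

lemma drdf_zero:
  assumes "drdf V E f" "v \<in> V" "f v = 0"
  shows "(\<exists>w \<in> neighbors E v. f w = 3) \<or>
    (\<exists>w \<in> neighbors E v. \<exists>w' \<in> neighbors E v. w \<noteq> w' \<and> f w = 2 \<and> f w' = 2)"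
proof (cases "\<exists>w \<in> neighbors E v. f w = 3")
  case False
  then have "2 \<le> card {u \<in> neighbors E v. f u = 2}" using assms by (auto simp: drdf_def)
  then obtain T where "T \<subseteq> {u \<in> neighbors E v. f u = 2}" "card T = 2"
    by (meson obtain_subset_with_card_n)
  then show ?thesis unfolding card_2_iff by blast
qed simp

text \<open>Seven vertices of total weight at most 6 include one of value 0. All its neighbours lie
  on the opposite side, which therefore has a 3 or two 2s, so weight 3 there means a single 3.
  Nothing is assumed to be adjacent, so the bound persists when edges are deleted.\<close>

lemma biclique_gadget:
  assumes f: "drdf V E f" and fin: "finite X" "finite Y" and sub: "X \<subseteq> V" "Y \<subseteq> V"
    and A: "A \<subseteq> X" "7 \<le> card A" "\<And>a. a \<in> A \<Longrightarrow> neighbors E a \<subseteq> Y"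
    and B: "B \<subseteq> Y" "7 \<le> card B" "\<And>b. b \<in> B \<Longrightarrow> neighbors E b \<subseteq> X"
  shows "6 \<le> sum f X + sum f Y"
    and "sum f X + sum f Y \<le> 6 \<Longrightarrow> \<exists>x \<in> X. f x = 3 \<and> (\<forall>x' \<in> X - {x}. f x' = 0)"
    and "sum f X + sum f Y \<le> 6 \<Longrightarrow> \<exists>y \<in> Y. f y = 3 \<and> (\<forall>y' \<in> Y - {y}. f y' = 0)"
proof -
  have half: "3 \<le> sum f X' \<and> (sum f X' = 3 \<longrightarrow> (\<exists>x \<in> X'. f x = 3 \<and> (\<forall>x' \<in> X' - {x}. f x' = 0)))"
    if h: "finite X'" "finite B'" "B' \<subseteq> V" "7 \<le> card B'" "\<And>b. b \<in> B' \<Longrightarrow> neighbors E b \<subseteq> X'"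
      "sum f B' \<le> 6" for X' B'
  proof -
    have "\<exists>b \<in> B'. f b = 0"
    proof (rule ccontr)
      assume "\<not> (\<exists>b \<in> B'. f b = 0)"
      then have "(\<Sum>b \<in> B'. 1) \<le> sum f B'" by (intro sum_mono) (auto simp: Suc_le_eq)
      then show False using h(4,6) by simp
    qed
    then obtain b where b: "b \<in> B'" "f b = 0" by blast
    have "(\<exists>w \<in> X'. f w = 3) \<or> (\<exists>w \<in> X'. \<exists>w' \<in> X'. w \<noteq> w' \<and> f w = 2 \<and> f w' = 2)"
      using drdf_zero[OF f, of b] b h(3) h(5)[OF b(1)] by blast
    then show ?thesis
    proof
      assume "\<exists>w \<in> X'. f w = 3"
      then obtain w where w: "w \<in> X'" "f w = 3" by blast
      then have "sum f X' = 3 + sum f (X' - {w})" using h(1) by (simp add: sum.remove)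
      then show ?thesis using w h(1) by auto
    next
      assume "\<exists>w \<in> X'. \<exists>w' \<in> X'. w \<noteq> w' \<and> f w = 2 \<and> f w' = 2"
      then obtain w w' where w: "w \<in> X'" "w' \<in> X'" "w \<noteq> w'" "f w = 2" "f w' = 2" by blast
      then have "sum f {w, w'} \<le> sum f X'" using h(1) by (intro sum_mono2) auto
      then show ?thesis using w by simp
    qed
  qed
  have AX: "sum f A \<le> sum f X" using A(1) fin(1) by (intro sum_mono2) auto
  have BY: "sum f B \<le> sum f Y" using B(1) fin(2) by (intro sum_mono2) auto
  have fAB: "finite A" "finite B" "A \<subseteq> V" "B \<subseteq> V"
    using A(1) B(1) fin sub finite_subset by blast+
  note X = half[OF fin(1) fAB(2,4) B(2,3)] and Y = half[OF fin(2) fAB(1,3) A(2,3)]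
  show ge: "6 \<le> sum f X + sum f Y"
  proof (rule ccontr)
    assume lt: "\<not> ?thesis"
    then have "3 \<le> sum f X" "3 \<le> sum f Y" using X Y AX BY by auto
    then show False using lt by simp
  qed
  assume le: "sum f X + sum f Y \<le> 6"
  then have "3 \<le> sum f X" "3 \<le> sum f Y" using X Y AX BY by auto
  then have eq: "sum f X = 3" "sum f Y = 3" using le by auto
  show "\<exists>x \<in> X. f x = 3 \<and> (\<forall>x' \<in> X - {x}. f x' = 0)" using X eq BY by simp
  show "\<exists>y \<in> Y. f y = 3 \<and> (\<forall>y' \<in> Y - {y}. f y' = 0)" using Y eq AX by simp
qed

section \<open>The graph of blocks and clauses and the weights it admits\<close>

datatype ('b, 'c) vtx = XV 'b nat | YV 'b nat | CV 'c

text \<open>The special block: vertices 1 to 6 on the X side form three pairs, pair \<open>k\<close> being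
  exactly the nonneighbours of Y vertex \<open>k + 1\<close> among the first seven X vertices.\<close>

definition special_adj :: "nat \<Rightarrow> nat \<Rightarrow> bool" where
  "special_adj a a' \<longleftrightarrow>
     a = 0 \<or> (1 \<le> a \<and> a \<le> 6 \<and> a' \<noteq> 1 + (a - 1) div 2) \<or> (7 \<le> a \<and> a' < 4)"

text \<open>Values of unknowns lie below \<open>D\<close>. The X positions from \<open>D\<close> on
  are joined to no clause, and \<open>A\<close> leaves at least seven of them for
  \<open>biclique_gadget\<close>; \<open>7 \<le> D\<close> does the same for positions 1 to 6 of the
  special block, which are below \<open>D\<close> too.\<close>

locale gadget_graph =
  fixes Bs :: "'b set" and b0 :: 'b and A D :: nat and Cs :: "'c set"
    and lit :: "'b \<Rightarrow> nat \<Rightarrow> 'c \<Rightarrow> bool"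
  assumes fin_Bs: "finite Bs" and fin_Cs: "finite Cs" and b0: "b0 \<in> Bs"
    and D: "7 \<le> D" and A: "D + 7 \<le> A"
begin

definition X_of :: "'b \<Rightarrow> ('b, 'c) vtx set" where "X_of b = XV b ` {..<A}"
definition Y_of :: "'b \<Rightarrow> ('b, 'c) vtx set" where "Y_of b = YV b ` {..<A}"

definition Vs :: "('b, 'c) vtx set" where
  "Vs = (\<Union>b \<in> Bs. X_of b \<union> Y_of b) \<union> CV ` Cs"

text \<open>Clauses touch X sides only, so the X vertices against the Y vertices and clauses form
  the bipartition.\<close>

fun joined :: "('b, 'c) vtx \<Rightarrow> ('b, 'c) vtx \<Rightarrow> bool" where
  "joined (XV b a) (YV b' a') \<longleftrightarrow> b = b' \<and> (b = b0 \<longrightarrow> special_adj a a')"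
| "joined (XV b a) (CV c) \<longleftrightarrow> (if b = b0 then 1 \<le> a \<and> a \<le> 6 else a < D \<and> lit b a c)"
| "joined _ _ \<longleftrightarrow> False"

definition Es :: "('b, 'c) vtx set set" where
  "Es = {{u, v} | u v. u \<in> Vs \<and> v \<in> Vs \<and> joined u v}"

definition sat :: bool where
  "sat \<longleftrightarrow> (\<exists>\<alpha>. (\<forall>b. \<alpha> b < D) \<and> (\<forall>c \<in> Cs. \<exists>b \<in> Bs - {b0}. lit b (\<alpha> b) c))"

lemma Vs_simps [simp]:
  "XV b a \<in> Vs \<longleftrightarrow> b \<in> Bs \<and> a < A" "YV b a \<in> Vs \<longleftrightarrow> b \<in> Bs \<and> a < A" "CV c \<in> Vs \<longleftrightarrow> c \<in> Cs"
  by (auto simp: Vs_def X_of_def Y_of_def)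

lemma fin_Vs: "finite Vs"
  using fin_Bs fin_Cs by (auto simp: Vs_def X_of_def Y_of_def)

lemma joined_imp: "joined u v \<Longrightarrow> u \<in> range (case_prod XV) \<and> v \<notin> range (case_prod XV)"
  by (cases "(u, v)" rule: joined.cases) auto

lemma Es_iff: "{u, v} \<in> Es \<longleftrightarrow> u \<in> Vs \<and> v \<in> Vs \<and> (joined u v \<or> joined v u)"
  by (auto simp: Es_def doubleton_eq_iff)

lemma simple_graph_Es: "simple_graph Vs Es"
  unfolding simple_graph_def Es_def using fin_Vs joined_imp by (fastforce simp: card_2_iff)

lemma bipartite_Es: "bipartite Vs Es"
  unfolding bipartite_def
proof (intro exI conjI ballI)
  let ?X = "Vs \<inter> range (case_prod XV)"
  show "?X \<union> (Vs - ?X) = Vs" "?X \<inter> (Vs - ?X) = {}" by auto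
  fix e assume "e \<in> Es"
  then show "\<exists>x \<in> ?X. \<exists>y \<in> Vs - ?X. e = {x, y}"
    unfolding Es_def using joined_imp by blast
qed

lemma sum_Vs:
  "sum f Vs = (\<Sum>b \<in> Bs. sum f (X_of b) + sum f (Y_of b)) + sum f (CV ` Cs)" for f :: "_ \<Rightarrow> nat"
proof -
  have "sum f Vs = sum f (\<Union>b \<in> Bs. X_of b \<union> Y_of b) + sum f (CV ` Cs)"
    unfolding Vs_def using fin_Bs fin_Cs
    by (intro sum.union_disjoint) (auto simp: X_of_def Y_of_def)
  also have "sum f (\<Union>b \<in> Bs. X_of b \<union> Y_of b) = (\<Sum>b \<in> Bs. sum f (X_of b \<union> Y_of b))"
    using fin_Bs by (intro sum.UNION_disjoint) (auto simp: X_of_def Y_of_def)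
  also have "(\<Sum>b \<in> Bs. sum f (X_of b \<union> Y_of b)) = (\<Sum>b \<in> Bs. sum f (X_of b) + sum f (Y_of b))"
    by (intro sum.cong sum.union_disjoint refl) (auto simp: X_of_def Y_of_def)
  finally show ?thesis .
qed

lemma sum_X_of: "sum f (X_of b) = (\<Sum>a<A. f (XV b a))"
  and sum_Y_of: "sum f (Y_of b) = (\<Sum>a<A. f (YV b a))"
  by (auto simp: X_of_def Y_of_def sum.reindex inj_on_def)

text \<open>\<open>biclique_gadget\<close> applies with the X positions from \<open>D\<close> on and
  the whole Y side, none of which sees a clause. Arbitrary subgraphs are allowed so as to cover the
  graph before and after a deletion.\<close>

lemma block_weight:
  assumes f: "drdf Vs E f" and E: "E \<subseteq> Es" and b: "b \<in> Bs"
  shows "6 \<le> sum f (X_of b) + sum f (Y_of b)"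
    and "sum f (X_of b) + sum f (Y_of b) \<le> 6 \<Longrightarrow>
      \<exists>a<A. f (XV b a) = 3 \<and> (\<forall>a'<A. a' \<noteq> a \<longrightarrow> f (XV b a') = 0)"
    and "sum f (X_of b) + sum f (Y_of b) \<le> 6 \<Longrightarrow>
      \<exists>a<A. f (YV b a) = 3 \<and> (\<forall>a'<A. a' \<noteq> a \<longrightarrow> f (YV b a') = 0)"
proof -
  have fin: "finite (X_of b)" "finite (Y_of b)" "X_of b \<subseteq> Vs" "Y_of b \<subseteq> Vs"
    using b by (auto simp: X_of_def Y_of_def)
  have 1: "XV b ` {D..<A} \<subseteq> X_of b" "7 \<le> card (XV b ` {D..<A})"
    using A by (auto simp: X_of_def card_image inj_on_def)
  have 2: "neighbors E v \<subseteq> Y_of b" if "v \<in> XV b ` {D..<A}" for v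
  proof
    fix u assume "u \<in> neighbors E v"
    then have "{u, v} \<in> Es" using E by (auto simp: neighbors_def)
    then show "u \<in> Y_of b"
      using that D by (cases u) (auto simp: Es_iff Y_of_def split: if_splits)
  qed
  have 3: "Y_of b \<subseteq> Y_of b" "7 \<le> card (Y_of b)"
    using A by (auto simp: Y_of_def card_image inj_on_def)
  have 4: "neighbors E v \<subseteq> X_of b" if "v \<in> Y_of b" for v
  proof
    fix u assume "u \<in> neighbors E v"
    then have "{u, v} \<in> Es" using E by (auto simp: neighbors_def)
    then show "u \<in> X_of b"
      using that by (cases u) (auto simp: Es_iff X_of_def Y_of_def split: if_splits)
  qed
  note g = biclique_gadget[OF f fin 1 2 3 4]
  show "6 \<le> sum f (X_of b) + sum f (Y_of b)" by (rule g(1))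
  assume le: "sum f (X_of b) + sum f (Y_of b) \<le> 6"
  show "\<exists>a<A. f (XV b a) = 3 \<and> (\<forall>a'<A. a' \<noteq> a \<longrightarrow> f (XV b a') = 0)"
    using g(2)[OF _ _ le] by (force simp: X_of_def)
  show "\<exists>a<A. f (YV b a) = 3 \<and> (\<forall>a'<A. a' \<noteq> a \<longrightarrow> f (YV b a') = 0)"
    using g(3)[OF _ _ le] by (force simp: Y_of_def)
qed

text \<open>Here \<open>a1\<close> and \<open>a2\<close> are the vertices of value 3 on the two
  sides, each of which must dominate the opposite side except possibly the other one. A vertex
  \<open>a1\<close> above 6 misses both Y vertices 4 and 5. If \<open>a1\<close> lies in a pair then
  \<open>a2\<close> is the Y vertex it misses, but the partner in the pair misses that vertex as
  well. Finally X vertex 7 sees only Y vertices below 4.\<close>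

lemma special_adj_unique:
  assumes 1: "\<And>a'. a' < 14 \<Longrightarrow> a' \<noteq> a2 \<Longrightarrow> special_adj a1 a'"
    and 2: "\<And>a'. a' < 14 \<Longrightarrow> a' \<noteq> a1 \<Longrightarrow> special_adj a' a2"
  shows "a1 = 0" "a2 < 4"
proof -
  show a1: "a1 = 0"
  proof (rule ccontr)
    assume "a1 \<noteq> 0"
    show False
    proof (cases "a1 \<le> 6")
      case False
      then have "\<not> special_adj a1 4" "\<not> special_adj a1 5" by (auto simp: special_adj_def)
      then show False using 1[of 4] 1[of 5] by (cases "a2 = 4") auto
    next
      case True
      let ?k = "(a1 - 1) div 2"
      have "\<not> special_adj a1 (1 + ?k)" using True \<open>a1 \<noteq> 0\<close> by (auto simp: special_adj_def)
      moreover have "1 + ?k < 14" using True by linarith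
      ultimately have "a2 = 1 + ?k" using 1[of "1 + ?k"] by blast
      \<comment> \<open>The witness is the other member of the pair of \<open>a1\<close>.\<close>
      moreover have "\<exists>a'. a' \<noteq> a1 \<and> 1 \<le> a' \<and> a' \<le> 6 \<and> (a' - 1) div 2 = ?k"
        using True \<open>a1 \<noteq> 0\<close> by presburger
      then obtain a' where "a' \<noteq> a1" "1 \<le> a'" "a' \<le> 6" "(a' - 1) div 2 = ?k" by blast
      ultimately show False using 2[of a'] by (auto simp: special_adj_def)
    qed
  qed
  show "a2 < 4" using 2[of 7] a1 by (auto simp: special_adj_def)
qed

text \<open>The weight is too small for anything but 6 on every block and 0 on the clauses, so every
  block selects one X vertex and these dominate all clauses. The special block selects X vertex 0,
  which no clause sees; hence the other blocks satisfy the clauses. The 3 on its Y side sits below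
  4, so Y vertex 4 has value 0 and depends on its edge to X vertex 0.\<close>

lemma cheap_drdf:
  assumes f: "drdf Vs E f" and E: "E \<subseteq> Es"
    and le: "sum f Vs \<le> 6 * card Bs"
  shows "sat \<and> {XV b0 0, YV b0 4} \<in> E"
proof -
  let ?w = "\<lambda>b. sum f (X_of b) + sum f (Y_of b)"
  have ge: "6 \<le> ?w b" if "b \<in> Bs" for b using block_weight(1)[OF f E that] .
  then have tot: "6 * card Bs \<le> sum ?w Bs"
    using sum_mono[of Bs "\<lambda>_. 6" ?w] by simp
  with le have C0: "sum f (CV ` Cs) = 0" and Bs6: "sum ?w Bs = 6 * card Bs"
    by (auto simp: sum_Vs)
  have w6: "?w b \<le> 6" if b: "b \<in> Bs" for b
  proof -
    have "sum ?w Bs = ?w b + sum ?w (Bs - {b})" using b fin_Bs by (simp add: sum.remove)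
    moreover have "6 * card (Bs - {b}) \<le> sum ?w (Bs - {b})"
      using sum_mono[of "Bs - {b}" "\<lambda>_. 6" ?w] ge by simp
    moreover have "card Bs = Suc (card (Bs - {b}))"
      using card.remove[OF fin_Bs b] .
    ultimately show ?thesis using Bs6 by simp
  qed
  have C: "f (CV c) = 0" if "c \<in> Cs" for c using C0 that fin_Cs by auto
  have "\<exists>a. \<forall>b \<in> Bs. a b < A \<and> f (XV b (a b)) = 3 \<and> (\<forall>a'<A. a' \<noteq> a b \<longrightarrow> f (XV b a') = 0)"
    using block_weight(2)[OF f E _ w6] by (intro bchoice) blast
  then obtain p where p: "\<And>b. b \<in> Bs \<Longrightarrow> p b < A \<and> f (XV b (p b)) = 3"
    "\<And>b a'. b \<in> Bs \<Longrightarrow> a' < A \<Longrightarrow> a' \<noteq> p b \<Longrightarrow> f (XV b a') = 0" by metis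
  obtain q where q: "q < A" "f (YV b0 q) = 3" "\<And>a'. a' < A \<Longrightarrow> a' \<noteq> q \<Longrightarrow> f (YV b0 a') = 0"
    using block_weight(3)[OF f E b0 w6[OF b0]] by auto
  have X23: "f (XV b a) = 0 \<or> f (XV b a) = 3 \<and> a = p b" if "b \<in> Bs" "a < A" for a b
    using p that by (cases "a = p b") auto
  have nb: "{u, v} \<in> E \<and> u \<in> Vs \<and> (joined u v \<or> joined v u)" if "u \<in> neighbors E v" for u v
    using that E by (auto simp: neighbors_def Es_iff dest: subsetD)
  have Y: "{XV b0 (p b0), YV b0 a'} \<in> E" if a': "a' < A" "a' \<noteq> q" for a'
  proof -
    have "u = XV b0 (p b0) \<and> f u = 3" if "u \<in> neighbors E (YV b0 a')" "f u = 2 \<or> f u = 3" for u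
    proof -
      from nb[OF that(1)] obtain a where "u = XV b0 a" "a < A" by (cases u) auto
      then show ?thesis using X23[OF b0, of a] that(2) by auto
    qed
    then show ?thesis
      using drdf_zero[OF f, of "YV b0 a'"] q(3)[OF a'] a' b0 nb by fastforce
  qed
  \<comment> \<open>An X vertex may also see clauses, but those carry 0, so only Y vertex
    \<open>q\<close> can dominate it.\<close>
  have X: "joined (XV b0 a') (YV b0 q)" if a': "a' < A" "a' \<noteq> p b0" for a'
  proof -
    have "u = YV b0 q \<and> f u = 3" if "u \<in> neighbors E (XV b0 a')" "f u = 2 \<or> f u = 3" for u
    proof -
      from nb[OF that(1)] have "(\<exists>a<A. u = YV b0 a) \<or> (\<exists>c \<in> Cs. u = CV c)"
        by (cases u) auto
      then show ?thesis using q C that(2) by fastforce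
    qed
    then show ?thesis
      using drdf_zero[OF f, of "XV b0 a'"] p(2)[OF b0 a'] a' b0 nb by fastforce
  qed
  have 14: "a' < A" if "a' < 14" for a' using that A D by simp
  have p0: "p b0 = 0" and q4: "q < 4"
  proof -
    have "special_adj (p b0) a'" if "a' < 14" "a' \<noteq> q" for a'
      using Y[OF 14[OF that(1)] that(2)] E by (auto simp: Es_iff dest: subsetD)
    moreover have "special_adj a' q" if "a' < 14" "a' \<noteq> p b0" for a'
      using X[OF 14[OF that(1)] that(2)] by simp
    ultimately show "p b0 = 0" "q < 4" using special_adj_unique by blast+
  qed
  have sat
    unfolding sat_def
  proof (intro exI conjI ballI allI)
    \<comment> \<open>A block may select a position from \<open>D\<close> on, which satisfies no
      clause; 0 is then a harmless value.\<close>
    let ?\<alpha> = "\<lambda>b. if p b < D then p b else 0"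
    show "?\<alpha> b < D" for b using D by simp
    fix c assume c: "c \<in> Cs"
    have u: "\<exists>b \<in> Bs. u = XV b (p b) \<and> f u = 3" if "u \<in> neighbors E (CV c)" "f u = 2 \<or> f u = 3" for u
    proof -
      from nb[OF that(1)] obtain b a where "u = XV b a" "b \<in> Bs" "a < A" by (cases u) auto
      then show ?thesis using X23[of b a] that(2) by auto
    qed
    obtain u where "u \<in> neighbors E (CV c)" "f u = 2 \<or> f u = 3"
      using drdf_zero[OF f, of "CV c"] C[OF c] c by auto
    with u[OF this] obtain b where b: "b \<in> Bs" "XV b (p b) \<in> neighbors E (CV c)" by blast
    from nb[OF b(2)] have "b \<noteq> b0" "p b < D" "lit b (p b) c"
      using p0 by (auto split: if_splits)
    then show "\<exists>b \<in> Bs - {b0}. lit b (?\<alpha> b) c" using b(1) by (intro bexI[of _ b]) auto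
  qed
  moreover have "{XV b0 0, YV b0 4} \<in> E" using Y[of 4] 14[of 4] q4 p0 by auto
  ultimately show "sat \<and> {XV b0 0, YV b0 4} \<in> E" ..
qed

lemma weight_sat:
  assumes sat
  shows "gamma_dR Vs Es \<le> 6 * card Bs"
proof -
  from assms obtain \<alpha> where \<alpha>: "\<And>b. \<alpha> b < D" "\<And>c. c \<in> Cs \<Longrightarrow> \<exists>b \<in> Bs - {b0}. lit b (\<alpha> b) c"
    unfolding sat_def by blast
  \<comment> \<open>In the special block X vertex 0 and Y vertex 0 both see the whole opposite side,
    so the pair of 3s is placed there.\<close>
  define \<beta> where "\<beta> = \<alpha>(b0 := 0)"
  have \<beta>: "\<beta> b < D" "\<beta> b < A" for b using \<alpha>(1)[of b] A D by (auto simp: \<beta>_def)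
  define f :: "('b, 'c) vtx \<Rightarrow> nat" where
    "f = (\<lambda>v. case v of XV b a \<Rightarrow> if a = \<beta> b then 3 else 0 | YV b a \<Rightarrow> if a = 0 then 3 else 0 | CV c \<Rightarrow> 0)"
  have "drdf Vs Es f"
    unfolding drdf_def
  proof (intro conjI ballI impI)
    show "f ` Vs \<subseteq> {0, 1, 2, 3}" by (auto simp: f_def split: vtx.splits)
    fix v assume v: "v \<in> Vs"
    have "\<exists>w \<in> neighbors Es v. f w = 3"
    proof (cases v)
      case (XV b a)
      then have "YV b 0 \<in> neighbors Es v"
        using v A by (auto simp: neighbors_def Es_iff special_adj_def)
      then show ?thesis by (intro bexI[of _ "YV b 0"]) (auto simp: f_def)
    next
      case (YV b a)
      then have "XV b (\<beta> b) \<in> neighbors Es v"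
        using v \<beta>[of b] by (auto simp: neighbors_def Es_iff special_adj_def \<beta>_def)
      then show ?thesis by (intro bexI[of _ "XV b (\<beta> b)"]) (auto simp: f_def)
    next
      case (CV c)
      then obtain b where "b \<in> Bs - {b0}" "lit b (\<alpha> b) c" using \<alpha>(2) v by auto
      then have "XV b (\<beta> b) \<in> neighbors Es v"
        using v \<beta>[of b] \<alpha>(1)[of b] CV by (auto simp: neighbors_def Es_iff \<beta>_def)
      then show ?thesis by (intro bexI[of _ "XV b (\<beta> b)"]) (auto simp: f_def)
    qed
    then show "2 \<le> card {u \<in> neighbors Es v. f u = 2} \<or> (\<exists>w\<in>neighbors Es v. f w = 3)"
      and "\<exists>w\<in>neighbors Es v. 2 \<le> f w" by force+
  qed
  then have "gamma_dR Vs Es \<le> sum f Vs" by (rule gamma_dR_le)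
  also have "sum f Vs = (\<Sum>b \<in> Bs. 6)"
  proof -
    have "sum f (X_of b) = 3" "sum f (Y_of b) = 3" for b
      using \<beta>(2)[of b] A by (auto simp: f_def sum_X_of sum_Y_of sum.delta)
    moreover have "sum f (CV ` Cs) = 0" by (intro sum.neutral) (auto simp: f_def)
    ultimately show ?thesis by (simp add: sum_Vs)
  qed
  finally show ?thesis by simp
qed

text \<open>The fallback function uses pair \<open>r\<close> of the special block. An edge has two ends, so
  one of the three choices of \<open>r\<close> puts no weight on an end of the deleted edge.\<close>

lemma weight_robust:
  assumes e: "e \<in> Es"
  shows "gamma_dR Vs (Es - {e}) \<le> 6 * card Bs + 1"
proof -
  \<comment> \<open>For a vertex that can carry weight, \<open>idx\<close> is the only choice of
    \<open>r\<close> for which it does; for clauses and for vertices 0 of the special block the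
    value 3 excludes all choices.\<close>
  define idx :: "('b, 'c) vtx \<Rightarrow> nat" where
    "idx = (\<lambda>v. case v of XV b a \<Rightarrow> if b = b0 then if a = 0 then 3 else (a - 1) div 2 else a
       | YV b a \<Rightarrow> if b = b0 then if a = 0 then 3 else a - 1 else a | CV c \<Rightarrow> 3)"
  obtain r where r: "r < 3" "\<And>v. v \<in> e \<Longrightarrow> idx v \<noteq> r"
  proof -
    obtain u v where uv: "e = {u, v}" using e by (auto simp: Es_def)
    have "\<exists>r<3. r \<noteq> idx u \<and> r \<noteq> idx v"
    proof -
      have "\<not> {0, 1, 2} \<subseteq> {idx u, idx v}"
        using card_mono[of "{idx u, idx v}" "{0, 1, 2}"] card_insert_le_m1[of 2 "{idx v}" "idx u"] by auto
      then have "\<exists>r \<in> {0, 1, 2}. r \<notin> {idx u, idx v}" by blast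
      then obtain r where "r \<in> {0, 1, 2}" "r \<notin> {idx u, idx v}" ..
      then show ?thesis by (intro exI[of _ r]) auto
    qed
    then show ?thesis using uv that by auto
  qed
  \<comment> \<open>Pair \<open>r\<close> dominates all clauses and all Y vertices of its block but
    \<open>r + 1\<close>. That vertex carries 3 itself and dominates all X vertices but pair
    \<open>r\<close>, which carries 2s. The weight is 4 + 3 here and 3 + 3 in every other
    block.\<close>
  define f :: "('b, 'c) vtx \<Rightarrow> nat" where
    "f = (\<lambda>v. case v of
        XV b a \<Rightarrow> if b = b0 then if a = 2 * r + 1 \<or> a = 2 * r + 2 then 2 else 0 else if a = r then 3 else 0
      | YV b a \<Rightarrow> if a = (if b = b0 then r + 1 else r) then 3 else 0 | CV c \<Rightarrow> 0)"
  have idx: "idx v = r" if "f v \<noteq> 0" for v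
    using that by (auto simp: f_def idx_def split: vtx.splits if_splits)
  \<comment> \<open>No end of \<open>e\<close> carries weight, so every edge at a weighted vertex
    survives.\<close>
  have nb: "w \<in> neighbors (Es - {e}) v"
    if "f w \<noteq> 0" "w \<in> Vs" "v \<in> Vs" "joined w v \<or> joined v w" for v w
    using that r(2)[of w] idx[of w] by (auto simp: neighbors_def Es_iff)
  have A': "r < A" "r + 1 < A" "2 * r + 2 < A" using r(1) A D by auto
  have "drdf Vs (Es - {e}) f"
    unfolding drdf_def
  proof (intro conjI ballI impI)
    show "f ` Vs \<subseteq> {0, 1, 2, 3}" by (auto simp: f_def split: vtx.splits)
    show "\<exists>w\<in>neighbors (Es - {e}) v. 2 \<le> f w" if "f v = 1" for v
      using that by (auto simp: f_def split: vtx.splits if_splits)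
    fix v assume v: "v \<in> Vs" and 0: "f v = 0"
    have two: "2 \<le> card {u \<in> neighbors (Es - {e}) v. f u = 2}"
      if "joined (XV b0 (2 * r + 1)) v" "joined (XV b0 (2 * r + 2)) v"
    proof -
      have "{XV b0 (2 * r + 1), XV b0 (2 * r + 2)} \<subseteq> {u \<in> neighbors (Es - {e}) v. f u = 2}"
        using nb[of "XV b0 (2 * r + 1)" v] nb[of "XV b0 (2 * r + 2)" v] that v b0 A'
        by (auto simp: f_def)
      moreover have "finite {u \<in> neighbors (Es - {e}) v. f u = 2}"
        by (rule finite_subset[OF _ fin_Vs]) (auto simp: neighbors_def Es_iff)
      ultimately have "card {XV b0 (2 * r + 1), XV b0 (2 * r + 2) :: ('b, 'c) vtx} \<le>
          card {u \<in> neighbors (Es - {e}) v. f u = 2}" by (rule card_mono[rotated])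
      then show ?thesis by simp
    qed
    show "2 \<le> card {u \<in> neighbors (Es - {e}) v. f u = 2} \<or> (\<exists>w\<in>neighbors (Es - {e}) v. f w = 3)"
    proof (cases v)
      case (XV b a)
      let ?y = "YV b (if b = b0 then r + 1 else r)"
      have "joined v ?y"
        using 0 r(1) XV by (auto simp: f_def special_adj_def split: if_splits)
      then have "?y \<in> neighbors (Es - {e}) v"
        using v XV A' by (intro nb) (auto simp: f_def)
      then show ?thesis by (intro disjI2 bexI[of _ ?y]) (auto simp: f_def)
    next
      case (YV b a)
      show ?thesis
      proof (cases "b = b0")
        case True
        then show ?thesis
          using 0 YV r(1) by (intro disjI1 two) (auto simp: f_def special_adj_def)
      next
        case False
        then have "XV b r \<in> neighbors (Es - {e}) v"
          using v YV A' by (intro nb) (auto simp: f_def)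
        then show ?thesis using False by (intro disjI2 bexI[of _ "XV b r"]) (auto simp: f_def)
      qed
    next
      case (CV c)
      then show ?thesis using r(1) by (intro disjI1 two) auto
    qed
  qed
  then have "gamma_dR Vs (Es - {e}) \<le> sum f Vs" by (rule gamma_dR_le)
  also have "sum f Vs = (\<Sum>b \<in> Bs. if b = b0 then 7 else 6)"
  proof -
    have "sum f (X_of b0) = sum f {XV b0 (2 * r + 1), XV b0 (2 * r + 2)}"
      using A' by (intro sum.mono_neutral_right) (auto simp: X_of_def f_def split: if_splits)
    then have "sum f (X_of b0) = 4" by (simp add: f_def)
    moreover have "sum f (X_of b) = 3" if "b \<noteq> b0" for b
      using A' that by (auto simp: f_def sum_X_of)
    moreover have "sum f (Y_of b) = 3" for b
      using A' by (auto simp: f_def sum_Y_of)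
    moreover have "sum f (CV ` Cs) = 0" by (intro sum.neutral) (auto simp: f_def)
    ultimately show ?thesis unfolding sum_Vs by (auto intro!: sum.cong)
  qed
  also have "\<dots> = 6 * card Bs + 1"
  proof -
    have "(\<Sum>b \<in> Bs. if b = b0 then 7 else 6) = 7 + (\<Sum>b \<in> Bs - {b0}. 6 :: nat)"
      using fin_Bs b0 by (simp add: sum.remove)
    then show ?thesis using card.remove[OF fin_Bs b0] by simp
  qed
  finally show ?thesis .
qed

lemma special_edge: "{XV b0 0, YV b0 4} \<in> Es"
  using A D b0 by (auto simp: Es_iff special_adj_def)

text \<open>If \<open>sat\<close> holds then the minimum is at most \<open>6 * card Bs\<close>, a
  weight that \<open>cheap_drdf\<close> forbids once the edge between X vertex 0 and Y vertex 4 is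
  gone. Conversely \<open>weight_robust\<close> caps the minimum after a deletion at one more, so an
  increase means that the original minimum was at most \<open>6 * card Bs\<close>, which forces
  \<open>sat\<close>.\<close>

theorem bondage_iff_sat: "(\<exists>e \<in> Es. gamma_dR Vs Es < gamma_dR Vs (Es - {e})) \<longleftrightarrow> sat"
proof
  assume sat
  obtain f where f: "drdf Vs (Es - {{XV b0 0, YV b0 4}}) f"
    "gamma_dR Vs (Es - {{XV b0 0, YV b0 4}}) = sum f Vs"
    using gamma_dR_attained by blast
  then have "6 * card Bs < sum f Vs" using cheap_drdf[OF f(1)] by force
  then show "\<exists>e \<in> Es. gamma_dR Vs Es < gamma_dR Vs (Es - {e})"
    using special_edge weight_sat[OF \<open>sat\<close>] f(2) by (intro bexI) auto
next
  assume "\<exists>e \<in> Es. gamma_dR Vs Es < gamma_dR Vs (Es - {e})"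
  then obtain e where "e \<in> Es" "gamma_dR Vs Es < gamma_dR Vs (Es - {e})" by blast
  with weight_robust[of e] have "gamma_dR Vs Es \<le> 6 * card Bs" by simp
  moreover obtain f where "drdf Vs Es f" "gamma_dR Vs Es = sum f Vs"
    using gamma_dR_attained by blast
  ultimately show sat using cheap_drdf by auto
qed

end

section \<open>Bondage by a single edge, and renaming of vertices\<close>

lemma b_dR_le_1_iff:
  assumes "simple_graph V E" "E \<noteq> {}"
  shows "b_dR V E \<le> 1 \<longleftrightarrow> (\<exists>e \<in> E. gamma_dR V E < gamma_dR V (E - {e}))"
proof
  assume le: "b_dR V E \<le> 1"
  obtain B where B: "B \<subseteq> E" "card B = b_dR V E" "gamma_dR V E < gamma_dR V (E - B)"
    using b_dR_attained[OF assms] by blast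
  have "finite E" using assms(1) unfolding simple_graph_def by (meson finite_Pow_iff finite_subset PowI subsetI)
  then have "finite B" using B(1) finite_subset by blast
  moreover have "B \<noteq> {}" using B(3) by auto
  ultimately have "card B = 1" using B(2) le by (metis One_nat_def card_gt_0_iff le_antisym Suc_leI)
  then obtain e where "B = {e}" by (auto simp: card_1_singleton_iff)
  then show "\<exists>e \<in> E. gamma_dR V E < gamma_dR V (E - {e})" using B by auto
next
  assume "\<exists>e \<in> E. gamma_dR V E < gamma_dR V (E - {e})"
  then obtain e where "e \<in> E" "gamma_dR V E < gamma_dR V (E - {e})" by blast
  then show "b_dR V E \<le> 1" unfolding b_dR_def by (intro Least_le exI[of _ "{e}"]) auto
qed

lemma neighbors_image:
  assumes g: "inj_on g V" and E: "\<Union>E \<subseteq> V" and v: "v \<in> V"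
  shows "neighbors ((`) g ` E) (g v) = g ` neighbors E v"
proof (intro equalityI subsetI)
  fix u assume "u \<in> neighbors ((`) g ` E) (g v)"
  then obtain e where e: "e \<in> E" "{u, g v} = g ` e" by (auto simp: neighbors_def)
  then obtain w where w: "w \<in> e" "u = g w" by blast
  have "g ` e = g ` {w, v}" using e(2) w by auto
  then have "e = {w, v}" using inj_on_image_eq_iff[OF g, of e "{w, v}"] e(1) E v w(1) by auto
  then show "u \<in> g ` neighbors E v" using e(1) w by (auto simp: neighbors_def)
next
  fix u assume "u \<in> g ` neighbors E v"
  then obtain w where "u = g w" "{w, v} \<in> E" by (auto simp: neighbors_def)
  then show "u \<in> neighbors ((`) g ` E) (g v)"
    unfolding neighbors_def by (auto intro!: image_eqI[where x = "{w, v}"])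
qed

lemma drdf_image:
  assumes g: "inj_on g V" and E: "\<Union>E \<subseteq> V"
  shows "drdf (g ` V) ((`) g ` E) f \<longleftrightarrow> drdf V E (f \<circ> g)"
proof -
  have sub: "neighbors E v \<subseteq> V" for v using E by (auto simp: neighbors_def)
  have "card {u \<in> g ` neighbors E v. f u = 2} = card {u \<in> neighbors E v. f (g u) = 2}" for v
  proof -
    have "{u \<in> g ` neighbors E v. f u = 2} = g ` {u \<in> neighbors E v. f (g u) = 2}" by auto
    moreover have "inj_on g {u \<in> neighbors E v. f (g u) = 2}"
      using sub[of v] by (intro inj_on_subset[OF g]) auto
    ultimately show ?thesis by (simp add: card_image)
  qed
  then show ?thesis
    unfolding drdf_def by (simp add: neighbors_image[OF g E] image_image)
qed

lemma gamma_dR_image: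
  assumes g: "inj_on g V" and E: "\<Union>E \<subseteq> V"
  shows "gamma_dR (g ` V) ((`) g ` E) = gamma_dR V E"
proof (rule antisym)
  obtain f where f: "drdf V E f" "gamma_dR V E = sum f V" using gamma_dR_attained by blast
  let ?f = "f \<circ> inv_into V g"
  \<comment> \<open>The two functions agree on \<open>V\<close> only; this is enough because all
    neighbours lie in \<open>V\<close>.\<close>
  have eq: "(?f \<circ> g) v = f v" if "v \<in> V" for v using that g by simp
  have "neighbors E v \<subseteq> V" for v using E by (auto simp: neighbors_def)
  then have "{u \<in> neighbors E v. (?f \<circ> g) u = 2} = {u \<in> neighbors E v. f u = 2}" for v
    using eq by (metis (mono_tags, lifting) subset_iff)
  then have "drdf V E (?f \<circ> g)"
    using f(1) \<open>\<And>v. neighbors E v \<subseteq> V\<close> eq unfolding drdf_def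
    by (smt (verit) image_cong subset_iff)
  then have "gamma_dR (g ` V) ((`) g ` E) \<le> sum ?f (g ` V)"
    by (intro gamma_dR_le) (simp only: drdf_image[OF g E])
  also have "\<dots> = sum f V" using g eq by (simp add: sum.reindex)
  finally show "gamma_dR (g ` V) ((`) g ` E) \<le> gamma_dR V E" using f(2) by simp
next
  obtain f where f: "drdf (g ` V) ((`) g ` E) f" "gamma_dR (g ` V) ((`) g ` E) = sum f (g ` V)"
    using gamma_dR_attained by blast
  then have "gamma_dR V E \<le> sum (f \<circ> g) V"
    by (intro gamma_dR_le) (simp only: drdf_image[OF g E])
  then show "gamma_dR V E \<le> gamma_dR (g ` V) ((`) g ` E)" using f(2) g by (simp add: sum.reindex)
qed

lemma bondage_image:
  assumes g: "inj_on g V" and G: "simple_graph V E" "E \<noteq> {}"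
  shows "simple_graph (g ` V) ((`) g ` E)"
    and "bipartite V E \<Longrightarrow> bipartite (g ` V) ((`) g ` E)"
    and "b_dR (g ` V) ((`) g ` E) \<le> 1 \<longleftrightarrow> (\<exists>e \<in> E. gamma_dR V E < gamma_dR V (E - {e}))"
proof -
  have E: "\<Union>E \<subseteq> V" using G(1) by (auto simp: simple_graph_def)
  show s: "simple_graph (g ` V) ((`) g ` E)"
    using G(1) unfolding simple_graph_def
    by (auto simp: card_image inj_on_subset[OF g])
  show "bipartite (g ` V) ((`) g ` E)" if bip: "bipartite V E"
  proof -
    from bip obtain X Y where XY: "X \<union> Y = V" "X \<inter> Y = {}" "\<forall>e \<in> E. \<exists>x \<in> X. \<exists>y \<in> Y. e = {x, y}"
      unfolding bipartite_def by blast
    have "g ` X \<union> g ` Y = g ` V" using XY(1) by auto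
    moreover have "g ` X \<inter> g ` Y = {}" using XY(1,2) g by (auto simp: inj_on_def)
    moreover have "\<forall>e \<in> (`) g ` E. \<exists>x \<in> g ` X. \<exists>y \<in> g ` Y. e = {x, y}" using XY(3) by fastforce
    ultimately show ?thesis unfolding bipartite_def by blast
  qed
  have "inj_on ((`) g) E"
  proof (rule inj_onI)
    fix e e' assume "e \<in> E" "e' \<in> E" "g ` e = g ` e'"
    then show "e = e'" using E inj_on_image_eq_iff[OF g, of e e'] by auto
  qed
  then have del: "(`) g ` E - {g ` e} = (`) g ` (E - {e})" if "e \<in> E" for e
    using that by (auto simp: inj_on_def)
  have "gamma_dR (g ` V) ((`) g ` E - {g ` e}) = gamma_dR V (E - {e})" if "e \<in> E" for e
    unfolding del[OF that] using E by (intro gamma_dR_image[OF g]) auto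
  moreover have "(`) g ` E \<noteq> {}" using G(2) by simp
  ultimately show "b_dR (g ` V) ((`) g ` E) \<le> 1 \<longleftrightarrow> (\<exists>e \<in> E. gamma_dR V E < gamma_dR V (E - {e}))"
    using b_dR_le_1_iff[OF s] gamma_dR_image[OF g E] by auto
qed

section \<open>Accepting runs as satisfiable clauses\<close>

type_synonym action = "(nat \<times> nat list) \<times> (nat \<times> nat list \<times> move list)"

text \<open>A list rather than a set gives every action a number, which becomes a value of an
  unknown.\<close>

definition table_tm :: "nat \<Rightarrow> action list \<Rightarrow> nat \<Rightarrow> tm" where
  "table_tm k Ds q0 = \<lparr>tapes = k, trans = set Ds, start = q0, accepting = {}\<rparr>"

text \<open>Letting the machine idle once it has halted in an accepting state turns acceptance
  into the existence of a run that is longer than the time bound.\<close>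

lemma NP_long_run:
  assumes "L \<in> NP"
  obtains k Ds q0 and p :: "nat poly" where
    "\<And>q rs q' ws ds. ((q, rs), (q', ws, ds)) \<in> set Ds \<Longrightarrow> length rs = k"
    "\<And>x. x \<in> L \<longleftrightarrow> (\<exists>c. (step (table_tm k Ds q0) ^^ Suc (poly p (length x))) (init (table_tm k Ds q0) x) c)"
proof -
  obtain M where M: "wf_tm M" "poly_time M" "L = {x. accepts M x}"
    using assms by (auto simp: NP_def)
  obtain p where p: "runs_in_time M (poly p)" using M(2) by (auto simp: poly_time_def)
  define k where "k = tapes M"
  \<comment> \<open>States and symbols are arbitrary naturals. Idling is added only for those that a
    run can produce, which keeps the table finite.\<close>
  define \<Sigma> where "\<Sigma> = {0, 1, 2} \<union> (\<Union>(_, (_, ws, _)) \<in> trans M. set ws)"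
  define Q where "Q = insert (start M) ((\<lambda>(_, (q', _, _)). q') ` trans M)"
  define idle where "idle = (\<lambda>(q, rs). ((q, rs), (q, rs, replicate k MStay))) `
    {(q, rs) \<in> Q \<times> {rs. set rs \<subseteq> \<Sigma> \<and> length rs = k}. q \<in> accepting M \<and> (\<nexists>y. ((q, rs), y) \<in> trans M)}"
  have fin: "finite (trans M)" and len: "\<And>q rs q' ws ds. ((q, rs), (q', ws, ds)) \<in> trans M \<Longrightarrow>
      length rs = k \<and> length ws = k \<and> length ds = k"
    using M(1) by (auto simp: wf_tm_def k_def)
  have "finite \<Sigma>" "finite Q" using fin by (auto simp: \<Sigma>_def Q_def)
  then have "finite (Q \<times> {rs. set rs \<subseteq> \<Sigma> \<and> length rs = k})" by (simp add: finite_lists_length_eq)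
  then have "finite idle" unfolding idle_def by (rule finite_imageI[OF finite_subset[rotated]]) auto
  then obtain Ds where Ds: "set Ds = trans M \<union> idle" using fin finite_list by (metis finite_Un)
  define M' where "M' = table_tm k Ds (start M)"
  have M': "tapes M' = tapes M" "trans M' = trans M \<union> idle" by (auto simp: M'_def table_tm_def k_def Ds)
  have init: "init M' x = init M x" for x by (simp add: M'_def table_tm_def init_def)
  have sub: "step M' c c'" if "step M c c'" for c c'
    using that
  proof cases
    case (1 q T h q' ws ds)
    then show ?thesis using step.intros[of q T h M' q' ws ds] M' by simp
  qed
  have new: "halted M c \<and> fst c \<in> accepting M" if st: "step M' c c'" "\<not> step M c c'" for c c'
    using st(1)
  proof cases
    case (1 q T h q' ws ds)
    let ?rs = "map (\<lambda>j. T j (h j)) [0..<tapes M]"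
    have "((q, ?rs), (q', ws, ds)) \<notin> trans M"
      using st(2) step.intros[of q T h M q' ws ds] 1 M' by auto
    then have "((q, ?rs), (q', ws, ds)) \<in> idle" using 1 M' by auto
    then have "q \<in> accepting M" "\<nexists>y. ((q, ?rs), y) \<in> trans M" by (auto simp: idle_def)
    then show ?thesis using 1 by (auto simp: halted_def elim!: step.cases)
  qed
  define good where "good = (\<lambda>c :: config. fst c \<in> Q \<and> (\<forall>j<k. \<forall>i. fst (snd c) j i \<in> \<Sigma>))"
  have good_init: "good (init M x)" for x
    by (auto simp: good_def init_def Q_def \<Sigma>_def tape_of_def)
  have good_step: "good c'" if "step M c c'" "good c" for c c'
    using that(1)
  proof cases
    case (1 q T h q' ws ds)
    have "set ws \<subseteq> \<Sigma>" using 1(3) by (force simp: \<Sigma>_def)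
    then have "ws ! j \<in> \<Sigma>" if "j < k" for j using that len[OF 1(3)] by auto
    moreover have "q' \<in> Q" using 1(3) by (force simp: Q_def)
    ultimately show ?thesis using that(2) 1 by (auto simp: good_def k_def)
  qed
  have good_run: "good c" if "(step M)\<^sup>*\<^sup>* (init M x) c" for x c
    using that by (induction rule: rtranclp_induct) (auto intro: good_init good_step)
  have idle: "step M' c c" if "good c" "halted M c" "fst c \<in> accepting M" for c
  proof -
    obtain q T h where c: "c = (q, T, h)" by (metis prod_cases3)
    let ?rs = "map (\<lambda>j. T j (h j)) [0..<tapes M']"
    let ?ds = "replicate k MStay"
    have "\<nexists>y. ((q, ?rs), y) \<in> trans M"
      using that(2) step.intros[of q T h M] unfolding halted_def c M' by fastforce
    then have "((q, ?rs), (q, ?rs, ?ds)) \<in> idle"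
      using that c M' unfolding idle_def by (auto simp: good_def k_def intro!: image_eqI[where x = "(q, ?rs)"])
    then have "step M' (q, T, h) (q, (\<lambda>j. if j < tapes M' then (T j)(h j := ?rs ! j) else T j),
       (\<lambda>j. if j < tapes M' then h j + shift (?ds ! j) else h j))"
      using M' by (intro step.intros) auto
    moreover have "(\<lambda>j. if j < tapes M' then (T j)(h j := ?rs ! j) else T j) = T"
      "(\<lambda>j. if j < tapes M' then h j + shift (?ds ! j) else h j) = h"
      by (auto simp: fun_eq_iff k_def M')
    ultimately show ?thesis using c by simp
  qed
  have "x \<in> L \<longleftrightarrow> (\<exists>c. (step M' ^^ Suc (poly p (length x))) (init M' x) c)" for x
  proof
    assume "x \<in> L"
    then obtain c where c: "(step M)\<^sup>*\<^sup>* (init M x) c" "halted M c" "fst c \<in> accepting M"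
      unfolding M(3) accepts_def by blast
    then obtain n where n: "(step M ^^ n) (init M x) c" using rtranclp_imp_relpowp by fast
    then have "n \<le> poly p (length x)" using p unfolding runs_in_time_def by blast
    moreover have "(step M' ^^ n) (init M x) c"
      using relpowp_mono[of "step M" "step M'" n "init M x" c] sub n by blast
    moreover have "(step M' ^^ i) c c" for i
      using idle[OF good_run[OF c(1)] c(2,3)] by (induction i) auto
    ultimately have "(step M' ^^ (n + (Suc (poly p (length x)) - n))) (init M x) c"
      by (intro relpowp_trans)
    moreover have "n + (Suc (poly p (length x)) - n) = Suc (poly p (length x))"
      using \<open>n \<le> poly p (length x)\<close> by simp
    ultimately show "\<exists>c. (step M' ^^ Suc (poly p (length x))) (init M' x) c"
      unfolding init by metis
  next
    let ?n = "Suc (poly p (length x))"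
    assume "\<exists>c. (step M' ^^ ?n) (init M' x) c"
    then obtain c where c: "(step M' ^^ ?n) (init M x) c" unfolding init by blast
    obtain f where f: "f 0 = init M x" "\<And>i. i < ?n \<Longrightarrow> step M' (f i) (f (Suc i))"
      using c unfolding relpowp_fun_conv by blast
    \<comment> \<open>The original machine cannot make \<open>?n\<close> steps, so some step is an
      idle one; the first of these leaves a reachable accepting halted configuration.\<close>
    have "\<exists>i<?n. \<not> step M (f i) (f (Suc i))"
    proof (rule ccontr)
      assume "\<not> ?thesis"
      then have "(step M ^^ ?n) (init M x) (f ?n)"
        unfolding relpowp_fun_conv using f(1) by blast
      then have "?n \<le> poly p (length x)" using p unfolding runs_in_time_def by blast
      then show False by simp
    qed
    then obtain i where i: "i < ?n" "\<not> step M (f i) (f (Suc i))"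
      "\<And>i'. i' < i \<Longrightarrow> step M (f i') (f (Suc i'))"
      using exists_least_iff[of "\<lambda>i. i < ?n \<and> \<not> step M (f i) (f (Suc i))"] by (metis less_trans)
    have "(step M ^^ i) (init M x) (f i)" unfolding relpowp_fun_conv using f(1) i(3) by blast
    then have "(step M)\<^sup>*\<^sup>* (init M x) (f i)" by (rule relpowp_imp_rtranclp)
    then show "x \<in> L" using new[OF f(2)[OF i(1)] i(2)] unfolding M(3) accepts_def by blast
  qed
  moreover have "((q, rs), (q', ws, ds)) \<in> set Ds \<Longrightarrow> length rs = k" for q rs q' ws ds
    using len by (auto simp: Ds idle_def)
  ultimately show thesis using that[of Ds k p "start M"] unfolding M'_def by blast
qed

section \<open>Runs determined by their sequence of actions\<close>

locale action_table =
  fixes k :: nat and Ds :: "action list" and q0 :: nat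
  assumes len: "\<And>q rs q' ws ds. ((q, rs), (q', ws, ds)) \<in> set Ds \<Longrightarrow> length rs = k"
begin

definition src :: "nat \<Rightarrow> nat" where "src i = fst (fst (Ds ! i))"
definition rd :: "nat \<Rightarrow> nat \<Rightarrow> nat" where "rd i j = snd (fst (Ds ! i)) ! j"
definition tgt :: "nat \<Rightarrow> nat" where "tgt i = fst (snd (Ds ! i))"
definition wr :: "nat \<Rightarrow> nat \<Rightarrow> nat" where "wr i j = fst (snd (snd (Ds ! i))) ! j"
definition mv :: "nat \<Rightarrow> nat \<Rightarrow> move" where "mv i j = snd (snd (snd (Ds ! i))) ! j"

text \<open>States, heads and tapes are functions of the action sequence \<open>a\<close>, defined
  for illegitimate sequences too; legitimacy is checked separately in
  \<open>valid_run\<close>.\<close>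

fun state_at :: "(nat \<Rightarrow> nat) \<Rightarrow> nat \<Rightarrow> nat" where
  "state_at a 0 = q0"
| "state_at a (Suc t) = tgt (a t)"

fun head_at :: "(nat \<Rightarrow> nat) \<Rightarrow> nat \<Rightarrow> nat \<Rightarrow> int" where
  "head_at a 0 j = 0"
| "head_at a (Suc t) j = (if j < k then head_at a t j + shift (mv (a t) j) else head_at a t j)"

fun tape_at :: "bool list \<Rightarrow> (nat \<Rightarrow> nat) \<Rightarrow> nat \<Rightarrow> nat \<Rightarrow> int \<Rightarrow> nat" where
  "tape_at x a 0 j = (if j = 0 then tape_of x else (\<lambda>_. 0))"
| "tape_at x a (Suc t) j =
     (if j < k then (tape_at x a t j)(head_at a t j := wr (a t) j) else tape_at x a t j)"

definition valid_run :: "bool list \<Rightarrow> nat \<Rightarrow> (nat \<Rightarrow> nat) \<Rightarrow> bool" where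
  "valid_run x n a \<longleftrightarrow> (\<forall>t<n. a t < length Ds \<and> src (a t) = state_at a t \<and>
     (\<forall>j<k. rd (a t) j = tape_at x a t j (head_at a t j)))"

lemma step_table_iff:
  "step (table_tm k Ds q0) (q, T, h) c' \<longleftrightarrow>
    (\<exists>i<length Ds. src i = q \<and> (\<forall>j<k. rd i j = T j (h j)) \<and>
       c' = (tgt i, (\<lambda>j. if j < k then (T j)(h j := wr i j) else T j),
          (\<lambda>j. if j < k then h j + shift (mv i j) else h j)))" (is "?l \<longleftrightarrow> ?r")
proof
  assume ?l
  then show ?r
  proof cases
    case (1 q' ws ds)
    then obtain i where i: "i < length Ds" "Ds ! i = ((q, map (\<lambda>j. T j (h j)) [0..<k]), (q', ws, ds))"
      by (auto simp: table_tm_def in_set_conv_nth)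
    then show ?r using 1
      by (intro exI[of _ i]) (simp add: src_def rd_def tgt_def wr_def mv_def table_tm_def cong: if_cong)
  qed
next
  assume ?r
  then obtain i where i: "i < length Ds" "src i = q" "\<forall>j<k. rd i j = T j (h j)"
    "c' = (tgt i, (\<lambda>j. if j < k then (T j)(h j := wr i j) else T j),
          (\<lambda>j. if j < k then h j + shift (mv i j) else h j))" by blast
  obtain q1 rs q' ws ds where Ds: "Ds ! i = ((q1, rs), (q', ws, ds))" by (metis surj_pair)
  then have mem: "((q1, rs), (q', ws, ds)) \<in> set Ds" using i(1) by (metis nth_mem)
  have "rs = map (\<lambda>j. T j (h j)) [0..<k]"
    using i(3) len[OF mem] by (auto simp: rd_def Ds intro!: nth_equalityI)
  then have "((q, map (\<lambda>j. T j (h j)) [0..<tapes (table_tm k Ds q0)]), (q', ws, ds)) \<in>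
      trans (table_tm k Ds q0)"
    using mem i(2) by (auto simp: src_def Ds table_tm_def)
  from step.intros[of q T h "table_tm k Ds q0" q' ws ds, OF this] show ?l
    using i(4) by (simp add: tgt_def wr_def mv_def Ds table_tm_def cong: if_cong)
qed

lemma run_iff_valid_run:
  "(\<exists>c. (step (table_tm k Ds q0) ^^ n) (init (table_tm k Ds q0) x) c) \<longleftrightarrow> (\<exists>a. valid_run x n a)"
proof
  let ?M = "table_tm k Ds q0"
  let ?c = "\<lambda>a t. (state_at a t, tape_at x a t, head_at a t)"
  have c0: "?c a 0 = init ?M x" for a
    by (auto simp: init_def table_tm_def fun_eq_iff)
  {
    assume "\<exists>c. (step ?M ^^ n) (init ?M x) c"
    then obtain f where f: "f 0 = init ?M x" "\<And>t. t < n \<Longrightarrow> step ?M (f t) (f (Suc t))"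
      unfolding relpowp_fun_conv by auto
    let ?next = "\<lambda>i c. (tgt i, (\<lambda>j. if j < k then (fst (snd c) j)(snd (snd c) j := wr i j) else fst (snd c) j),
          (\<lambda>j. if j < k then snd (snd c) j + shift (mv i j) else snd (snd c) j))"
    let ?ok = "\<lambda>i c. i < length Ds \<and> src i = fst c \<and> (\<forall>j<k. rd i j = fst (snd c) j (snd (snd c) j))"
    have "\<exists>i. ?ok i (f t) \<and> f (Suc t) = ?next i (f t)" if "t < n" for t
      using f(2)[OF that] step_table_iff[of "fst (f t)" "fst (snd (f t))" "snd (snd (f t))" "f (Suc t)"]
      by auto
    then have "\<forall>t. \<exists>i. t < n \<longrightarrow> ?ok i (f t) \<and> f (Suc t) = ?next i (f t)" by blast
    from choice[OF this] obtain a
      where a: "\<And>t. t < n \<Longrightarrow> ?ok (a t) (f t) \<and> f (Suc t) = ?next (a t) (f t)" by blast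
    have "t \<le> n \<Longrightarrow> f t = ?c a t" for t
    proof (induction t)
      case 0
      show ?case unfolding f(1) c0 ..
    next
      case (Suc t)
      then have "f t = ?c a t" "t < n" by auto
      then show ?case using a[of t] by (auto simp: fun_eq_iff)
    qed
    then show "\<exists>a. valid_run x n a"
      using a unfolding valid_run_def by (intro exI[of _ a]) auto
  next
    assume "\<exists>a. valid_run x n a"
    then obtain a where a: "valid_run x n a" ..
    have "step ?M (?c a t) (?c a (Suc t))" if "t < n" for t
      using a that unfolding step_table_iff valid_run_def
      by (intro exI[of _ "a t"]) (auto simp: fun_eq_iff)
    then have "(step ?M ^^ n) (?c a 0) (?c a n)"
      unfolding relpowp_fun_conv by (intro exI[of _ "?c a"]) auto
    then show "\<exists>c. (step ?M ^^ n) (init ?M x) c" using c0 by metis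
  }
qed

text \<open>Together with \<open>tape_at_last_visit\<close> this eliminates the tape contents: a
  symbol read is determined by the last earlier visit to its cell, so cells require no
  unknowns.\<close>

lemma tape_at_unvisited:
  "(\<And>t'. t' < t \<Longrightarrow> head_at a t' j \<noteq> i) \<Longrightarrow> tape_at x a t j i = tape_at x a 0 j i"
proof (induction t)
  case (Suc t)
  have "head_at a t j \<noteq> i" using Suc.prems by blast
  moreover have "tape_at x a t j i = tape_at x a 0 j i" by (rule Suc.IH) (simp add: Suc.prems)
  ultimately show ?case by (simp del: tape_at.simps(1))
qed simp

lemma tape_at_last_visit:
  assumes "t' < t" "j < k" "head_at a t' j = i" "\<And>s. t' < s \<Longrightarrow> s < t \<Longrightarrow> head_at a s j \<noteq> i"
  shows "tape_at x a t j i = wr (a t') j"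
  using assms
proof (induction t)
  case (Suc t)
  show ?case
  proof (cases "t' = t")
    case False
    then have "tape_at x a t j i = wr (a t') j" using Suc by auto
    moreover have "head_at a t j \<noteq> i" using Suc.prems False by auto
    ultimately show ?thesis by simp
  qed (use Suc.prems in auto)
qed simp

text \<open>Hence positions shifted by the length \<open>T\<close> of the run are natural numbers
  below \<open>2 * T\<close>.\<close>

lemma head_at_bound: "\<bar>head_at a t j\<bar> \<le> int t"
proof (induction t)
  case (Suc t)
  have "\<bar>shift d\<bar> \<le> 1" for d by (cases d) auto
  with Suc show ?case by (auto simp: abs_le_iff intro: order_trans) (smt (verit))+
qed simp

text \<open>Unknowns are pairs \<open>(s, l)\<close>: for \<open>l = 0\<close> the action at time \<open>s\<close>, for \<open>l = Suc j\<close> the head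
  position on tape \<open>j\<close> at time \<open>s\<close>, shifted by \<open>T\<close>. The clause with parameters
  \<open>(\<kappa>, j, t', t, p, \<tau>)\<close> is the disjunction of the literals that unknown \<open>(s, l)\<close> has
  value \<open>a\<close>, as given below. The clauses with \<open>\<kappa> = 4\<close> say that a symbol read is the one written at the last
  visit; those with \<open>\<kappa> = 5\<close> handle the first visit to a cell.\<close>

definition literal :: "bool list \<Rightarrow> nat \<Rightarrow> nat \<times> nat \<times> nat \<times> nat \<times> nat \<times> nat \<Rightarrow> nat \<times> nat \<Rightarrow> nat \<Rightarrow> bool" where
  "literal x T = (\<lambda>(\<kappa>, j, t', t, p, \<tau>) (s, l) a.
     (\<kappa> = 0 \<longrightarrow> s = 0 \<and> l = 0 \<and> a < length Ds \<and> src a = q0) \<and>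
     (\<kappa> = 1 \<and> Suc t < T \<longrightarrow> s = t \<and> l = 0 \<and> a \<noteq> \<tau> \<or>
        s = Suc t \<and> l = 0 \<and> \<tau> < length Ds \<and> a < length Ds \<and> src a = tgt \<tau>) \<and>
     (\<kappa> = 2 \<and> j < k \<longrightarrow> s = 0 \<and> l = Suc j \<and> a = T) \<and>
     (\<kappa> = 3 \<and> j < k \<and> Suc t < T \<longrightarrow> s = t \<and> l = 0 \<and> a \<noteq> \<tau> \<or> s = t \<and> l = Suc j \<and> a \<noteq> p \<or>
        s = Suc t \<and> l = Suc j \<and> \<tau> < length Ds \<and> int a = int p + shift (mv \<tau> j)) \<and>
     (\<kappa> = 4 \<and> j < k \<and> t' < t \<and> t < T \<longrightarrow> s = t' \<and> l = 0 \<and> a \<noteq> \<tau> \<or> s = t' \<and> l = Suc j \<and> a \<noteq> p \<or>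
        s = t \<and> l = Suc j \<and> a \<noteq> p \<or> t' < s \<and> s < t \<and> l = Suc j \<and> a = p \<or>
        s = t \<and> l = 0 \<and> \<tau> < length Ds \<and> a < length Ds \<and> rd a j = wr \<tau> j) \<and>
     (\<kappa> = 5 \<and> j < k \<and> t < T \<longrightarrow> s = t \<and> l = Suc j \<and> a \<noteq> p \<or> s < t \<and> l = Suc j \<and> a = p \<or>
        s = t \<and> l = 0 \<and> a < length Ds \<and> rd a j = (if j = 0 \<and> T \<le> p then tape_of x (int (p - T)) else 0)))"

text \<open>One bound \<open>R\<close> covers times, shifted positions, action numbers, tapes and
  the six kinds of clauses. Unknowns that matter have \<open>l \<le> k\<close>, so by
  \<open>k + 2 \<le> R\<close> the pair \<open>(0, R - 1)\<close> is free to name the special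
  block.\<close>

lemma valid_run_iff_clauses:
  assumes T: "1 \<le> T" and R: "2 * T < R" "length Ds \<le> R" "k + 2 \<le> R" "6 \<le> R"
  shows "(\<exists>a. valid_run x T a) \<longleftrightarrow>
    (\<exists>\<alpha>. (\<forall>b. \<alpha> b < R) \<and> (\<forall>c \<in> {..<R} \<times> {..<R} \<times> {..<R} \<times> {..<R} \<times> {..<R} \<times> {..<R}.
       \<exists>b \<in> {..<R} \<times> {..<R} - {(0, R - 1)}. literal x T c b (\<alpha> b)))" (is "?l \<longleftrightarrow> ?r")
proof
  assume ?l
  then obtain a where a: "valid_run x T a" ..
  have a1: "a t < length Ds" "src (a t) = state_at a t"
    "j < k \<Longrightarrow> rd (a t) j = tape_at x a t j (head_at a t j)" if "t < T" for t j
    using a that by (auto simp: valid_run_def)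
  define H where "H t j = nat (head_at a t j + int T)" for t j
  have H: "int (H t j) = head_at a t j + int T" if "t < T" for t j
    using head_at_bound[of a t j] that by (simp add: H_def abs_le_iff)
  have HR: "H t j < R" if "t < T" for t j
    using H[OF that, of j] head_at_bound[of a t j] that R(1) by linarith
  have Heq: "head_at a s j = head_at a t j" if "s < T" "t < T" "H s j = H t j" for s t j
    using H[OF that(1), of j] H[OF that(2), of j] that(3) by simp
  define \<alpha> where "\<alpha> = (\<lambda>(s, l). if s < T then if l = 0 then a s else H s (l - 1) else 0)"
  have \<alpha>0: "\<alpha> (s, 0) = a s" and \<alpha>S: "\<alpha> (s, Suc j) = H s j" if "s < T" for s j
    using that by (auto simp: \<alpha>_def)
  have mem: "(s, l) \<in> {..<R} \<times> {..<R} - {(0, R - 1)}" if "s < T" "l \<le> k" for s l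
    using that R by auto
  show ?r
  proof (intro exI conjI allI ballI)
    show "\<alpha> b < R" for b
      using a1(1) R(2,4) HR by (cases b) (auto simp: \<alpha>_def intro: less_le_trans)
    fix c assume "c \<in> {..<R} \<times> {..<R} \<times> {..<R} \<times> {..<R} \<times> {..<R} \<times> {..<R}"
    obtain \<kappa> j t' t p \<tau> where c: "c = (\<kappa>, j, t', t, p, \<tau>)" by (metis prod_cases6)
    have "\<exists>s<T. \<exists>l\<le>k. literal x T c (s, l) (\<alpha> (s, l))"
    proof -
      \<comment> \<open>One case for each kind of clause whose guard holds; if no guard applies,
        every literal is true and the clause is trivial.\<close>
      consider "\<kappa> = 0" | "\<kappa> = 1" "Suc t < T" | "\<kappa> = 2" "j < k" | "\<kappa> = 3" "j < k" "Suc t < T"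
        | "\<kappa> = 4" "j < k" "t' < t" "t < T" | "\<kappa> = 5" "j < k" "t < T"
        | (triv) "\<forall>s l a. literal x T c (s, l) a \<or> \<kappa> = 0"
        unfolding c literal_def by fastforce
      then show ?thesis
      proof cases
        case 1
        then show ?thesis using T a1[of 0] \<alpha>0[of 0]
          by (intro exI[of _ 0]) (auto simp: c literal_def)
      next
        case 2
        then have "literal x T c (if a t \<noteq> \<tau> then t else Suc t, 0) (\<alpha> (if a t \<noteq> \<tau> then t else Suc t, 0))"
          using a1[of t] a1[of "Suc t"] \<alpha>0[of t] \<alpha>0[of "Suc t"] by (auto simp: c literal_def)
        then show ?thesis using 2 by (intro exI[of _ "if a t \<noteq> \<tau> then t else Suc t"]) auto
      next
        case 3
        then have "literal x T c (0, Suc j) (\<alpha> (0, Suc j))"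
          using \<alpha>S[of 0 j] T by (auto simp: c literal_def H_def)
        then show ?thesis using 3 T by (intro exI[of _ 0] conjI exI[of _ "Suc j"]) auto
      next
        case 4
        consider "a t \<noteq> \<tau>" | "H t j \<noteq> p" | "a t = \<tau>" "H t j = p" by blast
        then show ?thesis
        proof cases
          case 1
          then have "literal x T c (t, 0) (\<alpha> (t, 0))" using 4 \<alpha>0[of t] by (auto simp: c literal_def)
          then show ?thesis using 4 by (intro exI[of _ t] conjI exI[of _ 0]) auto
        next
          case 2
          then have "literal x T c (t, Suc j) (\<alpha> (t, Suc j))" using 4 \<alpha>S[of t j] by (auto simp: c literal_def)
          then show ?thesis using 4 by (intro exI[of _ t] conjI exI[of _ "Suc j"]) auto
        next
          case 3
          then have "int (H (Suc t) j) = int p + shift (mv \<tau> j)"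
            using H[of t j] H[of "Suc t" j] 4 by auto
          then have "literal x T c (Suc t, Suc j) (\<alpha> (Suc t, Suc j))"
            using 3 4 \<alpha>S[of "Suc t" j] a1(1)[of t] by (auto simp: c literal_def)
          then show ?thesis using 4 by (intro exI[of _ "Suc t"] conjI exI[of _ "Suc j"]) auto
        qed
      next
        case 5
        \<comment> \<open>In the case \<open>last\<close> all premises of the clause are met: the
          cell read at \<open>t\<close> was last visited at \<open>t'\<close>, with action
          \<open>\<tau>\<close>.\<close>
        consider "a t' \<noteq> \<tau>" | "H t' j \<noteq> p" | "H t j \<noteq> p" | s where "t' < s" "s < t" "H s j = p"
          | (last) "a t' = \<tau>" "H t' j = p" "H t j = p" "\<And>s. t' < s \<Longrightarrow> s < t \<Longrightarrow> H s j \<noteq> p" by blast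
        then show ?thesis
        proof cases
          case 1
          then have "literal x T c (t', 0) (\<alpha> (t', 0))" using 5 \<alpha>0[of t'] by (auto simp: c literal_def)
          then show ?thesis using 5 by (intro exI[of _ t'] conjI exI[of _ 0]) auto
        next
          case 2
          then have "literal x T c (t', Suc j) (\<alpha> (t', Suc j))"
            using 5 \<alpha>S[of t' j] by (auto simp: c literal_def)
          then show ?thesis using 5 by (intro exI[of _ t'] conjI exI[of _ "Suc j"]) auto
        next
          case 3
          then have "literal x T c (t, Suc j) (\<alpha> (t, Suc j))"
            using 5 \<alpha>S[of t j] by (auto simp: c literal_def)
          then show ?thesis using 5 by (intro exI[of _ t] conjI exI[of _ "Suc j"]) auto
        next
          case (4 s)
          then have "literal x T c (s, Suc j) (\<alpha> (s, Suc j))"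
            using 5 \<alpha>S[of s j] by (auto simp: c literal_def)
          then show ?thesis using 4 5 by (intro exI[of _ s] conjI exI[of _ "Suc j"]) auto
        next
          case last
          have "tape_at x a t j (head_at a t j) = wr (a t') j"
          proof (rule tape_at_last_visit)
            show "head_at a t' j = head_at a t j" using 5 last Heq[of t' t j] by auto
            show "head_at a s j \<noteq> head_at a t j" if "t' < s" "s < t" for s
              using 5 last that H[of s j] H[of t j] by fastforce
          qed (use 5 in auto)
          then have "literal x T c (t, 0) (\<alpha> (t, 0))"
            using 5 last \<alpha>0[of t] a1[of t] a1(1)[of t'] by (auto simp: c literal_def)
          then show ?thesis using 5 by (intro exI[of _ t] conjI exI[of _ 0]) auto
        qed
      next
        case 6
        consider "H t j \<noteq> p" | s where "s < t" "H s j = p"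
          | "H t j = p" "\<And>s. s < t \<Longrightarrow> H s j \<noteq> p" by blast
        then show ?thesis
        proof cases
          case 1
          then have "literal x T c (t, Suc j) (\<alpha> (t, Suc j))"
            using 6 \<alpha>S[of t j] by (auto simp: c literal_def)
          then show ?thesis using 6 by (intro exI[of _ t] conjI exI[of _ "Suc j"]) auto
        next
          case (2 s)
          then have "literal x T c (s, Suc j) (\<alpha> (s, Suc j))"
            using 6 \<alpha>S[of s j] by (auto simp: c literal_def)
          then show ?thesis using 2 6 by (intro exI[of _ s] conjI exI[of _ "Suc j"]) auto
        next
          case 3
          have "tape_at x a t j (head_at a t j) = tape_at x a 0 j (head_at a t j)"
          proof (rule tape_at_unvisited)
            show "head_at a s j \<noteq> head_at a t j" if "s < t" for s
              using 6 3 that H[of s j] H[of t j] by fastforce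
          qed
          also have "\<dots> = (if j = 0 \<and> T \<le> p then tape_of x (int (p - T)) else 0)"
            using H[of t j] 3 6 by (auto simp: tape_of_def of_nat_diff)
          finally have "literal x T c (t, 0) (\<alpha> (t, 0))"
            using 6 3 \<alpha>0[of t] a1[of t] by (auto simp: c literal_def)
          then show ?thesis using 6 by (intro exI[of _ t] conjI exI[of _ 0]) auto
        qed
      next
        case triv
        then show ?thesis using T a1[of 0] \<alpha>0[of 0]
          by (cases "\<kappa> = 0") (auto simp: c literal_def intro!: exI[of _ 0])
      qed
    qed
    then show "\<exists>b \<in> {..<R} \<times> {..<R} - {(0, R - 1)}. literal x T c b (\<alpha> b)" using mem by blast
  qed
next
  assume ?r
  obtain \<alpha> where \<alpha>: "\<And>b. \<alpha> b < R"
    "\<And>\<kappa> j t' t p \<tau>. \<kappa> < R \<Longrightarrow> j < R \<Longrightarrow> t' < R \<Longrightarrow> t < R \<Longrightarrow> p < R \<Longrightarrow> \<tau> < R \<Longrightarrow>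
       \<exists>s l. literal x T (\<kappa>, j, t', t, p, \<tau>) (s, l) (\<alpha> (s, l))"
  proof -
    from \<open>?r\<close> obtain \<alpha> where \<alpha>: "\<And>b. \<alpha> b < R"
      "\<And>c. c \<in> {..<R} \<times> {..<R} \<times> {..<R} \<times> {..<R} \<times> {..<R} \<times> {..<R} \<Longrightarrow>
         \<exists>b \<in> {..<R} \<times> {..<R} - {(0, R - 1)}. literal x T c b (\<alpha> b)" by blast
    have "\<exists>s l. literal x T (\<kappa>, j, t', t, p, \<tau>) (s, l) (\<alpha> (s, l))"
      if "\<kappa> < R" "j < R" "t' < R" "t < R" "p < R" "\<tau> < R" for \<kappa> j t' t p \<tau>
      using \<alpha>(2)[of "(\<kappa>, j, t', t, p, \<tau>)"] that by auto
    with \<alpha>(1) show ?thesis using that by blast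
  qed
  define a where "a t = \<alpha> (t, 0)" for t
  define H where "H t j = \<alpha> (t, Suc j)" for t j
  have c0: "a 0 < length Ds \<and> src (a 0) = q0"
    using \<alpha>(2)[of 0 0 0 0 0 0] R by (auto simp: literal_def a_def)
  \<comment> \<open>Here and below the clause is taken with the values that \<open>\<alpha>\<close>
    itself assigns as its parameters. This falsifies the literals that deny these values and leaves
    the conclusion.\<close>
  have c1: "a (Suc t) < length Ds \<and> src (a (Suc t)) = tgt (a t)" if "Suc t < T" for t
    using \<alpha>(2)[of 1 0 0 t 0 "a t"] R that \<alpha>(1)[of "(t, 0)"] by (auto simp: literal_def a_def)
  have c2: "H 0 j = T" if "j < k" for j
    using \<alpha>(2)[of 2 j 0 0 0 0] R that by (auto simp: literal_def H_def)
  have c3: "int (H (Suc t) j) = int (H t j) + shift (mv (a t) j)" if "Suc t < T" "j < k" for t j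
    using \<alpha>(2)[of 3 j 0 t "H t j" "a t"] R that \<alpha>(1)[of "(t, 0)"] \<alpha>(1)[of "(t, Suc j)"]
    by (auto simp: literal_def a_def H_def)
  have c4: "rd (a t) j = wr (a t') j" if h: "j < k" "t' < t" "t < T" "H t' j = H t j"
    "\<And>s. t' < s \<Longrightarrow> s < t \<Longrightarrow> H s j \<noteq> H t j" for t' t j
  proof -
    obtain s l where "literal x T (4, j, t', t, H t j, a t') (s, l) (\<alpha> (s, l))"
      using \<alpha>(2)[of 4 j t' t "H t j" "a t'"] R h(1-3) \<alpha>(1)[of "(t', 0)"] \<alpha>(1)[of "(t, Suc j)"]
      by (auto simp: a_def H_def)
    then show ?thesis using h by (auto simp: literal_def a_def H_def)
  qed
  have c5: "rd (a t) j = (if j = 0 \<and> T \<le> H t j then tape_of x (int (H t j - T)) else 0)"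
    if h: "j < k" "t < T" "\<And>s. s < t \<Longrightarrow> H s j \<noteq> H t j" for t j
  proof -
    obtain s l where "literal x T (5, j, 0, t, H t j, 0) (s, l) (\<alpha> (s, l))"
      using \<alpha>(2)[of 5 j 0 t "H t j" 0] R h(1,2) \<alpha>(1)[of "(t, Suc j)"]
      by (auto simp: H_def)
    then show ?thesis using h by (auto simp: literal_def a_def H_def)
  qed
  have H: "int (H t j) = head_at a t j + int T" if "t < T" "j < k" for t j
    using that
  proof (induction t)
    case 0
    then show ?case using c2 by simp
  next
    case (Suc t)
    then show ?case using c3[of t j] by simp
  qed
  have "valid_run x T a"
    unfolding valid_run_def
  proof (intro allI impI)
    fix t assume t: "t < T"
    have "a t < length Ds" "src (a t) = state_at a t" using c0 c1 t by (cases t; auto)+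
    moreover have "rd (a t) j = tape_at x a t j (head_at a t j)" if j: "j < k" for j
    proof (cases "\<exists>t'<t. H t' j = H t j")
      case True
      \<comment> \<open>The last earlier visit to the cell makes the literals for intermediate
        visits false.\<close>
      define t' where "t' = Max {t'. t' < t \<and> H t' j = H t j}"
      have fin: "finite {t'. t' < t \<and> H t' j = H t j}" by simp
      have t': "t' < t" "H t' j = H t j" using Max_in[OF fin] True by (auto simp: t'_def)
      have max: "H s j \<noteq> H t j" if "t' < s" "s < t" for s
      proof
        assume "H s j = H t j"
        then have "s \<le> t'" unfolding t'_def using that by (intro Max_ge[OF fin]) auto
        then show False using that by simp
      qed
      have "tape_at x a t j (head_at a t j) = wr (a t') j"
      proof (rule tape_at_last_visit)
        show "head_at a t' j = head_at a t j" using H[of t' j] H[of t j] t' t j by auto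
        show "head_at a s j \<noteq> head_at a t j" if "t' < s" "s < t" for s
          using max[OF that] H[of s j] H[of t j] that t j by fastforce
      qed (use t' j in auto)
      then show ?thesis using c4[OF j t'(1) t t'(2) max] by simp
    next
      case False
      then have "rd (a t) j = (if j = 0 \<and> T \<le> H t j then tape_of x (int (H t j - T)) else 0)"
        using c5[OF j t] by auto
      also have "\<dots> = tape_at x a 0 j (head_at a t j)"
      proof -
        have "head_at a t j = int (H t j) - int T" using H[OF t j] by simp
        then show ?thesis by (auto simp: tape_of_def of_nat_diff)
      qed
      also have "\<dots> = tape_at x a t j (head_at a t j)"
      proof (rule tape_at_unvisited[symmetric])
        show "head_at a s j \<noteq> head_at a t j" if "s < t" for s
          using False that t H[of s j] H[of t j] j by fastforce
      qed
      finally show ?thesis .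
    qed
    ultimately show "a t < length Ds \<and> src (a t) = state_at a t \<and>
      (\<forall>j<k. rd (a t) j = tape_at x a t j (head_at a t j))" by blast
  qed
  then show ?l by blast
qed

end

section \<open>The reduction\<close>

text \<open>With nonzero as truth, \<open>Times\<close>, \<open>Plus\<close> and \<open>Sum\<close>
  are conjunction, disjunction and bounded existential quantification.\<close>

definition holds :: "bool list \<Rightarrow> trm \<Rightarrow> (nat \<Rightarrow> nat) \<Rightarrow> bool" where
  "holds x e s \<longleftrightarrow> eval x e s \<noteq> 0"

definition tNot :: "trm \<Rightarrow> trm" where "tNot e = Monus (Const 1) e"
definition tLe :: "trm \<Rightarrow> trm \<Rightarrow> trm" where "tLe a b = tNot (Monus a b)"
definition tLt :: "trm \<Rightarrow> trm \<Rightarrow> trm" where "tLt a b = tLe (Plus a (Const 1)) b"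
definition tEq :: "trm \<Rightarrow> trm \<Rightarrow> trm" where "tEq a b = Times (tLe a b) (tLe b a)"
definition tImp :: "trm \<Rightarrow> trm \<Rightarrow> trm" where "tImp a b = Plus (tNot a) b"

lemma holds_simps [simp]:
  "holds x (tNot e) s \<longleftrightarrow> \<not> holds x e s"
  "holds x (Times a b) s \<longleftrightarrow> holds x a s \<and> holds x b s"
  "holds x (Plus a b) s \<longleftrightarrow> holds x a s \<or> holds x b s"
  "holds x (tImp a b) s \<longleftrightarrow> (holds x a s \<longrightarrow> holds x b s)"
  "holds x (tLe a b) s \<longleftrightarrow> eval x a s \<le> eval x b s"
  "holds x (tLt a b) s \<longleftrightarrow> eval x a s < eval x b s"
  "holds x (tEq a b) s \<longleftrightarrow> eval x a s = eval x b s"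
  "holds x (Sum v a b) s \<longleftrightarrow> (\<exists>i<eval x a s. holds x b (s(v := i)))"
  "holds x (Const n) s \<longleftrightarrow> n \<noteq> 0"
  by (auto simp: holds_def tNot_def tLe_def tLt_def tEq_def tImp_def)

text \<open>A finite ternary relation becomes a case distinction; this is how the transition table,
  which is fixed for the language, enters the terms.\<close>

fun tRel :: "(nat \<times> nat \<times> nat) list \<Rightarrow> trm \<Rightarrow> trm \<Rightarrow> trm \<Rightarrow> trm" where
  "tRel [] a b c = Const 0"
| "tRel ((i, j, l) # r) a b c =
     Plus (Times (tEq a (Const i)) (Times (tEq b (Const j)) (tEq c (Const l)))) (tRel r a b c)"

lemma holds_tRel [simp]:
  "holds x (tRel r a b c) s \<longleftrightarrow> (eval x a s, eval x b s, eval x c s) \<in> set r"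
  by (induction r a b c rule: tRel.induct) auto

lemma poly_term: "\<exists>e. \<forall>x s. eval x e s = poly p (s 0)" for p :: "nat poly"
proof (induction p rule: pCons_induct)
  case 0
  then show ?case by (intro exI[of _ "Const 0"]) simp
next
  case (pCons c p)
  then obtain e where "\<forall>x s. eval x e s = poly p (s 0)" by blast
  then show ?case by (intro exI[of _ "Plus (Const c) (Times (Var 0) e)"]) simp
qed

lemma digit_eq_iff: "a < R \<Longrightarrow> a' < R \<Longrightarrow> a + R * b = a' + R * b' \<longleftrightarrow> a = a' \<and> b = b'" for R :: nat
  by (metis add_diff_cancel_left' less_nat_zero_code mod_less mod_mult_self2 mult_cancel1)

lemma digit_less: "a < R \<Longrightarrow> b < M \<Longrightarrow> a + R * b < R * M" for R :: nat
proof -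
  assume "a < R" "b < M"
  then have "a + R * b < R + R * b" "R * Suc b \<le> R * M" by (auto simp del: mult_Suc_right)
  then show ?thesis by simp
qed

section \<open>Adjacency as an arithmetic term\<close>

locale reduction = action_table k Ds q0 for k Ds q0 +
  fixes T :: "nat \<Rightarrow> nat" and tT :: trm
  assumes eval_tT [simp]: "\<And>x s. eval x tT s = T (s 0)" and T_pos: "\<And>n. 1 \<le> T n"
begin

text \<open>Large enough for \<open>valid_run_iff_clauses\<close>; being at least 10, it also makes
  the width \<open>R ^ 4\<close> exceed \<open>R + 7\<close>.\<close>

definition R :: "nat \<Rightarrow> nat" where "R n = 2 * T n + (length Ds + k + 10)"
definition tR :: trm where "tR = Plus (Times (Const 2) tT) (Const (length Ds + k + 10))"
text \<open>With this width the \<open>R ^ 2\<close> blocks have \<open>R ^ 6\<close> vertices on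
  the X sides and on the Y sides, as many as there are clauses, so the three kinds can be numbered
  without gaps by residues modulo 3.\<close>

definition tA :: trm where "tA = Times (Times tR tR) (Times tR tR)"
definition tN :: trm where "tN = Times (Const 3) (Times (Times tR tR) tA)"

lemma eval_tR [simp]: "eval x tR s = R (s 0)"
  by (simp add: tR_def R_def)

lemma eval_tA [simp]: "eval x tA s = R (s 0) ^ 4"
  by (simp add: tA_def eval_nat_numeral algebra_simps)

lemma eval_tN [simp]: "eval x tN s = 3 * R (s 0) ^ 6"
  by (simp add: tN_def eval_nat_numeral algebra_simps)

lemma R_ge: "10 \<le> R n"
  by (simp add: R_def)

text \<open>Variables 0, 1 and 2 are taken by the input length and the two vertices to be
  compared.\<close>

abbreviation "vs \<equiv> Var 3"
abbreviation "vl \<equiv> Var 4"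
abbreviation "va \<equiv> Var 5"
abbreviation "va' \<equiv> Var 6"
abbreviation "v\<kappa> \<equiv> Var 7"
abbreviation "vj \<equiv> Var 8"
abbreviation "vt' \<equiv> Var 9"
abbreviation "vt \<equiv> Var 10"
abbreviation "vp \<equiv> Var 11"
abbreviation "v\<tau> \<equiv> Var 12"

definition startL where "startL = [(a, 0, 0 :: nat). a \<leftarrow> [0..<length Ds], src a = q0]"
definition nextL where
  "nextL = [(\<tau>, a, 0 :: nat). \<tau> \<leftarrow> [0..<length Ds], a \<leftarrow> [0..<length Ds], src a = tgt \<tau>]"
text \<open>The movement is stored increased by 1 to be a natural number: 0, 1 and 2 mean left, stay
  and right.\<close>

definition moveL where
  "moveL = [(j, \<tau>, nat (shift (mv \<tau> j) + 1)). j \<leftarrow> [0..<k], \<tau> \<leftarrow> [0..<length Ds]]"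
definition copyL where
  "copyL = [(j, \<tau>, a). j \<leftarrow> [0..<k], \<tau> \<leftarrow> [0..<length Ds], a \<leftarrow> [0..<length Ds], rd a j = wr \<tau> j]"
definition readL where "readL = [(j, a, rd a j). j \<leftarrow> [0..<k], a \<leftarrow> [0..<length Ds]]"

lemma set_tables:
  "(a, b, c) \<in> set startL \<longleftrightarrow> a < length Ds \<and> src a = q0 \<and> b = 0 \<and> c = 0"
  "(a, b, c) \<in> set nextL \<longleftrightarrow> a < length Ds \<and> b < length Ds \<and> src b = tgt a \<and> c = 0"
  "(a, b, c) \<in> set moveL \<longleftrightarrow> a < k \<and> b < length Ds \<and> int c = shift (mv b a) + 1"
  "(a, b, c) \<in> set copyL \<longleftrightarrow> a < k \<and> b < length Ds \<and> c < length Ds \<and> rd c a = wr b a"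
  "(a, b, c) \<in> set readL \<longleftrightarrow> a < k \<and> b < length Ds \<and> rd b a = c"
proof -
  have c: "int c = shift (mv b a) + 1 \<longleftrightarrow> c = nat (shift (mv b a) + 1)"
    by (cases "mv b a") auto
  show "(a, b, c) \<in> set moveL \<longleftrightarrow> a < k \<and> b < length Ds \<and> int c = shift (mv b a) + 1"
    unfolding c by (auto simp: moveL_def image_iff)
qed (auto simp: startL_def nextL_def copyL_def readL_def image_iff)

definition tMove :: trm where
  "tMove = Plus (Times (tRel moveL vj v\<tau> (Const 0)) (tEq (Plus va (Const 1)) vp))
    (Plus (Times (tRel moveL vj v\<tau> (Const 1)) (tEq va vp))
      (Times (tRel moveL vj v\<tau> (Const 2)) (tEq va (Plus vp (Const 1)))))"

lemma holds_tMove [simp]: "holds x tMove s \<longleftrightarrow>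
   s 8 < k \<and> s 12 < length Ds \<and> int (s 5) = int (s 11) + shift (mv (s 12) (s 8))"
  by (cases "mv (s 12) (s 8)") (auto simp: tMove_def set_tables)

definition tInit :: trm where
  "tInit = Times (Times (tEq vj (Const 0)) (tLe tT vp)) (Sym (Monus vp tT))"

lemma eval_tInit [simp]: "eval x tInit s =
    (if s 8 = 0 \<and> T (s 0) \<le> s 11 then tape_of x (int (s 11 - T (s 0))) else 0)"
  by (auto simp: tInit_def tEq_def tLe_def tNot_def)

definition lit_at :: "trm \<Rightarrow> trm \<Rightarrow> trm \<Rightarrow> trm" where
  "lit_at t l e = Times (tEq vs t) (Times (tEq vl l) e)"

definition tLit :: trm where
  "tLit =
    (let act = Const 0; hdj = Plus vj (Const 1); t1 = Plus vt (Const 1) in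
    Times (tImp (tEq v\<kappa> (Const 0)) (lit_at (Const 0) act (tRel startL va (Const 0) (Const 0))))
    (Times (tImp (Times (tEq v\<kappa> (Const 1)) (tLt t1 tT))
       (Plus (lit_at vt act (tNot (tEq va v\<tau>))) (lit_at t1 act (tRel nextL v\<tau> va (Const 0)))))
    (Times (tImp (Times (tEq v\<kappa> (Const 2)) (tLt vj (Const k))) (lit_at (Const 0) hdj (tEq va tT)))
    (Times (tImp (Times (tEq v\<kappa> (Const 3)) (Times (tLt vj (Const k)) (tLt t1 tT)))
       (Plus (lit_at vt act (tNot (tEq va v\<tau>))) (Plus (lit_at vt hdj (tNot (tEq va vp))) (lit_at t1 hdj tMove))))
    (Times (tImp (Times (tEq v\<kappa> (Const 4)) (Times (tLt vj (Const k)) (Times (tLt vt' vt) (tLt vt tT))))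
       (Plus (lit_at vt' act (tNot (tEq va v\<tau>))) (Plus (lit_at vt' hdj (tNot (tEq va vp)))
       (Plus (lit_at vt hdj (tNot (tEq va vp)))
       (Plus (Times (tLt vt' vs) (Times (tLt vs vt) (Times (tEq vl hdj) (tEq va vp))))
         (lit_at vt act (tRel copyL vj v\<tau> va)))))))
    (tImp (Times (tEq v\<kappa> (Const 5)) (Times (tLt vj (Const k)) (tLt vt tT)))
       (Plus (lit_at vt hdj (tNot (tEq va vp)))
       (Plus (Times (tLt vs vt) (Times (tEq vl hdj) (tEq va vp)))
         (lit_at vt act (tRel readL vj va tInit))))))))))"

lemma holds_tLit:
  "s 0 = length x \<Longrightarrow> holds x tLit s \<longleftrightarrow>
    literal x (T (length x)) (s 7, s 8, s 9, s 10, s 11, s 12) (s 3, s 4) (s 5)"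
  unfolding tLit_def literal_def Let_def lit_at_def
  by (simp add: set_tables split del: if_split cong: if_cong)

definition tB0 :: trm where "tB0 = Times (tEq vs (Const 0)) (tEq (Plus vl (Const 1)) tR)"

text \<open>For positive \<open>a\<close>, the equation \<open>a' = 1 + (a - 1) div 2\<close> says
  that \<open>2 * a'\<close> is \<open>a\<close> or \<open>a + 1\<close>, which expresses it without
  division.\<close>

definition tSpecial :: trm where
  "tSpecial = Plus (tEq va (Const 0))
     (Plus (Times (tLe (Const 1) va) (Times (tLe va (Const 6))
        (tNot (Plus (tEq (Plus va' va') va) (tEq (Plus va' va') (Plus va (Const 1)))))))
       (Times (tLe (Const 7) va) (tLt va' (Const 4))))"

lemma holds_tSpecial [simp]: "holds x tSpecial s \<longleftrightarrow> special_adj (s 5) (s 6)"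
  unfolding tSpecial_def special_adj_def by (simp, presburger)

text \<open>Base \<open>R\<close> with the least significant digit first; the last entry may exceed
  \<open>R\<close>, as the position in a block does.\<close>

definition digits :: "trm list \<Rightarrow> trm" where
  "digits es = foldr (\<lambda>a b. Plus a (Times tR b)) (butlast es) (last es)"

text \<open>Vertex numbers are decoded by search instead of division: the sums run through all
  components and compare the resulting numbers with \<open>u\<close> and \<open>v\<close>.\<close>

definition tHalf :: "trm \<Rightarrow> trm \<Rightarrow> trm" where
  "tHalf u v = Sum 3 tR (Sum 4 tR (Sum 5 tA (Times (tEq u (Times (Const 3) (digits [vs, vl, va])))
     (Plus
       (Sum 6 tA (Times (tEq v (Plus (Const 1) (Times (Const 3) (digits [vs, vl, va']))))
          (tImp tB0 tSpecial)))
       (Sum 7 tR (Sum 8 tR (Sum 9 tR (Sum 10 tR (Sum 11 tR (Sum 12 tR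
          (Times (tEq v (Plus (Const 2) (Times (Const 3) (digits [v\<kappa>, vj, vt', vt, vp, v\<tau>]))))
            (Plus (Times tB0 (Times (tLe (Const 1) va) (tLe va (Const 6))))
              (Times (tNot tB0) (Times (tLt va tR) tLit))))))))))))))"

definition tAdj :: trm where "tAdj = Plus (tHalf (Var 1) (Var 2)) (tHalf (Var 2) (Var 1))"

end

section \<open>Correctness of the reduction on a fixed input\<close>

locale reduction_input = reduction k Ds q0 T tT for k Ds q0 T tT + fixes x :: "bool list"
begin

abbreviation "r \<equiv> R (length x)"

definition Bs :: "(nat \<times> nat) set" where "Bs = {..<r} \<times> {..<r}"
definition Cs :: "(nat \<times> nat \<times> nat \<times> nat \<times> nat \<times> nat) set" where
  "Cs = {..<r} \<times> {..<r} \<times> {..<r} \<times> {..<r} \<times> {..<r} \<times> {..<r}"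

definition special_block :: "nat \<times> nat" where "special_block = (0, r - 1)"
definition width :: nat where "width = r ^ 4"

lemma Bs_iff [simp]: "(s, l) \<in> Bs \<longleftrightarrow> s < r \<and> l < r"
  by (simp add: Bs_def)

lemma Cs_iff [simp]:
  "(\<kappa>, j, t', t, p, \<tau>) \<in> Cs \<longleftrightarrow> \<kappa> < r \<and> j < r \<and> t' < r \<and> t < r \<and> p < r \<and> \<tau> < r"
  by (simp add: Cs_def)

lemma special_block_iff [simp]: "(s, l) = special_block \<longleftrightarrow> s = 0 \<and> Suc l = r"
  using R_ge[of "length x"] by (auto simp: special_block_def)

sublocale G: gadget_graph Bs special_block width r Cs "\<lambda>b a c. literal x (T (length x)) c b a"
proof
  have "10 \<le> r ^ 1" using R_ge by simp
  also have "r ^ 1 \<le> r ^ 3" using R_ge[of "length x"] by (intro power_increasing) auto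
  finally have "r * 10 \<le> r * r ^ 3" by (rule mult_le_mono2)
  then show "r + 7 \<le> width" using R_ge[of "length x"] by (simp add: width_def eval_nat_numeral)
  show "special_block \<in> Bs" using R_ge[of "length x"] by (simp add: special_block_def)
qed (use R_ge[of "length x"] in \<open>auto simp: Bs_def Cs_def\<close>)

text \<open>The residue modulo 3 is the kind of the vertex and the quotient lists its components in
  base \<open>r\<close>, in the order used by \<open>tHalf\<close>.\<close>

fun number :: "(nat \<times> nat, nat \<times> nat \<times> nat \<times> nat \<times> nat \<times> nat) vtx \<Rightarrow> nat" where
  "number (XV (s, l) a) = 3 * (s + r * (l + r * a))"
| "number (YV (s, l) a) = 1 + 3 * (s + r * (l + r * a))"
| "number (CV (\<kappa>, j, t', t, p, \<tau>)) = 2 + 3 * (\<kappa> + r * (j + r * (t' + r * (t + r * (p + r * \<tau>)))))"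

definition E :: "nat set set" where "E = (`) number ` G.Es"
definition n :: nat where "n = 3 * r ^ 6"

lemma inj_number: "inj_on number G.Vs"
proof (rule inj_onI)
  fix u v assume uv: "u \<in> G.Vs" "v \<in> G.Vs" "number u = number v"
  have three: "3 * a = 3 * b \<longleftrightarrow> a = b" "1 + 3 * a = 1 + 3 * b \<longleftrightarrow> a = b" "2 + 3 * a = 2 + 3 * b \<longleftrightarrow> a = b"
    "3 * a = 1 + 3 * b \<longleftrightarrow> False" "3 * a = 2 + 3 * b \<longleftrightarrow> False" "1 + 3 * a = 3 * b \<longleftrightarrow> False"
    "1 + 3 * a = 2 + 3 * b \<longleftrightarrow> False" "2 + 3 * a = 3 * b \<longleftrightarrow> False" "2 + 3 * a = 1 + 3 * b \<longleftrightarrow> False"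
    for a b :: nat
    by presburger+
  show "u = v"
    using uv
    by (cases u rule: number.cases; cases v rule: number.cases)
      (simp_all only: number.simps three G.Vs_simps Bs_iff Cs_iff digit_eq_iff)
qed

text \<open>Surjectivity comes from counting: \<open>r ^ 2\<close> blocks of
  \<open>2 * r ^ 4\<close> vertices and \<open>r ^ 6\<close> clauses make
  \<open>3 * r ^ 6\<close>.\<close>

lemma number_Vs: "number ` G.Vs = {..<n}"
proof (rule card_subset_eq)
  have l3: "s + r * (l + r * a) < r ^ 6" if "s < r" "l < r" "a < width" for s l a
  proof -
    have "s + r * (l + r * a) < r * (r * width)" using that by (intro digit_less)
    then show ?thesis by (simp add: width_def eval_nat_numeral)
  qed
  have l6: "\<kappa> + r * (j + r * (t' + r * (t + r * (p + r * \<tau>)))) < r ^ 6"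
    if "\<kappa> < r" "j < r" "t' < r" "t < r" "p < r" "\<tau> < r" for \<kappa> j t' t p \<tau>
  proof -
    have "\<kappa> + r * (j + r * (t' + r * (t + r * (p + r * \<tau>)))) < r * (r * (r * (r * (r * r))))"
      using that by (intro digit_less)
    then show ?thesis by (simp add: eval_nat_numeral)
  qed
  have less: "number v < n" if "v \<in> G.Vs" for v
  proof (cases v rule: number.cases)
    case (1 s l a)
    then show ?thesis using that l3[of s l a] by (auto simp: n_def)
  next
    case (2 s l a)
    then show ?thesis using that l3[of s l a] by (auto simp: n_def)
  next
    case (3 \<kappa> j t' t p \<tau>)
    then show ?thesis using that l6[of \<kappa> j t' t p \<tau>] by (auto simp: n_def)
  qed
  then show "number ` G.Vs \<subseteq> {..<n}" by auto
  have "card G.Vs = sum (\<lambda>_. 1) G.Vs" by simp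
  also have "\<dots> = (\<Sum>b \<in> Bs. card (G.X_of b) + card (G.Y_of b)) + card (CV ` Cs :: (nat \<times> nat, _) vtx set)"
    unfolding G.sum_Vs by simp
  also have "\<dots> = card Bs * (2 * width) + card Cs"
    by (simp add: G.X_of_def G.Y_of_def card_image inj_on_def)
  also have "\<dots> = n"
    by (simp add: Bs_def Cs_def card_cartesian_product n_def width_def eval_nat_numeral algebra_simps)
  finally show "card (number ` G.Vs) = card {..<n}" using card_image[OF inj_number] by simp
qed simp

text \<open>The variables of both vertices lie below 3 because the sums bind 3 to 12 and would
  capture larger ones.\<close>

lemma holds_tHalf:
  assumes "s 0 = length x" and uv: "s u' = u" "s v' = v" "u' < 3" "v' < 3"
  shows "holds x (tHalf (Var u') (Var v')) s \<longleftrightarrow>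
    (\<exists>p q. p \<in> G.Vs \<and> q \<in> G.Vs \<and> G.joined p q \<and> u = number p \<and> v = number q)" (is "?l \<longleftrightarrow> ?r")
proof -
  have "?l \<longleftrightarrow> (\<exists>s'<r. \<exists>l<r. \<exists>a<width. u = number (XV (s', l) a) \<and>
    ((\<exists>a'<width. v = number (YV (s', l) a') \<and> G.joined (XV (s', l) a) (YV (s', l) a')) \<or>
     (\<exists>\<kappa><r. \<exists>j<r. \<exists>t'<r. \<exists>t<r. \<exists>p<r. \<exists>\<tau><r. v = number (CV (\<kappa>, j, t', t, p, \<tau>)) \<and>
        G.joined (XV (s', l) a) (CV (\<kappa>, j, t', t, p, \<tau>)))))"
    using assms
    by (simp add: tHalf_def digits_def tB0_def holds_tLit if_bool_eq_disj width_def[symmetric])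
  \<comment> \<open>It remains to regroup the quantifiers over components into quantifiers over
    vertices.\<close>
  also have "\<dots> \<longleftrightarrow> ?r"
  proof
    assume ?r
    then obtain p q where pq: "p \<in> G.Vs" "q \<in> G.Vs" "G.joined p q" "u = number p" "v = number q" by blast
    obtain s' l a where p: "p = XV (s', l) a" using pq(3) by (cases p) auto
    show "\<exists>s'<r. \<exists>l<r. \<exists>a<width. u = number (XV (s', l) a) \<and>
      ((\<exists>a'<width. v = number (YV (s', l) a') \<and> G.joined (XV (s', l) a) (YV (s', l) a')) \<or>
       (\<exists>\<kappa><r. \<exists>j<r. \<exists>t'<r. \<exists>t<r. \<exists>p<r. \<exists>\<tau><r. v = number (CV (\<kappa>, j, t', t, p, \<tau>)) \<and>
        G.joined (XV (s', l) a) (CV (\<kappa>, j, t', t, p, \<tau>))))"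
    proof (intro exI conjI)
      show "s' < r" "l < r" "a < width" "u = number (XV (s', l) a)" using pq p by auto
      show "(\<exists>a'<width. v = number (YV (s', l) a') \<and> G.joined (XV (s', l) a) (YV (s', l) a')) \<or>
       (\<exists>\<kappa><r. \<exists>j<r. \<exists>t'<r. \<exists>t<r. \<exists>p<r. \<exists>\<tau><r. v = number (CV (\<kappa>, j, t', t, p, \<tau>)) \<and>
        G.joined (XV (s', l) a) (CV (\<kappa>, j, t', t, p, \<tau>)))"
      proof (cases q)
        case (YV b a')
        then have "b = (s', l)" "a' < width" using pq p by auto
        then show ?thesis using pq(3,5) p YV by (intro disjI1 exI[of _ a']) auto
      next
        case (CV c)
        obtain \<kappa> j t' t p' \<tau> where c: "c = (\<kappa>, j, t', t, p', \<tau>)" by (metis prod_cases6)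
        have "\<kappa> < r" "j < r" "t' < r" "t < r" "p' < r" "\<tau> < r" using pq(2) CV c by auto
        then show ?thesis using pq(3,5) p CV c by blast
      qed (use pq(3) p in auto)
    qed
  next
    assume "\<exists>s'<r. \<exists>l<r. \<exists>a<width. u = number (XV (s', l) a) \<and>
      ((\<exists>a'<width. v = number (YV (s', l) a') \<and> G.joined (XV (s', l) a) (YV (s', l) a')) \<or>
       (\<exists>\<kappa><r. \<exists>j<r. \<exists>t'<r. \<exists>t<r. \<exists>p<r. \<exists>\<tau><r. v = number (CV (\<kappa>, j, t', t, p, \<tau>)) \<and>
        G.joined (XV (s', l) a) (CV (\<kappa>, j, t', t, p, \<tau>))))"
    then show ?r
    proof (elim exE conjE)
      fix s' l a assume a: "s' < r" "l < r" "a < width" "u = number (XV (s', l) a)"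
        "(\<exists>a'<width. v = number (YV (s', l) a') \<and> G.joined (XV (s', l) a) (YV (s', l) a')) \<or>
         (\<exists>\<kappa><r. \<exists>j<r. \<exists>t'<r. \<exists>t<r. \<exists>p<r. \<exists>\<tau><r. v = number (CV (\<kappa>, j, t', t, p, \<tau>)) \<and>
          G.joined (XV (s', l) a) (CV (\<kappa>, j, t', t, p, \<tau>)))"
      have "XV (s', l) a \<in> G.Vs" using a by simp
      moreover have "\<exists>q \<in> G.Vs. G.joined (XV (s', l) a) q \<and> v = number q"
        using a(5)
      proof (elim disjE exE conjE)
        fix a' assume "a' < width" "v = number (YV (s', l) a')" "G.joined (XV (s', l) a) (YV (s', l) a')"
        then show ?thesis using a by (intro bexI[of _ "YV (s', l) a'"]) auto
      next
        fix \<kappa> j t' t p \<tau>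
        assume "\<kappa> < r" "j < r" "t' < r" "t < r" "p < r" "\<tau> < r" "v = number (CV (\<kappa>, j, t', t, p, \<tau>))"
          "G.joined (XV (s', l) a) (CV (\<kappa>, j, t', t, p, \<tau>))"
        then show ?thesis by (intro bexI[of _ "CV (\<kappa>, j, t', t, p, \<tau>)"]) auto
      qed
      ultimately show ?r using a(4) by blast
    qed
  qed
  finally show ?thesis .
qed

lemma edge_iff: "{u, v} \<in> E \<longleftrightarrow> eval x tAdj (env x u v) \<noteq> 0"
proof -
  let ?half = "\<lambda>u v. \<exists>p q. p \<in> G.Vs \<and> q \<in> G.Vs \<and> G.joined p q \<and> u = number p \<and> v = number q"
  have "{u, v} \<in> E \<longleftrightarrow> ?half u v \<or> ?half v u"
  proof -
    have 1: "?half u v \<or> ?half v u" if "{u, v} \<in> E"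
    proof -
      obtain e where e: "e \<in> G.Es" "{u, v} = number ` e" using \<open>{u, v} \<in> E\<close> unfolding E_def by blast
      then obtain p q where pq: "e = {p, q}" "p \<in> G.Vs" "q \<in> G.Vs" "G.joined p q"
        unfolding G.Es_def by blast
      then have "{u, v} = {number p, number q}" using e(2) by simp
      then show ?thesis unfolding doubleton_eq_iff using pq(2-) by blast
    qed
    have 2: "{number p, number q} \<in> E" if "p \<in> G.Vs" "q \<in> G.Vs" "G.joined p q" for p q
    proof -
      have "number ` {p, q} \<in> E" using that unfolding E_def by (intro imageI) (simp add: G.Es_iff)
      then show ?thesis by simp
    qed
    have 3: "{number q, number p} \<in> E" if "p \<in> G.Vs" "q \<in> G.Vs" "G.joined p q" for p q
      using 2[OF that] by (simp add: insert_commute)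
    show ?thesis
    proof
      assume "?half u v \<or> ?half v u"
      then show "{u, v} \<in> E" by (elim disjE exE conjE) (simp_all only: 2 3)
    qed (rule 1)
  qed
  also have "\<dots> \<longleftrightarrow> holds x tAdj (env x u v)"
    by (simp add: tAdj_def holds_tHalf[where u = u and v = v] holds_tHalf[where u = v and v = u] env_def)
  finally show ?thesis by (simp add: holds_def)
qed

lemma encode_instance:
  "encode (n, E, 1) = replicate (3 * r ^ 6) True @ [False] @
    concat (map (\<lambda>u. map (\<lambda>v. eval x tAdj (env x u v) \<noteq> 0) [0..<3 * r ^ 6]) [0..<3 * r ^ 6]) @ [True]"
  using edge_iff by (simp add: encode_def n_def)

lemma instance_correct:
  "(n, E, 1) \<in> DRBN_instances \<inter> bipartite_instances"
  "DRBN (n, E, 1) \<longleftrightarrow> (\<exists>a. valid_run x (T (length x)) a)"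
proof -
  have ne: "G.Es \<noteq> {}" using G.special_edge by blast
  note im = bondage_image[OF inj_number G.simple_graph_Es ne, folded E_def, unfolded number_Vs]
  have "E \<noteq> {}" using ne by (simp add: E_def)
  then show "(n, E, 1) \<in> DRBN_instances \<inter> bipartite_instances"
    using im(1) im(2)[OF G.bipartite_Es] by (simp add: DRBN_instances_def bipartite_instances_def)
  have "DRBN (n, E, 1) \<longleftrightarrow> G.sat" using im(3) G.bondage_iff_sat by (simp add: DRBN_def)
  also have "\<dots> \<longleftrightarrow> (\<exists>a. valid_run x (T (length x)) a)"
    unfolding G.sat_def
    using T_pos[of "length x"]
    by (subst valid_run_iff_clauses[where R = r]) (auto simp: R_def Bs_def Cs_def special_block_def)
  finally show "DRBN (n, E, 1) \<longleftrightarrow> (\<exists>a. valid_run x (T (length x)) a)" .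
qed

end

lemma DRBN_reduction:
  assumes "L \<in> NP"
  shows "\<exists>f. poly_time_computable f \<and>
    (\<forall>x. \<exists>i \<in> DRBN_instances \<inter> bipartite_instances. f x = encode i \<and> (x \<in> L \<longleftrightarrow> DRBN i))"
proof (rule NP_long_run[OF assms])
  fix k Ds q0 and p :: "nat poly"
  assume len: "\<And>q rs q' ws ds. ((q, rs), (q', ws, ds)) \<in> set Ds \<Longrightarrow> length rs = k"
    and L: "\<And>x. x \<in> L \<longleftrightarrow> (\<exists>c. (step (table_tm k Ds q0) ^^ Suc (poly p (length x))) (init (table_tm k Ds q0) x) c)"
  obtain tP where tP: "\<And>x s. eval x tP s = poly p (s 0)" using poly_term[of p] by blast
  let ?T = "\<lambda>n. Suc (poly p n)"
  let ?tT = "Plus tP (Const 1)"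
  interpret reduction k Ds q0 ?T ?tT
    by unfold_locales (auto simp: tP dest: len)
  let ?N = "\<lambda>n. 3 * R n ^ 6"
  let ?f = "\<lambda>x. replicate (?N (length x)) True @ [False] @
    concat (map (\<lambda>u. map (\<lambda>v. eval x tAdj (env x u v) \<noteq> 0) [0..<?N (length x)]) [0..<?N (length x)]) @ [True]"
  have "poly_time_computable ?f" by (rule poly_time_computable_matrix[OF eval_tN])
  moreover have "\<exists>i \<in> DRBN_instances \<inter> bipartite_instances. ?f x = encode i \<and> (x \<in> L \<longleftrightarrow> DRBN i)" for x
  proof -
    interpret I: reduction_input k Ds q0 ?T ?tT x ..
    have "?f x = encode (I.n, I.E, 1)" by (rule I.encode_instance[symmetric])
    moreover have "x \<in> L \<longleftrightarrow> DRBN (I.n, I.E, 1)"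
      unfolding I.instance_correct(2) L run_iff_valid_run ..
    ultimately show ?thesis by (intro bexI[OF _ I.instance_correct(1)] conjI)
  qed
  ultimately show ?thesis by blast
qed

text \<open>The reduction produces bipartite instances only, so it serves every instance set between
  the two. Injectivity of \<open>encode\<close> excludes that a no-instance shares its code with a
  yes-instance.\<close>

lemma NP_hard_DRBN:
  assumes I: "DRBN_instances \<inter> bipartite_instances \<subseteq> I" "I \<subseteq> DRBN_instances"
  shows "NP_hard encode I DRBN"
  unfolding NP_hard_def
proof
  fix L assume "L \<in> NP"
  from DRBN_reduction[OF this] obtain f where f: "poly_time_computable f"
    "\<And>x. \<exists>i \<in> DRBN_instances \<inter> bipartite_instances. f x = encode i \<and> (x \<in> L \<longleftrightarrow> DRBN i)" by blast
  have "f x \<in> encode ` I \<and> (x \<in> L \<longleftrightarrow> f x \<in> encode ` {i \<in> I. DRBN i})" for x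
  proof -
    obtain i where i: "i \<in> I" "f x = encode i" "x \<in> L \<longleftrightarrow> DRBN i" using f(2)[of x] I(1) by blast
    have "i' = i" if "i' \<in> I" "encode i' = encode i" for i'
      using inj_onD[OF encode_inj that(2)] that(1) i(1) I(2) by blast
    then have "DRBN i" if "f x \<in> encode ` {i \<in> I. DRBN i}" using that i(2) by force
    then show ?thesis using i by blast
  qed
  with f(1) show "\<exists>f. poly_time_computable f \<and>
      (\<forall>x. f x \<in> encode ` I \<and> (x \<in> L \<longleftrightarrow> f x \<in> encode ` {i \<in> I. DRBN i}))" by blast
qed

theorem theorem4p1:
  shows "NP_hard encode DRBN_instances DRBN \<and>
         NP_hard encode (DRBN_instances \<inter> bipartite_instances) DRBN"
  by (intro conjI NP_hard_DRBN) auto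

end
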